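(* Let $A\in\mathbb{C}^{n\times n}$ be normal with eigenvalues $\lambda_1,\dots,\lambda_n$ and associated orthonormal eigenvectors $x_1,\dots,x_n$. Let $1\le p$ with $2p\le n$, assume that the sets $\{\lambda_1,\dots,\lambda_p\}$ and $\{\lambda_{p+1},\dots,\lambda_n\}$ are disjoint, and put $\mathcal{X}=\mathrm{span}\{x_1,\dots,x_p\}$. Let $\mathcal{Y}\subset\mathbb{C}^n$ be a $p$-dimensional subspace with $\angle(\mathcal{X},\mathcal{Y})<\pi/2$, let $f$ be a function with $$\max_{j\in\{p+1,\dots,n\}}|f(\lambda_j)|<\min_{j\in\{1,\dots,p\}}|f(\lambda_j)|,$$ and let $\mathcal{Y}'=f(A)\mathcal{Y}$. Let $y_1,\dots,y_p$ be the basis of $\mathcal{Y}$ biorthogonal to $x_1,\dots,x_p$ (defined in the context). Let $\tau=\{i_1,\dots,i_t\}\subseteq\{1,\dots,p\}$ with $i_1<\cdots<i_t$, and let $$\mathcal{X}_\tau=\mathrm{span}\{x_{i_1},\dots,x_{i_t}\},\qquad \mathcal{Y}_\tau=\mathrm{span}\{y_{i_1},\dots,y_{i_t}\}.$$ Then $$\tan\Theta(\mathcal{X}_\tau,\mathcal{Y}')\prec_w \Phi_\tau\,\widehat{\Phi}_t\,\tan\Theta(\mathcal{X}_\tau,\mathcal{Y}_\tau),$$ where $\Phi_\tau=\big[|f(\lambda_{i_1})|^{-1},\dots,|f(\lambda_{i_t})|^{-1}\big]^{\downarrow}$, $\widehat{\Phi}=\big[|f(\lambda_{p+1})|,\dots,|f(\lambda_n)|\big]^{\downarrow}$,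 $\widehat{\Phi}_t$ is the tuple of the first $t$ components of $\widehat{\Phi}$, and products of tuples are componentwise.
   Context: Superscript $H$ denotes the conjugate transpose. For the normal matrix $A=\sum_j\lambda_jx_jx_j^H$, $f(A)=\sum_j f(\lambda_j)x_jx_j^H$. Principal angles: for subspaces $\mathcal{U},\mathcal{V}\subset\mathbb{C}^n$ with $\dim\mathcal{U}=s\le\dim\mathcal{V}$ and orthonormal basis matrices $U,V$, the cosines of the principal angles from $\mathcal{U}$ to $\mathcal{V}$ are the $s$ largest singular values of $V^HU$ (that is, all $\min$-many of them). Arranged as $\theta_1\ge\cdots\ge\theta_s$ in $[0,\pi/2]$, they form $\Theta(\mathcal{U},\mathcal{V})=[\theta_1,\dots,\theta_s]$, and $\tan\Theta(\mathcal{U},\mathcal{V})=[\tan\theta_1,\dots,\tan\theta_s]$. The largest one, $\theta_1$, is denoted $\angle(\mathcal{U},\mathcal{V})$. Biorthogonal basis: with $X=[x_1,\dots,x_p]$ and any orthonormal basis matrix $\widetilde{Y}\in\mathbb{C}^{n\times p}$ of $\mathcal{Y}$, the matrix $X^H\widetilde{Y}$ is invertible (because $\angle(\mathcal{X},\mathcal{Y})<\pi/2$), and $y_i=\widetilde{Y}c_i$ where $c_1,\dots,c_p$ are the columns of $(X^H\widetilde{Y})^{-1}$; thus $x_i^Hy_j=\delta_{ij}$ for $i,j\in\{1,\dots,p\}$. Majorization: for a real tuple $a=[a_1,\dots,a_d]$, $a^{\downarrow}$ is its rearrangement in decreasing (not strictly) order. For real tuples $a,b$ of length $d$, $a\prec_w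 b$ means $\sum_{i=1}^k a_i^{\downarrow}\le\sum_{i=1}^k b_i^{\downarrow}$ for all $k\in\{1,\dots,d\}$. *)

theory Defs
  imports
    "Jordan_Normal_Form.Schur_Decomposition"
    "Jordan_Normal_Form.VS_Connect"
    "Jordan_Normal_Form.Gauss_Jordan_Elimination"
begin

subsection \<open>Real tuples and weak majorization\<close>

definition decreasing_rearr :: "real list \<Rightarrow> real list" where
  "decreasing_rearr a = rev (sort a)"

definition weakly_majorized :: "real list \<Rightarrow> real list \<Rightarrow> bool" (infix \<open>\<prec>\<^sub>w\<close> 50) where
  "a \<prec>\<^sub>w b \<longleftrightarrow> length a = length b \<and>
     (\<forall>k\<in>{1..length a}.
        sum_list (take k (decreasing_rearr a)) \<le> sum_list (take k (decreasing_rearr b)))"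

definition tuple_mult :: "real list \<Rightarrow> real list \<Rightarrow> real list" (infixl \<open>\<odot>\<^sub>t\<close> 70) where
  "a \<odot>\<^sub>t b = map2 (*) a b"

subsection \<open>Subspaces of complex n-space\<close>

abbreviation cspace :: "nat \<Rightarrow> (complex, complex vec) module" where
  "cspace n \<equiv> module_vec TYPE(complex) n"

abbreviation cspan :: "nat \<Rightarrow> complex vec set \<Rightarrow> complex vec set" where
  "cspan n \<equiv> LinearCombinations.module.span class_ring (cspace n)"

abbreviation csubspace :: "nat \<Rightarrow> complex vec set \<Rightarrow> bool" where
  "csubspace n W \<equiv> VectorSpace.subspace class_ring W (cspace n)"

abbreviation cdim :: "nat \<Rightarrow> complex vec set \<Rightarrow> nat" where
  "cdim n W \<equiv> vectorspace.dim class_ring (cspace n\<lparr>carrier := W\<rparr>)"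

definition orthonormal_basis_mat :: "nat \<Rightarrow> complex mat \<Rightarrow> complex vec set \<Rightarrow> bool" where
  "orthonormal_basis_mat n U W \<longleftrightarrow> dim_row U = n \<and>
     mat_adjoint U * U = 1\<^sub>m (dim_col U) \<and> cspan n (set (cols U)) = W"

subsection \<open>Singular values and principal angles\<close>

text \<open>
  The square roots of the eigenvalues of \<open>B\<^sup>H B\<close> (real and nonnegative, hence \<open>Re\<close>),
  counted with algebraic multiplicity and in decreasing order. Only the first \<open>min\<close> of the
  two dimensions are kept; the remaining ones are the zeros forced by the shape of \<open>B\<close>.
\<close>

definition singular_values :: "complex mat \<Rightarrow> real list" where
  "singular_values B =
     take (min (dim_row B) (dim_col B))
       (rev (sorted_list_of_multiset
          (image_mset (\<lambda>z. sqrt (Re z)) (proots (char_poly (mat_adjoint B * B))))))"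

text \<open>
  The principal angles in decreasing order. Since \<open>arccos\<close> is decreasing, this reverses the order
  of the singular values. The singular values of \<open>V\<^sup>H U\<close> do not depend on which orthonormal
  bases are chosen.
\<close>

definition principal_angles :: "nat \<Rightarrow> complex vec set \<Rightarrow> complex vec set \<Rightarrow> real list" where
  "principal_angles n \<U> \<V> =
     (let U = (SOME U. orthonormal_basis_mat n U \<U>);
          V = (SOME V. orthonormal_basis_mat n V \<V>)
      in rev (map arccos (singular_values (mat_adjoint V * U))))"

definition tan_principal_angles :: "nat \<Rightarrow> complex vec set \<Rightarrow> complex vec set \<Rightarrow> real list" where
  "tan_principal_angles n \<U> \<V> = map tan (principal_angles n \<U> \<V>)"

definition largest_angle :: "nat \<Rightarrow> complex vec set \<Rightarrow> complex vec set \<Rightarrow> real" where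
  "largest_angle n \<U> \<V> = hd (principal_angles n \<U> \<V>)"

subsection \<open>Functions of normal matrices\<close>

definition normal_mat :: "complex mat \<Rightarrow> bool" where
  "normal_mat A \<longleftrightarrow> square_mat A \<and> A * mat_adjoint A = mat_adjoint A * A"

definition orthonormal_eigensystem ::
  "complex mat \<Rightarrow> (nat \<Rightarrow> complex) \<Rightarrow> (nat \<Rightarrow> complex vec) \<Rightarrow> bool" where
  "orthonormal_eigensystem A lam x \<longleftrightarrow>
     (\<forall>j<dim_row A. x j \<in> carrier_vec (dim_row A) \<and> A *\<^sub>v x j = lam j \<cdot>\<^sub>v x j) \<and>
     (\<forall>i<dim_row A. \<forall>j<dim_row A. x i \<bullet>c x j = (if i = j then 1 else 0))"

text \<open>
  \<open>rank_one_sum n c x\<close> is the sum of \<open>c\<^sub>j x\<^sub>j x\<^sub>j\<^sup>H\<close> over \<open>j < n\<close>, written entrywise. The matrix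
  \<open>f(A)\<close> does not depend on the orthonormal eigensystem, so \<open>THE\<close> is well-defined for normal \<open>A\<close>.
\<close>

definition rank_one_sum :: "nat \<Rightarrow> (nat \<Rightarrow> complex) \<Rightarrow> (nat \<Rightarrow> complex vec) \<Rightarrow> complex mat" where
  "rank_one_sum n c x = mat n n (\<lambda>(r, s). \<Sum>j<n. c j * (x j $ r) * cnj (x j $ s))"

definition normal_mat_fun :: "(complex \<Rightarrow> complex) \<Rightarrow> complex mat \<Rightarrow> complex mat" where
  "normal_mat_fun f A =
     (THE B. \<exists>lam x. orthonormal_eigensystem A lam x \<and>
                     B = rank_one_sum (dim_row A) (\<lambda>j. f (lam j)) x)"

subsection \<open>The biorthogonal basis\<close>

text \<open>
  The \<open>i\<close>-th basis vector is \<open>Yt c\<^sub>i\<close>, where \<open>c\<^sub>i\<close> is the \<open>i\<close>-th column of the inverse of \<open>X\<^sup>H Yt\<close>.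
  This is meaningful only if \<open>X\<^sup>H Yt\<close> is invertible; otherwise \<open>mat_inverse\<close> is \<open>None\<close>.
\<close>

definition biorthogonal_basis :: "complex mat \<Rightarrow> complex mat \<Rightarrow> nat \<Rightarrow> complex vec" where
  "biorthogonal_basis X Yt i = Yt *\<^sub>v col (the (mat_inverse (mat_adjoint X * Yt))) i"

end

theory Submission
  imports Defs
begin

text \<open>
  In coordinates with respect to the eigenvectors \<open>x\<^sub>j\<close>, the biorthogonal basis of \<open>\<Y>\<close> is the graph of a
  linear map: \<open>y\<^sub>a = x\<^sub>a + z\<^sub>a\<close> with \<open>z\<^sub>a\<close> in the span of \<open>x\<^sub>p, \<dots>, x\<^bsub>n-1\<^esub>\<close>. If \<open>Z\<^sub>\<tau>\<close> is the matrix with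
  columns \<open>z\<^sub>a\<close>, \<open>a \<in> \<tau>\<close>, then the tangents of the angles from \<open>\<X>\<^sub>\<tau>\<close> to \<open>\<Y>\<^sub>\<tau>\<close> are the singular values
  of \<open>Z\<^sub>\<tau>\<close>. Since \<open>f(A)\<close> is diagonal in these coordinates, \<open>\<Y>'\<close> contains the graph of
  \<open>W = F\<^sub>2 Z\<^sub>\<tau> F\<^sub>1\<^bsup>-1\<^esup>\<close>, where \<open>F\<^sub>1\<close> and \<open>F\<^sub>2\<close> are the diagonal matrices with entries \<open>f(\<lambda>\<^sub>a)\<close>, \<open>a \<in> \<tau>\<close>, and
  \<open>f(\<lambda>\<^sub>b)\<close>, \<open>b \<ge> p\<close>. Enlarging a subspace only decreases angles, so the tangents from \<open>\<X>\<^sub>\<tau>\<close> to \<open>\<Y>'\<close>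
  are bounded by the singular values of \<open>W\<close>, and these are weakly majorized by the products of
  the singular values of the three factors.

  Both of these steps are carried out on sums instead of on single singular values. Take principal
  vectors \<open>u\<^sub>i \<in> \<X>\<^sub>\<tau>\<close> for \<open>\<Y>'\<close> and let \<open>g\<^sub>i\<close> be the projection of \<open>u\<^sub>i\<close> onto \<open>\<Y>'\<close>, so that
  \<open>\<langle>g\<^sub>i, u\<^sub>j\<rangle> = \<delta>\<^sub>i\<^sub>j cos\<^sup>2\<theta>\<^sub>i\<close>. The vectors \<open>w\<^sub>i = g\<^sub>i / cos\<^sup>2\<theta>\<^sub>i - u\<^sub>i\<close> are orthogonal to \<open>\<X>\<^sub>\<tau>\<close> and to each
  other, with length \<open>tan \<theta>\<^sub>i\<close>. Any \<open>h \<in> \<Y>'\<close> satisfies \<open>\<langle>h, g\<^sub>j\<rangle> = \<langle>h, u\<^sub>j\<rangle>\<close>; for the point \<open>h = u\<^sub>i + W u\<^sub>i\<close>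
  of the graph this yields \<open>\<langle>W u\<^sub>i, w\<^sub>j\<rangle> = \<delta>\<^sub>i\<^sub>j tan\<^sup>2\<theta>\<^sub>i\<close> (lemma \<open>tangent_vectors\<close>). Hence
  \<open>\<Sum>\<^bsub>i<k\<^esub> tan \<theta>\<^sub>i = \<Sum>\<^bsub>i<k\<^esub> \<langle>W u\<^sub>i, w\<^sub>i / tan \<theta>\<^sub>i\<rangle>\<close>, which is the trace of \<open>W\<close> against a contraction of rank at
  most \<open>k\<close>. The same vectors for \<open>\<Y>\<^sub>\<tau>\<close> itself give the singular value decomposition of \<open>Z\<^sub>\<tau>\<close>.

  It remains to bound a trace of the form \<open>tr (\<alpha> D\<^sub>1 \<beta> D\<^sub>2 \<gamma> D\<^sub>3 \<delta>)\<close> with contractions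
  \<open>\<alpha>, \<beta>, \<gamma>, \<delta>\<close> and decreasing nonnegative diagonal matrices \<open>D\<^sub>i\<close> (lemma \<open>weighted_cycle_bound\<close>). If all the
  diagonals are indicators of initial segments, the trace is at most the smallest of the dimensions
  involved. The general case follows because decreasing sequences are nonnegative
  combinations of such indicators. This also covers complex phases of \<open>f(\<lambda>\<^sub>j)\<close>, which are absorbed into
  the contractions.
\<close>

section \<open>A trace inequality for products of contractions and diagonal matrices\<close>

text \<open>
  The matrix \<open>M\<close> has operator norm at most one as a map from \<open>\<ell>\<^sup>2(J)\<close> to \<open>\<ell>\<^sup>2(I)\<close>. The index sets are
  arguments, not part of a matrix type, because the trace inequality below restricts rows and columns
  to arbitrary initial segments.
\<close>

definition contraction :: "'a set \<Rightarrow> 'b set \<Rightarrow> ('a \<Rightarrow> 'b \<Rightarrow> complex) \<Rightarrow> bool" where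
  "contraction I J M \<longleftrightarrow>
     (\<forall>v. (\<Sum>i\<in>I. (cmod (\<Sum>j\<in>J. M i j * v j))\<^sup>2) \<le> (\<Sum>j\<in>J. (cmod (v j))\<^sup>2))"

lemma contractionD:
  "contraction I J M \<Longrightarrow> (\<Sum>i\<in>I. (cmod (\<Sum>j\<in>J. M i j * v j))\<^sup>2) \<le> (\<Sum>j\<in>J. (cmod (v j))\<^sup>2)"
  by (simp add: contraction_def)

lemma contraction_submatrix:
  fixes M :: "'a \<Rightarrow> 'b \<Rightarrow> complex"
  assumes "contraction I J M" "finite I" "finite J" "I' \<subseteq> I" "J' \<subseteq> J"
  shows "contraction I' J' M"
  unfolding contraction_def
proof
  fix v :: "'b \<Rightarrow> complex"
  define w where "w j = (if j \<in> J' then v j else 0)" for j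
  have eq: "(\<Sum>j\<in>J. M i j * w j) = (\<Sum>j\<in>J'. M i j * v j)" for i
    by (rule sum.mono_neutral_cong_right) (use assms in \<open>auto simp: w_def\<close>)
  have eq2: "(\<Sum>j\<in>J. (cmod (w j))\<^sup>2) = (\<Sum>j\<in>J'. (cmod (v j))\<^sup>2)"
    by (rule sum.mono_neutral_cong_right) (use assms in \<open>auto simp: w_def\<close>)
  have "(\<Sum>i\<in>I'. (cmod (\<Sum>j\<in>J'. M i j * v j))\<^sup>2) \<le> (\<Sum>i\<in>I. (cmod (\<Sum>j\<in>J'. M i j * v j))\<^sup>2)"
    by (rule sum_mono2) (use assms in auto)
  also have "\<dots> \<le> (\<Sum>j\<in>J'. (cmod (v j))\<^sup>2)"
    using contractionD[OF assms(1), of w] unfolding eq eq2 .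
  finally show "(\<Sum>i\<in>I'. (cmod (\<Sum>j\<in>J'. M i j * v j))\<^sup>2) \<le> (\<Sum>j\<in>J'. (cmod (v j))\<^sup>2)" .
qed

lemma contraction_scale_cols:
  assumes "contraction I J M" "\<And>j. j \<in> J \<Longrightarrow> cmod (e j) \<le> 1"
  shows "contraction I J (\<lambda>i j. M i j * e j)"
  unfolding contraction_def
proof
  fix v
  have "(\<Sum>i\<in>I. (cmod (\<Sum>j\<in>J. M i j * e j * v j))\<^sup>2) \<le> (\<Sum>j\<in>J. (cmod (e j * v j))\<^sup>2)"
    using contractionD[OF assms(1), of "\<lambda>j. e j * v j"] by (simp add: mult.assoc)
  also have "\<dots> \<le> (\<Sum>j\<in>J. (cmod (v j))\<^sup>2)"
    by (intro sum_mono power_mono) (use assms in \<open>auto simp: norm_mult intro: mult_left_le_one_le\<close>)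
  finally show "(\<Sum>i\<in>I. (cmod (\<Sum>j\<in>J. M i j * e j * v j))\<^sup>2) \<le> (\<Sum>j\<in>J. (cmod (v j))\<^sup>2)" .
qed

lemma cmod_sq_diff: "(cmod (a - b))\<^sup>2 = (cmod a)\<^sup>2 + (cmod b)\<^sup>2 - 2 * Re (cnj a * b)"
  unfolding cmod_power2 by (simp add: power2_eq_square algebra_simps)

text \<open>
  With \<open>v = M\<^sup>H w\<close>, expanding \<open>0 \<le> \<parallel>w - M v\<parallel>\<^sup>2\<close> gives \<open>2 \<parallel>v\<parallel>\<^sup>2 \<le> \<parallel>w\<parallel>\<^sup>2 + \<parallel>M v\<parallel>\<^sup>2 \<le> \<parallel>w\<parallel>\<^sup>2 + \<parallel>v\<parallel>\<^sup>2\<close>.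
\<close>

lemma contraction_adjoint:
  assumes "contraction I J M"
  shows "contraction J I (\<lambda>j i. cnj (M i j))"
  unfolding contraction_def
proof
  fix w
  define v where "v j = (\<Sum>i\<in>I. cnj (M i j) * w i)" for j
  define z where "z i = (\<Sum>j\<in>J. M i j * v j)" for i
  have "(\<Sum>i\<in>I. cnj (w i) * z i) = (\<Sum>i\<in>I. \<Sum>j\<in>J. cnj (w i) * M i j * v j)"
    by (simp add: z_def sum_distrib_left mult.assoc)
  also have "\<dots> = (\<Sum>j\<in>J. \<Sum>i\<in>I. cnj (w i) * M i j * v j)"
    by (rule sum.swap)
  also have "\<dots> = (\<Sum>j\<in>J. cnj (v j) * v j)"
    by (simp add: v_def sum_distrib_left sum_distrib_right cnj_sum mult_ac)
  also have "\<dots> = complex_of_real (\<Sum>j\<in>J. (cmod (v j))\<^sup>2)"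
    unfolding of_real_sum complex_norm_square by (simp only: mult.commute)
  finally have "Re (\<Sum>i\<in>I. cnj (w i) * z i) = (\<Sum>j\<in>J. (cmod (v j))\<^sup>2)"
    by (simp only: Re_complex_of_real)
  hence inner: "(\<Sum>i\<in>I. Re (cnj (w i) * z i)) = (\<Sum>j\<in>J. (cmod (v j))\<^sup>2)"
    by (simp only: Re_sum)
  have "0 \<le> (\<Sum>i\<in>I. (cmod (w i - z i))\<^sup>2)" by (simp add: sum_nonneg)
  also have "\<dots> = (\<Sum>i\<in>I. (cmod (w i))\<^sup>2) + (\<Sum>i\<in>I. (cmod (z i))\<^sup>2) - 2 * (\<Sum>j\<in>J. (cmod (v j))\<^sup>2)"
    by (simp only: cmod_sq_diff sum.distrib sum_subtractf inner flip: sum_distrib_left)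
  also have "(\<Sum>i\<in>I. (cmod (z i))\<^sup>2) \<le> (\<Sum>j\<in>J. (cmod (v j))\<^sup>2)"
    unfolding z_def by (rule contractionD[OF assms])
  finally show "(\<Sum>j\<in>J. (cmod (\<Sum>i\<in>I. cnj (M i j) * w i))\<^sup>2) \<le> (\<Sum>i\<in>I. (cmod (w i))\<^sup>2)"
    by (simp add: v_def)
qed

text \<open>
  Bessel's inequality. The adjoint sends \<open>w\<close> to a combination of orthogonal vectors of length at most
  one, so it is a contraction by Pythagoras.
\<close>

lemma contraction_orthogonal_rows:
  assumes "finite I"
    and orth: "\<And>i i'. i \<in> I \<Longrightarrow> i' \<in> I \<Longrightarrow> i \<noteq> i' \<Longrightarrow> (\<Sum>j\<in>J. M i j * cnj (M i' j)) = 0"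
    and len: "\<And>i. i \<in> I \<Longrightarrow> (\<Sum>j\<in>J. (cmod (M i j))\<^sup>2) \<le> 1"
  shows "contraction I J M"
proof -
  have "contraction J I (\<lambda>j i. cnj (M i j))"
    unfolding contraction_def
  proof
    fix w
    have "complex_of_real (\<Sum>j\<in>J. (cmod (\<Sum>i\<in>I. cnj (M i j) * w i))\<^sup>2)
        = (\<Sum>j\<in>J. (\<Sum>i\<in>I. cnj (M i j) * w i) * cnj (\<Sum>i'\<in>I. cnj (M i' j) * w i'))"
      unfolding of_real_sum complex_norm_square ..
    also have "\<dots> = (\<Sum>j\<in>J. \<Sum>i'\<in>I. \<Sum>i\<in>I. (M i' j * cnj (M i j)) * (w i * cnj (w i')))"
      by (simp add: cnj_sum sum_distrib_left sum_distrib_right mult_ac)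
    also have "\<dots> = (\<Sum>i'\<in>I. \<Sum>i\<in>I. \<Sum>j\<in>J. (M i' j * cnj (M i j)) * (w i * cnj (w i')))"
      by (subst sum.swap) (intro sum.cong refl sum.swap)
    also have "\<dots> = (\<Sum>i'\<in>I. \<Sum>i\<in>I. (\<Sum>j\<in>J. M i' j * cnj (M i j)) * (w i * cnj (w i')))"
      by (simp add: sum_distrib_right)
    also have "\<dots> = (\<Sum>i'\<in>I. \<Sum>i\<in>I. if i = i' then (\<Sum>j\<in>J. M i' j * cnj (M i' j)) * (w i' * cnj (w i')) else 0)"
      by (intro sum.cong refl) (auto simp: orth)
    also have "\<dots> = (\<Sum>i\<in>I. (\<Sum>j\<in>J. M i j * cnj (M i j)) * (w i * cnj (w i)))"
      using \<open>finite I\<close> by simp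
    also have "\<dots> = complex_of_real (\<Sum>i\<in>I. (\<Sum>j\<in>J. (cmod (M i j))\<^sup>2) * (cmod (w i))\<^sup>2)"
      by (simp add: complex_norm_square del: of_real_power)
    finally have "(\<Sum>j\<in>J. (cmod (\<Sum>i\<in>I. cnj (M i j) * w i))\<^sup>2)
        = (\<Sum>i\<in>I. (\<Sum>j\<in>J. (cmod (M i j))\<^sup>2) * (cmod (w i))\<^sup>2)"
      unfolding of_real_eq_iff .
    also have "\<dots> \<le> (\<Sum>i\<in>I. 1 * (cmod (w i))\<^sup>2)"
      by (intro sum_mono mult_right_mono len) auto
    finally show "(\<Sum>j\<in>J. (cmod (\<Sum>i\<in>I. cnj (M i j) * w i))\<^sup>2) \<le> (\<Sum>i\<in>I. (cmod (w i))\<^sup>2)"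
      by simp
  qed
  from contraction_adjoint[OF this] show ?thesis by simp
qed

text \<open>
  Each diagonal entry of a product of contractions has modulus at most one, and the trace has \<open>card I\<close> of
  them.
\<close>

lemma contraction_cycle_bound:
  assumes fin: "finite I" "finite A" "finite J" "finite B"
    and \<alpha>: "contraction I A \<alpha>" and \<beta>: "contraction A J \<beta>"
    and \<gamma>: "contraction J B \<gamma>" and \<delta>: "contraction B I \<delta>"
  shows "cmod (\<Sum>i\<in>I. \<Sum>a\<in>A. \<Sum>j\<in>J. \<Sum>b\<in>B. \<alpha> i a * \<beta> a j * \<gamma> j b * \<delta> b i) \<le> card I"
proof -
  have "cmod (\<Sum>a\<in>A. \<Sum>j\<in>J. \<Sum>b\<in>B. \<alpha> i a * \<beta> a j * \<gamma> j b * \<delta> b i) \<le> 1" if i: "i \<in> I" for i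
  proof -
    define v where "v b = \<delta> b i" for b
    define w where "w j = (\<Sum>b\<in>B. \<gamma> j b * v b)" for j
    define z where "z a = (\<Sum>j\<in>J. \<beta> a j * w j)" for a
    have "(\<Sum>a\<in>A. \<Sum>j\<in>J. \<Sum>b\<in>B. \<alpha> i a * \<beta> a j * \<gamma> j b * \<delta> b i) = (\<Sum>a\<in>A. \<alpha> i a * z a)"
      by (simp add: z_def w_def v_def sum_distrib_left mult_ac)
    moreover have "(cmod (\<Sum>a\<in>A. \<alpha> i a * z a))\<^sup>2 \<le> (\<Sum>i\<in>I. (cmod (\<Sum>a\<in>A. \<alpha> i a * z a))\<^sup>2)"
      using i fin by (intro member_le_sum) auto
    moreover have "\<dots> \<le> (\<Sum>a\<in>A. (cmod (z a))\<^sup>2)" by (rule contractionD[OF \<alpha>])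
    moreover have "\<dots> \<le> (\<Sum>j\<in>J. (cmod (w j))\<^sup>2)" unfolding z_def by (rule contractionD[OF \<beta>])
    moreover have "\<dots> \<le> (\<Sum>b\<in>B. (cmod (v b))\<^sup>2)" unfolding w_def by (rule contractionD[OF \<gamma>])
    moreover have "\<dots> \<le> 1"
    proof -
      have "v b = (\<Sum>i'\<in>I. \<delta> b i' * (if i' = i then 1 else 0))" for b
        using i fin by (simp add: v_def if_distrib cong: if_cong)
      hence "(\<Sum>b\<in>B. (cmod (v b))\<^sup>2) \<le> (\<Sum>i'\<in>I. (cmod (if i' = i then 1 else 0))\<^sup>2)"
        using contractionD[OF \<delta>, of "\<lambda>i'. if i' = i then 1 else 0"] by simp
      also have "\<dots> = (\<Sum>i'\<in>I. if i' = i then 1 else 0)" by (intro sum.cong) auto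
      also have "\<dots> = 1" using i fin by simp
      finally show ?thesis .
    qed
    ultimately have "(cmod (\<Sum>a\<in>A. \<Sum>j\<in>J. \<Sum>b\<in>B. \<alpha> i a * \<beta> a j * \<gamma> j b * \<delta> b i))\<^sup>2 \<le> 1"
      by (simp only:)
    thus ?thesis by (simp add: power2_le_iff_abs_le abs_square_le_1)
  qed
  hence "cmod (\<Sum>i\<in>I. \<Sum>a\<in>A. \<Sum>j\<in>J. \<Sum>b\<in>B. \<alpha> i a * \<beta> a j * \<gamma> j b * \<delta> b i) \<le> (\<Sum>i\<in>I. 1)"
    by (intro sum_norm_le)
  thus ?thesis by simp
qed

lemma sum_rotate4:
  fixes F :: "'i \<Rightarrow> 'a \<Rightarrow> 'j \<Rightarrow> 'b \<Rightarrow> complex"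
  shows "(\<Sum>i\<in>I. \<Sum>a\<in>A. \<Sum>j\<in>J. \<Sum>b\<in>B. F i a j b) = (\<Sum>a\<in>A. \<Sum>j\<in>J. \<Sum>b\<in>B. \<Sum>i\<in>I. F i a j b)"
proof -
  have "(\<Sum>i\<in>I. \<Sum>a\<in>A. \<Sum>j\<in>J. \<Sum>b\<in>B. F i a j b) = (\<Sum>a\<in>A. \<Sum>i\<in>I. \<Sum>j\<in>J. \<Sum>b\<in>B. F i a j b)"
    by (rule sum.swap)
  also have "\<dots> = (\<Sum>a\<in>A. \<Sum>j\<in>J. \<Sum>i\<in>I. \<Sum>b\<in>B. F i a j b)"
    by (intro sum.cong refl sum.swap)
  also have "\<dots> = (\<Sum>a\<in>A. \<Sum>j\<in>J. \<Sum>b\<in>B. \<Sum>i\<in>I. F i a j b)"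
    by (intro sum.cong refl sum.swap)
  finally show ?thesis .
qed

text \<open>
  The trace is invariant under cyclic permutation, so each of the four index sets can be the outer one.
\<close>

lemma contraction_cycle_bound_min:
  assumes fin: "finite I" "finite A" "finite J" "finite B"
    and \<alpha>: "contraction I A \<alpha>" and \<beta>: "contraction A J \<beta>"
    and \<gamma>: "contraction J B \<gamma>" and \<delta>: "contraction B I \<delta>"
  shows "cmod (\<Sum>i\<in>I. \<Sum>a\<in>A. \<Sum>j\<in>J. \<Sum>b\<in>B. \<alpha> i a * \<beta> a j * \<gamma> j b * \<delta> b i)
    \<le> min (card B) (min (card J) (min (card A) (card I)))"
    (is "cmod ?S \<le> _")
proof -
  have A: "?S = (\<Sum>a\<in>A. \<Sum>j\<in>J. \<Sum>b\<in>B. \<Sum>i\<in>I. \<beta> a j * \<gamma> j b * \<delta> b i * \<alpha> i a)"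
    by (subst sum_rotate4) (simp add: mult_ac)
  have J: "?S = (\<Sum>j\<in>J. \<Sum>b\<in>B. \<Sum>i\<in>I. \<Sum>a\<in>A. \<gamma> j b * \<delta> b i * \<alpha> i a * \<beta> a j)"
    by (subst A, subst sum_rotate4) (simp add: mult_ac)
  have B: "?S = (\<Sum>b\<in>B. \<Sum>i\<in>I. \<Sum>a\<in>A. \<Sum>j\<in>J. \<delta> b i * \<alpha> i a * \<beta> a j * \<gamma> j b)"
    by (subst J, subst sum_rotate4) (simp add: mult_ac)
  have "cmod ?S \<le> card I" by (rule contraction_cycle_bound[OF fin \<alpha> \<beta> \<gamma> \<delta>])
  moreover have "cmod ?S \<le> card A"
    unfolding A by (rule contraction_cycle_bound) (use assms in auto)
  moreover have "cmod ?S \<le> card J"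
    unfolding J by (rule contraction_cycle_bound) (use assms in auto)
  moreover have "cmod ?S \<le> card B"
    unfolding B by (rule contraction_cycle_bound) (use assms in auto)
  ultimately show ?thesis by (simp add: min_def)
qed

text \<open>
  Summation by parts: a decreasing nonnegative sequence is a nonnegative combination of indicators of
  initial segments, so it suffices to compare partial sums.
\<close>

lemma abel_dominated:
  fixes c g h :: "nat \<Rightarrow> real"
  assumes nonneg: "\<And>a. a < N \<Longrightarrow> 0 \<le> c a"
    and decr: "\<And>a b. a \<le> b \<Longrightarrow> b < N \<Longrightarrow> c b \<le> c a"
    and dom: "\<And>l. l \<le> N \<Longrightarrow> (\<Sum>a<l. g a) \<le> (\<Sum>a<l. h a)"
  shows "(\<Sum>a<N. c a * g a) \<le> (\<Sum>a<N. c a * h a)"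
proof -
  define e where "e a = h a - g a" for a
  have e: "0 \<le> (\<Sum>a<l. e a)" if "l \<le> N" for l
    using dom[OF that] by (simp add: e_def sum_subtractf)
  \<comment> \<open>The factor \<open>c l\<close> is kept to make the induction go through: it may be lowered to \<open>c (Suc l)\<close> in each step.\<close>
  have *: "c l * (\<Sum>a<Suc l. e a) \<le> (\<Sum>a<Suc l. c a * e a)" if "l < N" for l
    using that
  proof (induction l)
    case (Suc l)
    have "c (Suc l) * (\<Sum>a<Suc l. e a) \<le> c l * (\<Sum>a<Suc l. e a)"
      using Suc.prems by (intro mult_right_mono decr e) auto
    also have "\<dots> \<le> (\<Sum>a<Suc l. c a * e a)" using Suc by simp
    finally show ?case by (simp add: algebra_simps)
  qed simp
  have "0 \<le> (\<Sum>a<N. c a * e a)"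
  proof (cases N)
    case (Suc l)
    have "0 \<le> c l * (\<Sum>a<Suc l. e a)" using Suc by (intro mult_nonneg_nonneg nonneg e) auto
    also have "\<dots> \<le> (\<Sum>a<N. c a * e a)" using *[of l] Suc by simp
    finally show ?thesis .
  qed simp
  thus ?thesis by (simp add: e_def algebra_simps sum_subtractf)
qed

lemma sum_if_less:
  fixes x :: "nat \<Rightarrow> real"
  shows "(\<Sum>j<J. if j < K then x j else 0) = (\<Sum>j<min J K. x j)"
  by (subst sum.inter_filter[symmetric]) (auto intro: sum.cong)

lemma abel_dominated_prefix:
  fixes c g h :: "nat \<Rightarrow> real"
  assumes "\<And>a. a < N \<Longrightarrow> 0 \<le> c a" "\<And>a b. a \<le> b \<Longrightarrow> b < N \<Longrightarrow> c b \<le> c a"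
    and dom: "\<And>l. l \<le> N \<Longrightarrow> (\<Sum>a<l. g a) \<le> (\<Sum>a<min l K. h a)" and "K \<le> N"
  shows "(\<Sum>a<N. c a * g a) \<le> (\<Sum>a<K. c a * h a)"
proof -
  have "(\<Sum>a<N. c a * g a) \<le> (\<Sum>a<N. c a * (if a < K then h a else 0))"
    by (rule abel_dominated) (use assms in \<open>auto simp: sum_if_less\<close>)
  also have "\<dots> = (\<Sum>a<N. if a < K then c a * h a else 0)"
    by (intro sum.cong) auto
  also have "\<dots> = (\<Sum>a<K. c a * h a)" using \<open>K \<le> N\<close> by (simp only: sum_if_less min.absorb2)
  finally show ?thesis .
qed

text \<open>
  The hypothesis \<open>box\<close> is the conclusion for three indicators of initial segments. Abel summation is applied
  to one index after the other; each application replaces the minimum by a sum over a shorter segment.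
\<close>

lemma layer_cake3:
  fixes T :: "nat \<Rightarrow> nat \<Rightarrow> nat \<Rightarrow> real" and c s d :: "nat \<Rightarrow> real"
  assumes c: "\<And>a. a < t \<Longrightarrow> 0 \<le> c a" "\<And>a b. a \<le> b \<Longrightarrow> b < t \<Longrightarrow> c b \<le> c a"
    and s: "\<And>a. a < t \<Longrightarrow> 0 \<le> s a" "\<And>a b. a \<le> b \<Longrightarrow> b < t \<Longrightarrow> s b \<le> s a"
    and d: "\<And>a. a < m \<Longrightarrow> 0 \<le> d a" "\<And>a b. a \<le> b \<Longrightarrow> b < m \<Longrightarrow> d b \<le> d a"
    and "t \<le> m" "k \<le> t"
    and box: "\<And>L J M. L \<le> t \<Longrightarrow> J \<le> t \<Longrightarrow> M \<le> m \<Longrightarrow>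
        (\<Sum>a<L. \<Sum>j<J. \<Sum>b<M. T a j b) \<le> real (min M (min J (min L k)))"
  shows "(\<Sum>a<t. \<Sum>j<t. \<Sum>b<m. c a * s j * d b * T a j b) \<le> (\<Sum>i<k. c i * s i * d i)"
proof -
  have 1: "(\<Sum>b<m. d b * (\<Sum>a<L. \<Sum>j<J. T a j b)) \<le> (\<Sum>b<min J (min L k). d b)"
    if "L \<le> t" "J \<le> t" for L J
  proof -
    have "(\<Sum>b<m. d b * (\<Sum>a<L. \<Sum>j<J. T a j b)) \<le> (\<Sum>b<min J (min L k). d b * 1)"
    proof (rule abel_dominated_prefix[OF d])
      fix M assume "M \<le> m"
      have "(\<Sum>b<M. \<Sum>a<L. \<Sum>j<J. T a j b) = (\<Sum>a<L. \<Sum>j<J. \<Sum>b<M. T a j b)"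
        by (subst sum.swap) (intro sum.cong refl sum.swap)
      also have "\<dots> \<le> real (min M (min J (min L k)))" using that \<open>M \<le> m\<close> by (intro box)
      finally show "(\<Sum>b<M. \<Sum>a<L. \<Sum>j<J. T a j b) \<le> (\<Sum>b<min M (min J (min L k)). 1)" by simp
    qed (use \<open>t \<le> m\<close> \<open>k \<le> t\<close> in auto)
    thus ?thesis by simp
  qed
  have 2: "(\<Sum>j<t. s j * (\<Sum>a<L. \<Sum>b<m. d b * T a j b)) \<le> (\<Sum>j<min L k. s j * d j)"
    if "L \<le> t" for L
  proof (rule abel_dominated_prefix[OF s])
    fix J assume "J \<le> t"
    have "(\<Sum>j<J. \<Sum>a<L. \<Sum>b<m. d b * T a j b) = (\<Sum>b<m. d b * (\<Sum>a<L. \<Sum>j<J. T a j b))"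
    proof -
      have "(\<Sum>j<J. \<Sum>a<L. \<Sum>b<m. d b * T a j b) = (\<Sum>a<L. \<Sum>j<J. \<Sum>b<m. d b * T a j b)"
        by (rule sum.swap)
      also have "\<dots> = (\<Sum>a<L. \<Sum>b<m. \<Sum>j<J. d b * T a j b)"
        by (intro sum.cong refl sum.swap)
      also have "\<dots> = (\<Sum>b<m. \<Sum>a<L. \<Sum>j<J. d b * T a j b)" by (rule sum.swap)
      finally show ?thesis by (simp add: sum_distrib_left)
    qed
    also have "\<dots> \<le> (\<Sum>b<min J (min L k). d b)" by (rule 1[OF that \<open>J \<le> t\<close>])
    finally show "(\<Sum>j<J. \<Sum>a<L. \<Sum>b<m. d b * T a j b) \<le> (\<Sum>b<min J (min L k). d b)" .
  qed (use \<open>k \<le> t\<close> in auto)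
  have 3: "(\<Sum>a<t. c a * (\<Sum>j<t. s j * (\<Sum>b<m. d b * T a j b))) \<le> (\<Sum>i<k. c i * (s i * d i))"
  proof (rule abel_dominated_prefix[OF c])
    fix L assume "L \<le> t"
    have "(\<Sum>a<L. \<Sum>j<t. s j * (\<Sum>b<m. d b * T a j b)) = (\<Sum>j<t. s j * (\<Sum>a<L. \<Sum>b<m. d b * T a j b))"
      by (subst sum.swap) (simp add: sum_distrib_left)
    also have "\<dots> \<le> (\<Sum>j<min L k. s j * d j)" by (rule 2[OF \<open>L \<le> t\<close>])
    finally show "(\<Sum>a<L. \<Sum>j<t. s j * (\<Sum>b<m. d b * T a j b)) \<le> (\<Sum>j<min L k. s j * d j)" .
  qed (use \<open>k \<le> t\<close> in auto)
  thus ?thesis by (simp add: sum_distrib_left mult.assoc)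
qed

lemma Re_complex_of_real_mult: "Re (complex_of_real x * z) = x * Re z"
  by simp

text \<open>
  This is the trace form of Horn's inequality: a product of three diagonal matrices that are separated by
  contractions has Ky Fan norms bounded by the sums of the products of their sorted entries.
\<close>

lemma weighted_cycle_bound:
  fixes \<alpha> \<beta> \<gamma> \<delta> :: "nat \<Rightarrow> nat \<Rightarrow> complex" and c s d :: "nat \<Rightarrow> real"
  assumes c: "\<And>a. a < t \<Longrightarrow> 0 \<le> c a" "\<And>a b. a \<le> b \<Longrightarrow> b < t \<Longrightarrow> c b \<le> c a"
    and s: "\<And>a. a < t \<Longrightarrow> 0 \<le> s a" "\<And>a b. a \<le> b \<Longrightarrow> b < t \<Longrightarrow> s b \<le> s a"
    and d: "\<And>a. a < m \<Longrightarrow> 0 \<le> d a" "\<And>a b. a \<le> b \<Longrightarrow> b < m \<Longrightarrow> d b \<le> d a"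
    and "t \<le> m" "k \<le> t"
    and \<alpha>: "contraction {..<k} {..<t} \<alpha>" and \<beta>: "contraction {..<t} {..<t} \<beta>"
    and \<gamma>: "contraction {..<t} {..<m} \<gamma>" and \<delta>: "contraction {..<m} {..<k} \<delta>"
  shows "Re (\<Sum>i<k. \<Sum>a<t. \<Sum>j<t. \<Sum>b<m. (c a * s j * d b) * (\<alpha> i a * \<beta> a j * \<gamma> j b * \<delta> b i))
    \<le> (\<Sum>i<k. c i * s i * d i)"
proof -
  define T where "T a j b = Re (\<Sum>i<k. \<alpha> i a * \<beta> a j * \<gamma> j b * \<delta> b i)" for a j b
  let ?F = "\<lambda>i a j b. \<alpha> i a * \<beta> a j * \<gamma> j b * \<delta> b i"
  have exchange: "(\<Sum>i<k. \<Sum>a<t. \<Sum>j<t. \<Sum>b<m. (c a * s j * d b) * (\<alpha> i a * \<beta> a j * \<gamma> j b * \<delta> b i))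
     = (\<Sum>a<t. \<Sum>j<t. \<Sum>b<m. (c a * s j * d b) * (\<Sum>i<k. \<alpha> i a * \<beta> a j * \<gamma> j b * \<delta> b i))"
    unfolding sum_distrib_left by (rule sum_rotate4)
  have "Re (\<Sum>i<k. \<Sum>a<t. \<Sum>j<t. \<Sum>b<m. (c a * s j * d b) * (\<alpha> i a * \<beta> a j * \<gamma> j b * \<delta> b i))
     = (\<Sum>a<t. \<Sum>j<t. \<Sum>b<m. c a * s j * d b * T a j b)"
    unfolding exchange by (simp only: T_def Re_sum Re_complex_of_real_mult)
  also have "\<dots> \<le> (\<Sum>i<k. c i * s i * d i)"
  proof (rule layer_cake3)
    fix L J M assume *: "L \<le> t" "J \<le> t" "M \<le> m"
    have "(\<Sum>a<L. \<Sum>j<J. \<Sum>b<M. T a j b) = Re (\<Sum>i<k. \<Sum>a<L. \<Sum>j<J. \<Sum>b<M. \<alpha> i a * \<beta> a j * \<gamma> j b * \<delta> b i)"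
      unfolding T_def Re_sum[symmetric] by (subst sum_rotate4[where F = ?F]) (rule refl)
    also have "\<dots> \<le> cmod (\<Sum>i<k. \<Sum>a<L. \<Sum>j<J. \<Sum>b<M. \<alpha> i a * \<beta> a j * \<gamma> j b * \<delta> b i)"
      by (rule complex_Re_le_cmod)
    also have "\<dots> \<le> min (card {..<M}) (min (card {..<J}) (min (card {..<L}) (card {..<k})))"
      by (rule contraction_cycle_bound_min)
        (use * in \<open>auto intro: contraction_submatrix[OF \<alpha>] contraction_submatrix[OF \<beta>]
           contraction_submatrix[OF \<gamma>] contraction_submatrix[OF \<delta>]\<close>)
    finally show "(\<Sum>a<L. \<Sum>j<J. \<Sum>b<M. T a j b) \<le> real (min M (min J (min L k)))" by simp
  qed (use assms in auto)
  finally show ?thesis .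
qed

section \<open>Adjoints and orthonormal families\<close>

lemma cscalar_prod_sum:
  fixes v w :: "complex vec"
  shows "w \<in> carrier_vec n \<Longrightarrow> v \<bullet>c w = (\<Sum>i<n. v $ i * cnj (w $ i))"
  by (auto simp: scalar_prod_def atLeast0LessThan intro!: sum.cong)

lemma mult_mat_vec_index:
  "A \<in> carrier_mat m n \<Longrightarrow> v \<in> carrier_vec n \<Longrightarrow> i < m \<Longrightarrow> (A *\<^sub>v v) $ i = (\<Sum>j<n. A $$ (i, j) * v $ j)"
  by (auto simp: scalar_prod_def atLeast0LessThan intro!: sum.cong)

lemma mat_mult_index:
  "A \<in> carrier_mat m n \<Longrightarrow> B \<in> carrier_mat n l \<Longrightarrow> i < m \<Longrightarrow> k < l \<Longrightarrow>
     (A * B) $$ (i, k) = (\<Sum>j<n. A $$ (i, j) * B $$ (j, k))"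
  by (auto simp: scalar_prod_def atLeast0LessThan intro!: sum.cong)

\<comment> \<open>These rules would turn entries of products into scalar products of rows, hiding the explicit sums.\<close>
declare index_mult_mat_vec [simp del] index_mult_mat(1) [simp del]

lemma mat_adjoint_dim [simp]:
  "dim_row (mat_adjoint A) = dim_col A" "dim_col (mat_adjoint A) = dim_row A"
  by (auto simp: mat_adjoint_def)

lemma mat_adjoint_index:
  fixes A :: "complex mat"
  shows "i < dim_col A \<Longrightarrow> j < dim_row A \<Longrightarrow> mat_adjoint A $$ (i, j) = cnj (A $$ (j, i))"
  by (simp add: mat_adjoint_def mat_of_rows_def)

lemma mat_adjoint_carrier [simp]:
  "A \<in> carrier_mat m n \<Longrightarrow> mat_adjoint A \<in> carrier_mat n m"
  by (intro carrier_matI) simp_all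

lemma cscalar_adjoint:
  fixes A :: "complex mat"
  assumes A: "A \<in> carrier_mat m n" and u: "u \<in> carrier_vec n" and z: "z \<in> carrier_vec m"
  shows "(A *\<^sub>v u) \<bullet>c z = u \<bullet>c (mat_adjoint A *\<^sub>v z)"
proof -
  have adj: "(mat_adjoint A *\<^sub>v z) $ j = (\<Sum>i<m. cnj (A $$ (i, j)) * z $ i)" if "j < n" for j
    unfolding mult_mat_vec_index[OF mat_adjoint_carrier[OF A] z that]
    by (intro sum.cong refl) (use A that in \<open>simp add: mat_adjoint_index\<close>)
  have cl: "A *\<^sub>v u \<in> carrier_vec m" "mat_adjoint A *\<^sub>v z \<in> carrier_vec n"
    using mult_mat_vec_carrier[OF A u] mult_mat_vec_carrier[OF mat_adjoint_carrier[OF A] z] by simp_all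
  have "(A *\<^sub>v u) \<bullet>c z = (\<Sum>i<m. \<Sum>j<n. A $$ (i, j) * u $ j * cnj (z $ i))"
    unfolding cscalar_prod_sum[OF z]
    by (intro sum.cong refl) (simp add: mult_mat_vec_index[OF A u] sum_distrib_right)
  also have "\<dots> = (\<Sum>j<n. \<Sum>i<m. A $$ (i, j) * u $ j * cnj (z $ i))" by (rule sum.swap)
  also have "\<dots> = u \<bullet>c (mat_adjoint A *\<^sub>v z)"
    unfolding cscalar_prod_sum[OF cl(2)]
    by (intro sum.cong refl) (simp add: adj sum_distrib_left mult_ac)
  finally show ?thesis .
qed

lemma mat_adjoint_mult:
  fixes A B :: "complex mat"
  assumes "A \<in> carrier_mat m n" "B \<in> carrier_mat n l"
  shows "mat_adjoint (A * B) = mat_adjoint B * mat_adjoint A"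
proof (rule eq_matI)
  fix i j assume "i < dim_row (mat_adjoint B * mat_adjoint A)" "j < dim_col (mat_adjoint B * mat_adjoint A)"
  hence "i < l" "j < m" using assms by auto
  thus "mat_adjoint (A * B) $$ (i, j) = (mat_adjoint B * mat_adjoint A) $$ (i, j)"
    using assms
    by (simp add: mat_adjoint_index mat_mult_index[of A m n B l] mat_mult_index[of _ l n _ m] mult.commute)
qed (use assms in auto)

lemma mat_adjoint_adjoint [simp]:
  fixes A :: "complex mat"
  shows "mat_adjoint (mat_adjoint A) = A"
  by (rule eq_matI) (auto simp: mat_adjoint_index)

definition orthonormal_family :: "nat \<Rightarrow> nat \<Rightarrow> (nat \<Rightarrow> complex vec) \<Rightarrow> bool" where
  "orthonormal_family n k v \<longleftrightarrow>
     (\<forall>i<k. v i \<in> carrier_vec n) \<and> (\<forall>i<k. \<forall>j<k. v i \<bullet>c v j = (if i = j then 1 else 0))"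

lemma orthonormal_familyD:
  assumes "orthonormal_family n k v"
  shows "i < k \<Longrightarrow> v i \<in> carrier_vec n"
    and "i < k \<Longrightarrow> j < k \<Longrightarrow> v i \<bullet>c v j = (if i = j then 1 else 0)"
  using assms by (auto simp: orthonormal_family_def)

lemma cscalar_cnj:
  fixes v w :: "complex vec"
  assumes "v \<in> carrier_vec n" "w \<in> carrier_vec n"
  shows "cnj (v \<bullet>c w) = w \<bullet>c v"
  using assms by (simp add: cscalar_prod_sum[of _ n] cnj_sum mult.commute)

text \<open>
  A one-sided inverse of a square matrix is two-sided, so orthonormal rows imply orthonormal columns.
\<close>

lemma orthonormal_array_transpose:
  fixes q :: "nat \<Rightarrow> nat \<Rightarrow> complex"
  assumes "\<And>i j. i < t \<Longrightarrow> j < t \<Longrightarrow> (\<Sum>a<t. q i a * cnj (q j a)) = (if i = j then 1 else 0)"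
    and "a < t" "b < t"
  shows "(\<Sum>i<t. q i a * cnj (q i b)) = (if a = b then 1 else 0)"
proof -
  define Q where "Q = mat t t (\<lambda>(i, a). q i a)"
  have Q: "Q \<in> carrier_mat t t" by (simp add: Q_def)
  note Qa = mat_adjoint_carrier[OF Q]
  have "Q * mat_adjoint Q = 1\<^sub>m t"
  proof (rule eq_matI)
    fix i j assume "i < dim_row (1\<^sub>m t :: complex mat)" "j < dim_col (1\<^sub>m t :: complex mat)"
    hence ij: "i < t" "j < t" by auto
    have "(Q * mat_adjoint Q) $$ (i, j) = (\<Sum>a<t. q i a * cnj (q j a))"
      unfolding mat_mult_index[OF Q Qa ij]
      by (intro sum.cong refl) (use ij Q in \<open>simp add: mat_adjoint_index Q_def\<close>)
    thus "(Q * mat_adjoint Q) $$ (i, j) = 1\<^sub>m t $$ (i, j)" using assms(1) ij by simp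
  qed (use Q in auto)
  hence "mat_adjoint Q * Q = 1\<^sub>m t"
    by (rule mat_mult_left_right_inverse[OF Q Qa])
  hence "(mat_adjoint Q * Q) $$ (b, a) = (1\<^sub>m t) $$ (b, a)" by simp
  also have "(mat_adjoint Q * Q) $$ (b, a) = (\<Sum>i<t. q i a * cnj (q i b))"
    unfolding mat_mult_index[OF Qa Q \<open>b < t\<close> \<open>a < t\<close>]
    by (intro sum.cong refl) (use assms(2,3) Q in \<open>simp add: mat_adjoint_index Q_def mult.commute\<close>)
  finally show ?thesis using assms(2,3) by auto
qed

lemma orthonormal_family_complete:
  assumes "orthonormal_family n n v" "r < n" "s < n"
  shows "(\<Sum>j<n. v j $ r * cnj (v j $ s)) = (if r = s then 1 else 0)"
proof (rule orthonormal_array_transpose)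
  fix i j assume "i < n" "j < n"
  thus "(\<Sum>a<n. v i $ a * cnj (v j $ a)) = (if i = j then 1 else 0)"
    using orthonormal_familyD[OF assms(1)] by (simp add: cscalar_prod_sum[of _ n, symmetric])
qed (use assms in auto)

lemma orthonormal_family_expand:
  assumes v: "orthonormal_family n n v" and z: "z \<in> carrier_vec n" and r: "r < n"
  shows "z $ r = (\<Sum>j<n. (z \<bullet>c v j) * v j $ r)"
proof -
  have "(\<Sum>j<n. (z \<bullet>c v j) * v j $ r) = (\<Sum>j<n. \<Sum>s<n. z $ s * (v j $ r * cnj (v j $ s)))"
    using orthonormal_familyD(1)[OF v]
    by (intro sum.cong refl) (simp add: cscalar_prod_sum[of _ n] sum_distrib_left sum_distrib_right mult_ac)
  also have "\<dots> = (\<Sum>s<n. z $ s * (\<Sum>j<n. v j $ r * cnj (v j $ s)))"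
    by (subst sum.swap) (simp add: sum_distrib_left)
  also have "\<dots> = (\<Sum>s<n. if s = r then z $ s else 0)"
    using orthonormal_family_complete[OF v r] by (intro sum.cong) auto
  finally show ?thesis using r by simp
qed

lemma orthonormal_family_parseval:
  assumes v: "orthonormal_family n n v" and z: "z \<in> carrier_vec n" and w: "w \<in> carrier_vec n"
  shows "z \<bullet>c w = (\<Sum>j<n. (z \<bullet>c v j) * cnj (w \<bullet>c v j))"
proof -
  have "z \<bullet>c w = (\<Sum>r<n. (\<Sum>j<n. (z \<bullet>c v j) * v j $ r) * cnj (w $ r))"
    using w z by (simp add: cscalar_prod_sum[of w n] orthonormal_family_expand[OF v z])
  also have "\<dots> = (\<Sum>r<n. \<Sum>j<n. (z \<bullet>c v j) * (v j $ r * cnj (w $ r)))"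
    by (simp add: sum_distrib_right mult.assoc)
  also have "\<dots> = (\<Sum>j<n. (z \<bullet>c v j) * (\<Sum>r<n. v j $ r * cnj (w $ r)))"
    by (subst sum.swap) (simp add: sum_distrib_left)
  also have "\<dots> = (\<Sum>j<n. (z \<bullet>c v j) * cnj (w \<bullet>c v j))"
    using orthonormal_familyD(1)[OF v] w
    by (intro sum.cong refl) (simp add: cscalar_cnj[of w n] cscalar_prod_sum[of w n])
  finally show ?thesis .
qed

section \<open>The spectral theorem for Hermitian matrices\<close>

text \<open>
  The last clause keeps a vector that is already of length one, which is what allows a given unit vector
  to remain the first member of an orthonormal basis.
\<close>

lemma normalize_vec:
  fixes v :: "complex vec"
  assumes v: "v \<in> carrier_vec n" and "v \<bullet>c v \<noteq> 0"
  obtains c :: complex where "c \<noteq> 0" "(c \<cdot>\<^sub>v v) \<bullet>c (c \<cdot>\<^sub>v v) = 1" "v \<bullet>c v = 1 \<Longrightarrow> c = 1"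
proof -
  define N where "N = (\<Sum>i<n. (cmod (v $ i))\<^sup>2)"
  have N: "v \<bullet>c v = complex_of_real N"
    unfolding cscalar_prod_sum[OF v] N_def of_real_sum complex_norm_square ..
  have "N \<ge> 0" by (simp add: N_def sum_nonneg)
  with assms N have "N > 0" by (cases "N = 0") auto
  define c where "c = complex_of_real (1 / sqrt N)"
  have "(c \<cdot>\<^sub>v v) \<bullet>c (c \<cdot>\<^sub>v v) = c * cnj c * (v \<bullet>c v)"
    using v by (simp add: cscalar_prod_sum[of _ n] sum_distrib_left mult_ac)
  also have "\<dots> = complex_of_real ((1 / sqrt N) * (1 / sqrt N) * N)"
    by (simp only: c_def N complex_cnj_complex_of_real of_real_mult)
  also have "(1 / sqrt N) * (1 / sqrt N) * N = 1" using \<open>N > 0\<close> by (simp add: field_simps)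
  finally show ?thesis using \<open>N > 0\<close> N that[of c] by (simp add: c_def)
qed

lemma corthogonal_normalize:
  fixes us :: "complex vec list"
  assumes us: "set us \<subseteq> carrier_vec n" "corthogonal us" "length us = k"
  obtains c where "\<And>i. i < k \<Longrightarrow> c i \<noteq> 0" "\<And>i. i < k \<Longrightarrow> us ! i \<bullet>c us ! i = 1 \<Longrightarrow> c i = 1"
    "orthonormal_family n k (\<lambda>i. c i \<cdot>\<^sub>v us ! i)"
proof -
  have usc: "us ! i \<in> carrier_vec n" if "i < k" for i using that us by auto
  have "\<exists>c. c \<noteq> 0 \<and> (c \<cdot>\<^sub>v us ! i) \<bullet>c (c \<cdot>\<^sub>v us ! i) = 1 \<and> (us ! i \<bullet>c us ! i = 1 \<longrightarrow> c = 1)"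
    if i: "i < k" for i
    using normalize_vec[OF usc[OF i]] corthogonalD[OF us(2), of i i] i us(3) by metis
  then obtain c where c: "\<And>i. i < k \<Longrightarrow> c i \<noteq> 0" "\<And>i. i < k \<Longrightarrow> (c i \<cdot>\<^sub>v us ! i) \<bullet>c (c i \<cdot>\<^sub>v us ! i) = 1"
    "\<And>i. i < k \<Longrightarrow> us ! i \<bullet>c us ! i = 1 \<Longrightarrow> c i = 1"
    by metis
  have "(c i \<cdot>\<^sub>v us ! i) \<bullet>c (c j \<cdot>\<^sub>v us ! j) = 0" if "i < k" "j < k" "i \<noteq> j" for i j
  proof -
    have "(c i \<cdot>\<^sub>v us ! i) \<bullet>c (c j \<cdot>\<^sub>v us ! j) = c i * cnj (c j) * (us ! i \<bullet>c us ! j)"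
      using usc[OF that(1)] usc[OF that(2)] by (simp add: cscalar_prod_sum[of _ n] sum_distrib_left mult_ac)
    thus ?thesis using corthogonalD[OF us(2), of i j] that us by simp
  qed
  hence "orthonormal_family n k (\<lambda>i. c i \<cdot>\<^sub>v us ! i)"
    unfolding orthonormal_family_def using c usc by auto
  thus ?thesis using that c by blast
qed

text \<open>
  Gram--Schmidt applied to a basis that starts with \<open>v\<close> leaves \<open>v\<close> unchanged.
\<close>

lemma orthonormal_family_extend:
  assumes v: "v \<in> carrier_vec n" and 1: "v \<bullet>c v = 1"
  shows "\<exists>w. orthonormal_family n n w \<and> w 0 = v"
proof -
  interpret cof_vec_space n "TYPE(complex)" .
  have v0: "v \<noteq> 0\<^sub>v n" using 1 v by auto
  define b where "b = basis_completion v"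
  from basis_completion[OF v v0, folded b_def]
  have dist_b: "distinct b" and indep: "\<not> lin_dep (set b)" and b: "set b \<subseteq> carrier_vec n"
    and hdb: "hd b = v" and len_b: "length b = n" by auto
  have n: "n \<noteq> 0" using v0 v by (metis carrier_vecD eq_vecI index_zero_vec(2) less_nat_zero_code)
  from hdb len_b n obtain vs where bv: "b = v # vs" by (cases b) auto
  define ws where "ws = gram_schmidt n b"
  from gram_schmidt_result[OF b dist_b indep refl, folded ws_def]
  have ws: "set ws \<subseteq> carrier_vec n" "corthogonal ws" "length ws = n" by (auto simp: len_b)
  from gram_schmidt_hd[OF v, of vs, folded bv] have "hd ws = v" unfolding ws_def .
  hence ws0: "ws ! 0 = v" using ws(3) n by (cases ws) auto
  obtain c where "\<And>i. i < n \<Longrightarrow> ws ! i \<bullet>c ws ! i = 1 \<Longrightarrow> c i = 1"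
    and "orthonormal_family n n (\<lambda>i. c i \<cdot>\<^sub>v ws ! i)"
    using corthogonal_normalize[OF ws] by metis
  moreover from this(1)[of 0] have "c 0 \<cdot>\<^sub>v ws ! 0 = v" using n ws0 1 v by simp
  ultimately show ?thesis by blast
qed

text \<open>
  Induction on the dimension. Pick a unit eigenvector \<open>v\<close> and an isometry \<open>W\<close> onto its orthogonal
  complement. The complement is invariant under \<open>H\<close>, so \<open>W\<close> maps eigenvectors of the Hermitian compression
  \<open>W\<^sup>H H W\<close> to eigenvectors of \<open>H\<close>.
\<close>

lemma hermitian_eigenbasis:
  fixes H :: "complex mat"
  assumes "H \<in> carrier_mat n n" "mat_adjoint H = H"
  shows "\<exists>v d. orthonormal_family n n v \<and> (\<forall>i<n. H *\<^sub>v v i = d i \<cdot>\<^sub>v v i)"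
  using assms
proof (induction n arbitrary: H)
  case 0
  show ?case by (auto simp: orthonormal_family_def)
next
  case (Suc n H)
  note H = Suc.prems(1) and sa = Suc.prems(2)
  have symH: "(H *\<^sub>v u) \<bullet>c z = u \<bullet>c (H *\<^sub>v z)" if "u \<in> carrier_vec (Suc n)" "z \<in> carrier_vec (Suc n)" for u z
    using cscalar_adjoint[OF H that] sa by simp
  obtain e where "poly (char_poly H) e = 0"
    using fundamental_theorem_of_algebra[of "char_poly H"] degree_monic_char_poly[OF H]
    by (auto simp: constant_degree)
  hence "eigenvalue H e" using eigenvalue_root_char_poly[OF H] by simp
  then obtain v' where v': "v' \<in> carrier_vec (Suc n)" "v' \<noteq> 0\<^sub>v (Suc n)" "H *\<^sub>v v' = e \<cdot>\<^sub>v v'"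
    using H unfolding eigenvalue_def eigenvector_def by auto
  have "v' \<bullet>c v' \<noteq> 0" using v' conjugate_square_eq_0_vec[OF v'(1)] by simp
  then obtain c where c: "c \<noteq> 0" "(c \<cdot>\<^sub>v v') \<bullet>c (c \<cdot>\<^sub>v v') = 1" using normalize_vec[OF v'(1)] by blast
  define v where "v = c \<cdot>\<^sub>v v'"
  have v: "v \<in> carrier_vec (Suc n)" "v \<bullet>c v = 1" using v' c by (auto simp: v_def)
  have Hv: "H *\<^sub>v v = e \<cdot>\<^sub>v v" using v' H
    by (simp add: v_def mult_mat_vec smult_smult_assoc mult.commute)
  obtain w where w: "orthonormal_family (Suc n) (Suc n) w" "w 0 = v"
    using orthonormal_family_extend[OF v] by blast
  define W where "W = mat (Suc n) n (\<lambda>(r, i). w (Suc i) $ r)"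
  have W: "W \<in> carrier_mat (Suc n) n" by (simp add: W_def)
  have WtW: "mat_adjoint W * W = 1\<^sub>m n"
  proof (rule eq_matI)
    fix i j assume "i < dim_row (1\<^sub>m n :: complex mat)" "j < dim_col (1\<^sub>m n :: complex mat)"
    hence ij: "i < n" "j < n" by auto
    have "(mat_adjoint W * W) $$ (i, j) = (\<Sum>r<Suc n. w (Suc j) $ r * cnj (w (Suc i) $ r))"
      unfolding mat_mult_index[OF mat_adjoint_carrier[OF W] W ij]
      by (intro sum.cong refl) (use ij W in \<open>simp add: mat_adjoint_index W_def mult.commute\<close>)
    also have "\<dots> = w (Suc j) \<bullet>c w (Suc i)"
      using ij orthonormal_familyD(1)[OF w(1)] by (subst cscalar_prod_sum[of _ "Suc n"]) auto
    also have "\<dots> = 1\<^sub>m n $$ (i, j)" using ij orthonormal_familyD(2)[OF w(1)] by auto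
    finally show "(mat_adjoint W * W) $$ (i, j) = 1\<^sub>m n $$ (i, j)" .
  qed (use W in auto)
  have coef: "(mat_adjoint W *\<^sub>v z) $ i = z \<bullet>c w (Suc i)" if "i < n" "z \<in> carrier_vec (Suc n)" for i z
  proof -
    have wi: "w (Suc i) \<in> carrier_vec (Suc n)" using that orthonormal_familyD(1)[OF w(1)] by simp
    show ?thesis
      unfolding mult_mat_vec_index[OF mat_adjoint_carrier[OF W] that(2,1)] cscalar_prod_sum[OF wi]
      by (intro sum.cong refl) (use that W in \<open>simp add: mat_adjoint_index W_def mult.commute\<close>)
  qed
  \<comment> \<open>\<open>W W\<^sup>H\<close> is the identity on the orthogonal complement of \<open>v\<close>.\<close>
  have Wz: "W *\<^sub>v (mat_adjoint W *\<^sub>v z) = z" if z: "z \<in> carrier_vec (Suc n)" "z \<bullet>c v = 0" for z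
  proof (rule eq_vecI)
    fix r assume "r < dim_vec z" hence r: "r < Suc n" using z by simp
    have Wtz: "mat_adjoint W *\<^sub>v z \<in> carrier_vec n"
      by (rule mult_mat_vec_carrier[OF mat_adjoint_carrier[OF W] z(1)])
    have "z $ r = (\<Sum>j<Suc n. (z \<bullet>c w j) * w j $ r)"
      by (rule orthonormal_family_expand[OF w(1) z(1) r])
    also have "\<dots> = (\<Sum>i<n. (z \<bullet>c w (Suc i)) * w (Suc i) $ r)"
      using w(2) z(2) by (subst sum.lessThan_Suc_shift) simp
    also have "\<dots> = (W *\<^sub>v (mat_adjoint W *\<^sub>v z)) $ r"
      unfolding mult_mat_vec_index[OF W Wtz r]
      by (intro sum.cong refl) (use r z coef in \<open>simp add: W_def mult.commute\<close>)
    finally show "(W *\<^sub>v (mat_adjoint W *\<^sub>v z)) $ r = z $ r" by simp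
  qed (use W z in auto)
  have Wv: "(W *\<^sub>v u) \<bullet>c v = 0" if u: "u \<in> carrier_vec n" for u
  proof -
    have "mat_adjoint W *\<^sub>v v = 0\<^sub>v n"
    proof (rule eq_vecI)
      fix i assume "i < dim_vec (0\<^sub>v n :: complex vec)" hence i: "i < n" by simp
      have "(mat_adjoint W *\<^sub>v v) $ i = v \<bullet>c w (Suc i)" by (rule coef[OF i v(1)])
      thus "(mat_adjoint W *\<^sub>v v) $ i = 0\<^sub>v n $ i"
        using orthonormal_familyD(2)[OF w(1), of 0 "Suc i"] w(2) i by simp
    qed (use W in auto)
    thus ?thesis using cscalar_adjoint[OF W u v(1)] u by simp
  qed
  \<comment> \<open>The compression of \<open>H\<close> to the orthogonal complement of \<open>v\<close>.\<close>
  define H3 where "H3 = mat_adjoint W * (H * W)"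
  have H3: "H3 \<in> carrier_mat n n" using W H unfolding H3_def by auto
  have "mat_adjoint H3 = mat_adjoint (H * W) * W"
    unfolding H3_def by (subst mat_adjoint_mult[of _ n "Suc n" _ n]) (use W H in auto)
  also have "\<dots> = (mat_adjoint W * H) * W" by (subst mat_adjoint_mult[OF H W]) (simp add: sa)
  also have "\<dots> = H3" unfolding H3_def using W H mat_adjoint_carrier[OF W] by (intro assoc_mult_mat) auto
  finally obtain u d where u: "orthonormal_family n n u" and d: "\<And>i. i < n \<Longrightarrow> H3 *\<^sub>v u i = d i \<cdot>\<^sub>v u i"
    using Suc.IH[OF H3] by blast
  have HW: "H *\<^sub>v (W *\<^sub>v u i) = d i \<cdot>\<^sub>v (W *\<^sub>v u i)" if i: "i < n" for i
  proof -
    have ui: "u i \<in> carrier_vec n" using orthonormal_familyD(1)[OF u i] .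
    have Wui: "W *\<^sub>v u i \<in> carrier_vec (Suc n)" using W ui by auto
    have HWui: "H *\<^sub>v (W *\<^sub>v u i) \<in> carrier_vec (Suc n)" using H Wui by auto
    have "(H *\<^sub>v (W *\<^sub>v u i)) \<bullet>c v = (W *\<^sub>v u i) \<bullet>c (e \<cdot>\<^sub>v v)" using symH[OF Wui v(1)] Hv by simp
    also have "\<dots> = cnj e * ((W *\<^sub>v u i) \<bullet>c v)"
      using v Wui by (simp add: conjugate_smult_vec)
    also have "\<dots> = 0" using Wv[OF ui] by simp
    finally have "H *\<^sub>v (W *\<^sub>v u i) = W *\<^sub>v (mat_adjoint W *\<^sub>v (H *\<^sub>v (W *\<^sub>v u i)))"
      using Wz[OF HWui] by simp
    also have "mat_adjoint W *\<^sub>v (H *\<^sub>v (W *\<^sub>v u i)) = H3 *\<^sub>v u i"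
      unfolding H3_def using W H ui mat_adjoint_carrier[OF W]
      by (simp add: assoc_mult_mat_vec[of _ n "Suc n" _ n] assoc_mult_mat_vec[of _ "Suc n" "Suc n" _ n])
    also have "\<dots> = d i \<cdot>\<^sub>v u i" by (rule d[OF i])
    also have "W *\<^sub>v (d i \<cdot>\<^sub>v u i) = d i \<cdot>\<^sub>v (W *\<^sub>v u i)" using W ui by (simp add: mult_mat_vec)
    finally show ?thesis .
  qed
  define z where "z i = (case i of 0 \<Rightarrow> v | Suc j \<Rightarrow> W *\<^sub>v u j)" for i
  have WW: "(W *\<^sub>v u i) \<bullet>c (W *\<^sub>v u j) = (if i = j then 1 else 0)" if "i < n" "j < n" for i j
  proof -
    have "u i \<in> carrier_vec n" "u j \<in> carrier_vec n" using orthonormal_familyD(1)[OF u] that by auto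
    moreover have "mat_adjoint W *\<^sub>v (W *\<^sub>v u j) = u j"
      using WtW W calculation mat_adjoint_carrier[OF W]
      by (metis assoc_mult_mat_vec one_mult_mat_vec)
    ultimately show ?thesis
      using cscalar_adjoint[OF W, of "u i" "W *\<^sub>v u j"] W orthonormal_familyD(2)[OF u that] by simp
  qed
  have vW: "v \<bullet>c (W *\<^sub>v u j) = 0" if "j < n" for j
    using cscalar_cnj[of "W *\<^sub>v u j" "Suc n" v] Wv[of "u j"] orthonormal_familyD(1)[OF u that] W v by simp
  have "orthonormal_family (Suc n) (Suc n) z"
    unfolding orthonormal_family_def
  proof (intro conjI allI impI)
    fix i assume i: "i < Suc n"
    show "z i \<in> carrier_vec (Suc n)"
      using i v W orthonormal_familyD(1)[OF u] by (auto simp: z_def split: nat.splits)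
    fix j assume j: "j < Suc n"
    show "z i \<bullet>c z j = (if i = j then 1 else 0)"
      using i j WW vW v Wv orthonormal_familyD(1)[OF u] by (auto simp: z_def split: nat.splits)
  qed
  moreover have "\<forall>i<Suc n. H *\<^sub>v z i = (case i of 0 \<Rightarrow> e | Suc j \<Rightarrow> d j) \<cdot>\<^sub>v z i"
    using HW Hv by (auto simp: z_def split: nat.splits)
  ultimately show ?case by blast
qed

section \<open>Singular values and right singular vectors\<close>

lemma proots_prod_linear_factors: "proots (\<Prod>a\<leftarrow>L. [:- a :: complex, 1:]) = mset L"
proof (induction L)
  case (Cons a L)
  have "(\<Prod>a\<leftarrow>L. [:- a, 1:]) \<noteq> 0" by (auto simp: prod_list_zero_iff)
  thus ?case using Cons by (simp add: proots_mult del: mult_pCons_left)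
qed simp

text \<open>
  The basis diagonalizes \<open>H\<close> by a unitary similarity, so the eigenvalues along the basis are the roots of the
  characteristic polynomial with their algebraic multiplicities.
\<close>

lemma proots_char_poly_eigenbasis:
  fixes H :: "complex mat"
  assumes H: "H \<in> carrier_mat n n" and v: "orthonormal_family n n v"
    and ev: "\<And>i. i < n \<Longrightarrow> H *\<^sub>v v i = d i \<cdot>\<^sub>v v i"
  shows "proots (char_poly H) = mset (map d [0..<n])"
proof -
  define V where "V = mat n n (\<lambda>(r, i). v i $ r)"
  define D where "D = mat n n (\<lambda>(i, j). if i = j then d i else 0)"
  have V: "V \<in> carrier_mat n n" and D: "D \<in> carrier_mat n n" by (simp_all add: V_def D_def)
  note Va = mat_adjoint_carrier[OF V]
  have VV: "V * mat_adjoint V = 1\<^sub>m n"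
  proof (rule eq_matI)
    fix r s assume "r < dim_row (1\<^sub>m n :: complex mat)" "s < dim_col (1\<^sub>m n :: complex mat)"
    hence rs: "r < n" "s < n" by auto
    have "(V * mat_adjoint V) $$ (r, s) = (\<Sum>j<n. v j $ r * cnj (v j $ s))"
      unfolding mat_mult_index[OF V Va rs]
      by (intro sum.cong refl) (use rs V in \<open>simp add: mat_adjoint_index V_def\<close>)
    thus "(V * mat_adjoint V) $$ (r, s) = 1\<^sub>m n $$ (r, s)"
      using orthonormal_family_complete[OF v rs] rs by simp
  qed (use V in auto)
  hence VV': "mat_adjoint V * V = 1\<^sub>m n" by (rule mat_mult_left_right_inverse[OF V Va])
  have HV: "H * V = V * D"
  proof (rule eq_matI)
    fix r i assume "r < dim_row (V * D)" "i < dim_col (V * D)"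
    hence ri: "r < n" "i < n" using V D by auto
    have "(H * V) $$ (r, i) = (\<Sum>s<n. H $$ (r, s) * v i $ s)"
      unfolding mat_mult_index[OF H V ri] by (intro sum.cong refl) (use ri in \<open>simp add: V_def\<close>)
    also have "\<dots> = (H *\<^sub>v v i) $ r"
      by (rule mult_mat_vec_index[OF H orthonormal_familyD(1)[OF v ri(2)] ri(1), symmetric])
    also have "\<dots> = d i * v i $ r"
      using ev[OF ri(2)] orthonormal_familyD(1)[OF v ri(2)] ri by simp
    also have "\<dots> = (\<Sum>j<n. if j = i then d i * v i $ r else 0)" using ri by simp
    also have "\<dots> = (V * D) $$ (r, i)"
      unfolding mat_mult_index[OF V D ri] by (intro sum.cong refl) (use ri in \<open>simp add: V_def D_def\<close>)
    finally show "(H * V) $$ (r, i) = (V * D) $$ (r, i)" .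
  qed (use H V D in auto)
  have "H = H * (V * mat_adjoint V)" using H VV by simp
  also have "\<dots> = V * D * mat_adjoint V" using HV assoc_mult_mat[OF H V Va] by simp
  finally have "similar_mat_wit H D V (mat_adjoint V)"
    by (intro similar_mat_witI[OF VV VV' _ H D V Va])
  hence "char_poly H = char_poly D" using char_poly_similar unfolding similar_mat_def by blast
  also have "\<dots> = (\<Prod>a\<leftarrow>diag_mat D. [:- a, 1:])"
    by (rule char_poly_upper_triangular[OF D]) (auto simp: D_def)
  also have "diag_mat D = map d [0..<n]" by (auto simp: diag_mat_def D_def)
  finally show ?thesis by (simp only: proots_prod_linear_factors)
qed

text \<open>
  An eigenvalue of \<open>B\<^sup>H B\<close> with unit eigenvector \<open>v\<close> equals \<open>\<parallel>B v\<parallel>\<^sup>2\<close>, hence is real and nonnegative. The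
  eigenvectors are enumerated so that the eigenvalues increase; this matches the decreasing order of the
  principal angles.
\<close>

lemma singular_vectors:
  fixes B :: "complex mat"
  assumes B: "B \<in> carrier_mat m t" and "t \<le> m"
  obtains q \<mu> where "orthonormal_family t t q"
    and "\<And>i. i < t \<Longrightarrow> (mat_adjoint B * B) *\<^sub>v q i = complex_of_real (\<mu> i) \<cdot>\<^sub>v q i"
    and "\<And>i. i < t \<Longrightarrow> 0 \<le> \<mu> i" and "\<And>i j. i \<le> j \<Longrightarrow> j < t \<Longrightarrow> \<mu> i \<le> \<mu> j"
    and "singular_values B = rev (map (\<lambda>i. sqrt (\<mu> i)) [0..<t])"
proof -
  note Ba = mat_adjoint_carrier[OF B]
  define H where "H = mat_adjoint B * B"
  have H: "H \<in> carrier_mat t t" using B Ba unfolding H_def by auto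
  have "mat_adjoint H = H" unfolding H_def by (subst mat_adjoint_mult[OF Ba B]) simp
  then obtain v e where v: "orthonormal_family t t v" and ev: "\<And>i. i < t \<Longrightarrow> H *\<^sub>v v i = e i \<cdot>\<^sub>v v i"
    using hermitian_eigenbasis[OF H] by blast
  have real: "e i = complex_of_real (Re (e i)) \<and> 0 \<le> Re (e i)" if i: "i < t" for i
  proof -
    have vi: "v i \<in> carrier_vec t" using orthonormal_familyD(1)[OF v i] .
    have Bv: "B *\<^sub>v v i \<in> carrier_vec m" by (rule mult_mat_vec_carrier[OF B vi])
    have "e i = e i * (v i \<bullet>c v i)" using orthonormal_familyD(2)[OF v i i] by simp
    also have "\<dots> = (H *\<^sub>v v i) \<bullet>c v i" unfolding ev[OF i] using vi by simp
    also have "H *\<^sub>v v i = mat_adjoint B *\<^sub>v (B *\<^sub>v v i)"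
      unfolding H_def by (rule assoc_mult_mat_vec[OF Ba B vi])
    also have "\<dots> \<bullet>c v i = (B *\<^sub>v v i) \<bullet>c (B *\<^sub>v v i)"
      using cscalar_adjoint[OF Ba Bv vi] by simp
    also have "\<dots> = complex_of_real (\<Sum>r<m. (cmod ((B *\<^sub>v v i) $ r))\<^sup>2)"
      unfolding cscalar_prod_sum[OF Bv] of_real_sum complex_norm_square ..
    finally show ?thesis by (simp add: sum_nonneg)
  qed
  define idx where "idx = sort_key (\<lambda>i. Re (e i)) [0..<t]"
  have idx: "length idx = t" "distinct idx" "set idx = {..<t}" by (auto simp: idx_def)
  have lt: "idx ! i < t" if "i < t" for i using that idx nth_mem by (metis lessThan_iff)
  define \<mu> where "\<mu> i = Re (e (idx ! i))" for i
  define q where "q i = v (idx ! i)" for i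
  have eq: "sorted (map (\<lambda>i. Re (e i)) idx)" unfolding idx_def by simp
  hence mono: "\<mu> i \<le> \<mu> j" if "i \<le> j" "j < t" for i j
    using that idx(1) by (auto simp: \<mu>_def sorted_iff_nth_mono)
  have map\<mu>: "map (\<lambda>z. sqrt (Re (e z))) idx = map (\<lambda>i. sqrt (\<mu> i)) [0..<t]"
    by (rule nth_equalityI) (auto simp: idx(1) \<mu>_def)
  have "proots (char_poly H) = mset (map e [0..<t])"
    by (rule proots_char_poly_eigenbasis[OF H v]) (rule ev)
  hence "image_mset (\<lambda>z. sqrt (Re z)) (proots (char_poly H)) = mset (map (\<lambda>z. sqrt (Re (e z))) idx)"
    by (simp add: idx_def multiset.map_comp o_def)
  hence "sorted_list_of_multiset (image_mset (\<lambda>z. sqrt (Re z)) (proots (char_poly H)))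
      = sort (map (\<lambda>i. sqrt (\<mu> i)) [0..<t])"
    by (simp only: map\<mu> sorted_list_of_multiset_mset)
  also have "\<dots> = map (\<lambda>i. sqrt (\<mu> i)) [0..<t]"
    by (rule sort_key_id_if_sorted) (auto simp: sorted_iff_nth_mono mono)
  finally have "singular_values B = rev (map (\<lambda>i. sqrt (\<mu> i)) [0..<t])"
    using B \<open>t \<le> m\<close> by (simp add: singular_values_def H_def[symmetric])
  moreover have "orthonormal_family t t q"
    using orthonormal_familyD[OF v] lt idx nth_eq_iff_index_eq[OF idx(2)]
    unfolding orthonormal_family_def q_def by auto
  moreover have "(mat_adjoint B * B) *\<^sub>v q i = complex_of_real (\<mu> i) \<cdot>\<^sub>v q i" "0 \<le> \<mu> i" if "i < t" for i
    using ev[OF lt[OF that]] real[OF lt[OF that]] by (simp_all add: q_def \<mu>_def H_def)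
  ultimately show ?thesis using that mono by blast
qed

section \<open>Linear combinations and orthonormal bases of subspaces\<close>

text \<open>
  Linear combinations are indexed by position and not by vector: coordinates then make sense for a family
  without appeal to injectivity, and spans become ranges.
\<close>

definition lincomb_fam :: "nat \<Rightarrow> nat \<Rightarrow> (nat \<Rightarrow> complex) \<Rightarrow> (nat \<Rightarrow> complex vec) \<Rightarrow> complex vec" where
  "lincomb_fam n k c v = vec n (\<lambda>r. \<Sum>i<k. c i * v i $ r)"

lemma lincomb_fam_carrier [simp]: "lincomb_fam n k c v \<in> carrier_vec n"
  by (simp add: lincomb_fam_def)

lemma lincomb_fam_cscalar:
  assumes "\<And>i. i < k \<Longrightarrow> v i \<in> carrier_vec n" "z \<in> carrier_vec n"
  shows "lincomb_fam n k c v \<bullet>c z = (\<Sum>i<k. c i * (v i \<bullet>c z))"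
proof -
  have "lincomb_fam n k c v \<bullet>c z = (\<Sum>r<n. \<Sum>i<k. c i * v i $ r * cnj (z $ r))"
    by (simp add: cscalar_prod_sum[OF assms(2)] lincomb_fam_def sum_distrib_right)
  also have "\<dots> = (\<Sum>i<k. \<Sum>r<n. c i * v i $ r * cnj (z $ r))" by (rule sum.swap)
  finally show ?thesis by (simp add: cscalar_prod_sum[OF assms(2)] sum_distrib_left mult.assoc)
qed

lemma cscalar_lincomb_fam:
  assumes "\<And>i. i < k \<Longrightarrow> v i \<in> carrier_vec n" "z \<in> carrier_vec n"
  shows "z \<bullet>c lincomb_fam n k c v = (\<Sum>i<k. cnj (c i) * (z \<bullet>c v i))"
proof -
  have "z \<bullet>c lincomb_fam n k c v = cnj (lincomb_fam n k c v \<bullet>c z)"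
    by (rule cscalar_cnj[symmetric]) (use assms in auto)
  also have "\<dots> = (\<Sum>i<k. cnj (c i) * cnj (v i \<bullet>c z))"
    by (simp add: lincomb_fam_cscalar[OF assms] cnj_sum)
  also have "\<dots> = (\<Sum>i<k. cnj (c i) * (z \<bullet>c v i))"
    by (intro sum.cong refl) (use assms in \<open>simp add: cscalar_cnj[of _ n]\<close>)
  finally show ?thesis .
qed

lemma mult_mat_vec_lincomb_fam:
  assumes U: "U \<in> carrier_mat n k" and "c \<in> carrier_vec k"
  shows "U *\<^sub>v c = lincomb_fam n k (\<lambda>i. c $ i) (col U)"
proof (rule eq_vecI)
  fix r assume "r < dim_vec (lincomb_fam n k (\<lambda>i. c $ i) (col U))"
  hence r: "r < n" by (simp add: lincomb_fam_def)
  show "(U *\<^sub>v c) $ r = lincomb_fam n k (\<lambda>i. c $ i) (col U) $ r"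
    unfolding mult_mat_vec_index[OF assms r]
    using r U by (auto simp: lincomb_fam_def mult.commute intro!: sum.cong)
qed (use U in \<open>auto simp: lincomb_fam_def\<close>)

lemma cspan_cols:
  assumes U: "U \<in> carrier_mat n k"
  shows "cspan n (set (cols U)) = (\<lambda>c. U *\<^sub>v c) ` carrier_vec k"
proof -
  interpret vec_space "TYPE(complex)" n .
  have "span (set (cols U)) = {y\<in>carrier_vec n. \<exists>x\<in>carrier_vec k. U *\<^sub>v x = y}"
    using col_space_eq[OF U] U unfolding col_space_def by auto
  also have "\<dots> = (\<lambda>c. U *\<^sub>v c) ` carrier_vec k"
    using mult_mat_vec_carrier[OF U] by auto
  finally show ?thesis .
qed

lemma cspan_cols_lincomb_fam:
  assumes U: "U \<in> carrier_mat n k"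
  shows "cspan n (set (cols U)) = range (\<lambda>c. lincomb_fam n k c (col U))"
proof (intro equalityI subsetI)
  fix z assume "z \<in> cspan n (set (cols U))"
  thus "z \<in> range (\<lambda>c. lincomb_fam n k c (col U))"
    unfolding cspan_cols[OF U] using mult_mat_vec_lincomb_fam[OF U] by auto
next
  fix z assume "z \<in> range (\<lambda>c. lincomb_fam n k c (col U))"
  then obtain c where "z = lincomb_fam n k c (col U)" by auto
  also have "\<dots> = lincomb_fam n k (\<lambda>i. vec k c $ i) (col U)"
    unfolding lincomb_fam_def by (auto intro!: eq_vecI sum.cong)
  also have "\<dots> = U *\<^sub>v vec k c" by (rule mult_mat_vec_lincomb_fam[OF U, symmetric]) simp
  finally show "z \<in> cspan n (set (cols U))" unfolding cspan_cols[OF U] by auto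
qed

lemma cspan_family:
  assumes "\<And>i. i < k \<Longrightarrow> v i \<in> carrier_vec n"
  shows "cspan n (v ` {..<k}) = range (\<lambda>c. lincomb_fam n k c v)"
proof -
  define U where "U = mat_of_cols n (map v [0..<k])"
  have U: "U \<in> carrier_mat n k" by (auto simp: U_def)
  have col: "col U i = v i" if "i < k" for i
    using that assms by (auto simp: U_def)
  have "set (cols U) = v ` {..<k}"
    using col U by (auto simp: cols_def atLeast0LessThan)
  moreover have "lincomb_fam n k c (col U) = lincomb_fam n k c v" for c
    using col unfolding lincomb_fam_def by (auto intro!: eq_vecI sum.cong)
  ultimately show ?thesis using cspan_cols_lincomb_fam[OF U] by simp
qed

lemma col_in_carrier: "U \<in> carrier_mat n k \<Longrightarrow> col U j \<in> carrier_vec n"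
  using col_dim[of U j] carrier_matD(1)[of U n k] by simp

lemma gram_mat_index:
  fixes U :: "complex mat"
  assumes U: "U \<in> carrier_mat n k" and ij: "i < k" "j < k"
  shows "(mat_adjoint U * U) $$ (j, i) = col U i \<bullet>c col U j"
proof -
  have dim: "dim_row U = n" "dim_col U = k" using carrier_matD[OF U] by simp_all
  show ?thesis
    unfolding cscalar_prod_sum[OF col_in_carrier[OF U]]
      mat_mult_index[OF mat_adjoint_carrier[OF U] U ij(2,1)]
    by (intro sum.cong refl) (simp add: mat_adjoint_index dim ij)
qed

lemma orthonormal_basis_matD:
  assumes "orthonormal_basis_mat n U W"
  shows "U \<in> carrier_mat n (dim_col U)" "mat_adjoint U * U = 1\<^sub>m (dim_col U)"
    "W = (\<lambda>c. U *\<^sub>v c) ` carrier_vec (dim_col U)"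
    "W = range (\<lambda>c. lincomb_fam n (dim_col U) c (col U))"
    "orthonormal_family n (dim_col U) (col U)"
proof -
  show U: "U \<in> carrier_mat n (dim_col U)" and UU: "mat_adjoint U * U = 1\<^sub>m (dim_col U)"
    using assms by (auto simp: orthonormal_basis_mat_def)
  show "W = (\<lambda>c. U *\<^sub>v c) ` carrier_vec (dim_col U)"
    using cspan_cols[OF U] assms by (simp add: orthonormal_basis_mat_def)
  show "W = range (\<lambda>c. lincomb_fam n (dim_col U) c (col U))"
    using cspan_cols_lincomb_fam[OF U] assms by (simp add: orthonormal_basis_mat_def)
  show "orthonormal_family n (dim_col U) (col U)"
    unfolding orthonormal_family_def
  proof (intro conjI allI impI)
    fix i j assume ij: "i < dim_col U" "j < dim_col U"
    have "col U i \<bullet>c col U j = (mat_adjoint U * U) $$ (j, i)"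
      by (rule gram_mat_index[OF U ij, symmetric])
    thus "col U i \<bullet>c col U j = (if i = j then 1 else 0)" unfolding UU using ij by auto
  qed (rule col_in_carrier[OF U])
qed

lemma orthonormal_basis_mat_of_family:
  assumes v: "orthonormal_family n k v"
  shows "orthonormal_basis_mat n (mat_of_cols n (map v [0..<k])) (cspan n (v ` {..<k}))"
proof -
  define U where "U = mat_of_cols n (map v [0..<k])"
  have U: "U \<in> carrier_mat n k" by (auto simp: U_def)
  have col: "col U i = v i" if "i < k" for i
    using that orthonormal_familyD(1)[OF v] by (auto simp: U_def)
  have "set (cols U) = v ` {..<k}"
    using col U by (auto simp: cols_def atLeast0LessThan)
  moreover have "mat_adjoint U * U = 1\<^sub>m k"
  proof (rule eq_matI)
    fix i j assume "i < dim_row (1\<^sub>m k :: complex mat)" "j < dim_col (1\<^sub>m k :: complex mat)"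
    hence ij: "i < k" "j < k" by auto
    have "(mat_adjoint U * U) $$ (i, j) = col U j \<bullet>c col U i"
      by (rule gram_mat_index[OF U ij(2,1)])
    thus "(mat_adjoint U * U) $$ (i, j) = 1\<^sub>m k $$ (i, j)"
      using orthonormal_familyD(2)[OF v ij(2,1)] ij col by auto
  qed (use U in auto)
  ultimately show ?thesis using U by (auto simp: orthonormal_basis_mat_def simp flip: U_def)
qed

lemma orthonormal_span_coords:
  assumes v: "orthonormal_family n k v" and z: "z \<in> range (\<lambda>c. lincomb_fam n k c v)"
  shows "z = lincomb_fam n k (\<lambda>i. z \<bullet>c v i) v"
proof -
  obtain c where zc: "z = lincomb_fam n k c v" using z by auto
  have "z \<bullet>c v j = c j" if j: "j < k" for j
  proof -
    have "z \<bullet>c v j = (\<Sum>i<k. c i * (v i \<bullet>c v j))"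
      unfolding zc by (rule lincomb_fam_cscalar) (use orthonormal_familyD(1)[OF v] j in auto)
    also have "\<dots> = (\<Sum>i<k. if i = j then c j else 0)"
      by (intro sum.cong refl) (use orthonormal_familyD(2)[OF v] j in auto)
    finally show ?thesis using j by simp
  qed
  thus ?thesis unfolding zc lincomb_fam_def by (auto intro!: eq_vecI sum.cong)
qed

lemma orthonormal_span_parseval:
  assumes v: "orthonormal_family n k v" and w: "w \<in> range (\<lambda>c. lincomb_fam n k c v)"
    and z: "z \<in> carrier_vec n"
  shows "z \<bullet>c w = (\<Sum>i<k. (z \<bullet>c v i) * cnj (w \<bullet>c v i))"
proof -
  have "z \<bullet>c w = z \<bullet>c lincomb_fam n k (\<lambda>i. w \<bullet>c v i) v"
    using orthonormal_span_coords[OF v w] by simp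
  also have "\<dots> = (\<Sum>i<k. cnj (w \<bullet>c v i) * (z \<bullet>c v i))"
    by (rule cscalar_lincomb_fam) (use orthonormal_familyD(1)[OF v] z in auto)
  finally show ?thesis by (simp add: mult.commute)
qed

lemma family_in_span:
  assumes "i < k" "v i \<in> carrier_vec n"
  shows "v i \<in> range (\<lambda>c. lincomb_fam n k c v)"
proof
  show "v i = lincomb_fam n k (\<lambda>j. if j = i then 1 else 0) v"
    using assms unfolding lincomb_fam_def by (auto intro!: eq_vecI simp: if_distrib if_distribR cong: if_cong)
qed simp

text \<open>
  By Parseval, \<open>k = \<Sum>\<^sub>i \<parallel>v\<^sub>i\<parallel>\<^sup>2 = \<Sum>\<^sub>i\<^sub>,\<^sub>j \<bar>\<langle>v\<^sub>i, w\<^sub>j\<rangle>\<bar>\<^sup>2 = \<Sum>\<^sub>j \<parallel>w\<^sub>j\<parallel>\<^sup>2 = l\<close>.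
\<close>

lemma orthonormal_families_same_size:
  assumes v: "orthonormal_family n k v" and w: "orthonormal_family n l w"
    and eq: "range (\<lambda>c. lincomb_fam n k c v) = range (\<lambda>c. lincomb_fam n l c w)"
  shows "k = l"
proof -
  have "complex_of_nat k = (\<Sum>i<k. v i \<bullet>c v i)" using orthonormal_familyD(2)[OF v] by simp
  also have "\<dots> = (\<Sum>i<k. \<Sum>j<l. (v i \<bullet>c w j) * cnj (v i \<bullet>c w j))"
    by (intro sum.cong refl orthonormal_span_parseval[OF w])
      (use family_in_span[of _ k v n] orthonormal_familyD(1)[OF v] eq in auto)
  also have "\<dots> = (\<Sum>j<l. \<Sum>i<k. (w j \<bullet>c v i) * cnj (w j \<bullet>c v i))"
    by (subst sum.swap, intro sum.cong refl)
      (use orthonormal_familyD(1)[OF v] orthonormal_familyD(1)[OF w] in \<open>auto simp: cscalar_cnj[of _ n] mult.commute\<close>)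
  also have "\<dots> = (\<Sum>j<l. w j \<bullet>c w j)"
    by (intro sum.cong refl orthonormal_span_parseval[OF v, symmetric])
      (use family_in_span[of _ l w n] orthonormal_familyD(1)[OF w] eq in auto)
  also have "\<dots> = complex_of_nat l" using orthonormal_familyD(2)[OF w] by simp
  finally show ?thesis by simp
qed

section \<open>Principal vectors\<close>

text \<open>
  Diagonalize \<open>(V\<^sup>H U)\<^sup>H (V\<^sup>H U) = U\<^sup>H P U\<close>, where \<open>P = V V\<^sup>H\<close> is the orthogonal projection onto \<open>\<V>\<close>. If \<open>q\<^sub>i\<close>
  are its orthonormal eigenvectors, then \<open>u\<^sub>i = U q\<^sub>i\<close> and \<open>g\<^sub>i = P u\<^sub>i\<close> have the stated inner products and
  \<open>\<mu>\<^sub>i\<close> is the squared cosine of an angle. The bases \<open>U0\<close> and \<open>V0\<close> witness that the choice in the definition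
  of the angles succeeds, and they fix the sizes of the chosen bases.
\<close>

lemma principal_vectors:
  assumes U0: "orthonormal_basis_mat n U0 \<U>" and V0: "orthonormal_basis_mat n V0 \<V>"
    and t: "dim_col U0 = t" and le: "t \<le> dim_col V0"
  obtains u g \<mu> where "orthonormal_family n t u" "\<And>i. i < t \<Longrightarrow> u i \<in> \<U>" "\<And>i. i < t \<Longrightarrow> g i \<in> \<V>"
    and "\<And>h i. h \<in> \<V> \<Longrightarrow> i < t \<Longrightarrow> h \<bullet>c g i = h \<bullet>c u i"
    and "\<And>i j. i < t \<Longrightarrow> j < t \<Longrightarrow> g i \<bullet>c u j = (if i = j then complex_of_real (\<mu> i) else 0)"
    and "\<And>i. i < t \<Longrightarrow> 0 \<le> \<mu> i" "\<And>i. i < t \<Longrightarrow> \<mu> i \<le> 1"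
    and "\<And>i j. i \<le> j \<Longrightarrow> j < t \<Longrightarrow> \<mu> i \<le> \<mu> j"
    and "principal_angles n \<U> \<V> = map (\<lambda>i. arccos (sqrt (\<mu> i))) [0..<t]"
proof -
  define U where "U = (SOME U. orthonormal_basis_mat n U \<U>)"
  define V where "V = (SOME V. orthonormal_basis_mat n V \<V>)"
  define s where "s = dim_col V0"
  have Ub: "orthonormal_basis_mat n U \<U>" unfolding U_def using U0 by (rule someI)
  have Vb: "orthonormal_basis_mat n V \<V>" unfolding V_def using V0 by (rule someI)
  note UD = orthonormal_basis_matD[OF Ub] and VD = orthonormal_basis_matD[OF Vb]
  have dU: "dim_col U = t"
    using orthonormal_families_same_size[OF UD(5) orthonormal_basis_matD(5)[OF U0]]
      UD(4) orthonormal_basis_matD(4)[OF U0] t by simp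
  have dV: "dim_col V = s"
    using orthonormal_families_same_size[OF VD(5) orthonormal_basis_matD(5)[OF V0]]
      VD(4) orthonormal_basis_matD(4)[OF V0] by (simp add: s_def)
  have U: "U \<in> carrier_mat n t" and V: "V \<in> carrier_mat n s" using UD(1) VD(1) dU dV by auto
  note Ua = mat_adjoint_carrier[OF U] and Va = mat_adjoint_carrier[OF V]
  define B where "B = mat_adjoint V * U"
  have B: "B \<in> carrier_mat s t" using U Va by (auto simp: B_def)
  note Ba = mat_adjoint_carrier[OF B]
  obtain q \<mu> where q: "orthonormal_family t t q"
    and ev: "\<And>i. i < t \<Longrightarrow> (mat_adjoint B * B) *\<^sub>v q i = complex_of_real (\<mu> i) \<cdot>\<^sub>v q i"
    and nn: "\<And>i. i < t \<Longrightarrow> 0 \<le> \<mu> i" and mono: "\<And>i j. i \<le> j \<Longrightarrow> j < t \<Longrightarrow> \<mu> i \<le> \<mu> j"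
    and sv: "singular_values B = rev (map (\<lambda>i. sqrt (\<mu> i)) [0..<t])"
    using singular_vectors[OF B] le unfolding s_def by blast
  define u where "u i = U *\<^sub>v q i" for i
  define g where "g i = V *\<^sub>v (B *\<^sub>v q i)" for i
  have qc: "q i \<in> carrier_vec t" if "i < t" for i using orthonormal_familyD(1)[OF q that] .
  have Bq: "B *\<^sub>v q i \<in> carrier_vec s" if "i < t" for i using mult_mat_vec_carrier[OF B qc[OF that]] .
  have uc: "u i \<in> carrier_vec n" if "i < t" for i
    using mult_mat_vec_carrier[OF U qc[OF that]] by (simp add: u_def)
  have gc: "g i \<in> carrier_vec n" if "i < t" for i
    using mult_mat_vec_carrier[OF V Bq[OF that]] by (simp add: g_def)
  have BVU: "B *\<^sub>v q i = mat_adjoint V *\<^sub>v u i" if "i < t" for i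
    unfolding B_def u_def by (rule assoc_mult_mat_vec[OF Va U qc[OF that]])
  have uon: "orthonormal_family n t u"
    unfolding orthonormal_family_def
  proof (intro conjI allI impI)
    fix i j assume i: "i < t" and j: "j < t"
    have "u i \<bullet>c u j = q i \<bullet>c (mat_adjoint U *\<^sub>v (U *\<^sub>v q j))"
      unfolding u_def by (rule cscalar_adjoint[OF U qc[OF i] mult_mat_vec_carrier[OF U qc[OF j]]])
    also have "mat_adjoint U *\<^sub>v (U *\<^sub>v q j) = q j"
      using assoc_mult_mat_vec[OF Ua U qc[OF j]] UD(2) dU qc[OF j] by simp
    finally show "u i \<bullet>c u j = (if i = j then 1 else 0)" using orthonormal_familyD(2)[OF q i j] by simp
  qed (use uc in auto)
  have proj: "h \<bullet>c g i = h \<bullet>c u i" if h: "h \<in> \<V>" and i: "i < t" for h i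
  proof -
    obtain c where c: "c \<in> carrier_vec s" "h = V *\<^sub>v c" using h VD(3) dV by auto
    have "h \<bullet>c g i = c \<bullet>c (mat_adjoint V *\<^sub>v (V *\<^sub>v (B *\<^sub>v q i)))"
      unfolding c(2) g_def by (rule cscalar_adjoint[OF V c(1) mult_mat_vec_carrier[OF V Bq[OF i]]])
    also have "mat_adjoint V *\<^sub>v (V *\<^sub>v (B *\<^sub>v q i)) = B *\<^sub>v q i"
      using assoc_mult_mat_vec[OF Va V Bq[OF i]] VD(2) dV Bq[OF i] by simp
    also have "c \<bullet>c (B *\<^sub>v q i) = h \<bullet>c u i"
      unfolding BVU[OF i] c(2) by (rule cscalar_adjoint[OF V c(1) uc[OF i], symmetric])
    finally show ?thesis .
  qed
  have gV: "g i \<in> \<V>" if "i < t" for i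
    using VD(3) dV Bq[OF that] by (auto simp: g_def)
  have gu: "g i \<bullet>c u j = (if i = j then complex_of_real (\<mu> i) else 0)" if i: "i < t" and j: "j < t" for i j
  proof -
    have "g i \<bullet>c u j = (B *\<^sub>v q i) \<bullet>c (B *\<^sub>v q j)"
      unfolding g_def BVU[OF j] by (rule cscalar_adjoint[OF V Bq[OF i] uc[OF j]])
    also have "\<dots> = q i \<bullet>c (mat_adjoint B *\<^sub>v (B *\<^sub>v q j))"
      by (rule cscalar_adjoint[OF B qc[OF i] Bq[OF j]])
    also have "mat_adjoint B *\<^sub>v (B *\<^sub>v q j) = complex_of_real (\<mu> j) \<cdot>\<^sub>v q j"
      using assoc_mult_mat_vec[OF Ba B qc[OF j]] ev[OF j] by simp
    also have "q i \<bullet>c (complex_of_real (\<mu> j) \<cdot>\<^sub>v q j) = complex_of_real (\<mu> j) * (q i \<bullet>c q j)"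
      using qc[OF i] qc[OF j] by (simp add: cscalar_prod_sum[of _ t] sum_distrib_left mult_ac)
    finally show ?thesis using orthonormal_familyD(2)[OF q i j] by auto
  qed
  have le1: "\<mu> i \<le> 1" if i: "i < t" for i
  proof -
    \<comment> \<open>\<open>D = \<parallel>u\<^sub>i - g\<^sub>i\<parallel>\<^sup>2 = 1 - \<mu>\<^sub>i\<close>.\<close>
    define D where "D = (\<Sum>r<n. (cmod (u i $ r - g i $ r))\<^sup>2)"
    have "complex_of_real D = (\<Sum>r<n. (u i $ r - g i $ r) * cnj (u i $ r - g i $ r))"
      unfolding D_def of_real_sum complex_norm_square ..
    also have "\<dots> = u i \<bullet>c u i - g i \<bullet>c u i - u i \<bullet>c g i + g i \<bullet>c g i"
      unfolding cscalar_prod_sum[OF uc[OF i]] cscalar_prod_sum[OF gc[OF i]]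
      by (simp add: algebra_simps sum.distrib sum_subtractf)
    also have "g i \<bullet>c g i = g i \<bullet>c u i" using proj[OF gV[OF i] i] .
    also have "u i \<bullet>c g i = complex_of_real (\<mu> i)"
      using cscalar_cnj[OF gc[OF i] uc[OF i]] gu[OF i i] by simp
    also have "u i \<bullet>c u i = 1" using orthonormal_familyD(2)[OF uon i i] by simp
    finally have "complex_of_real D = complex_of_real (1 - \<mu> i)" using gu[OF i i] by simp
    hence "D = 1 - \<mu> i" by (simp only: of_real_eq_iff)
    moreover have "0 \<le> D" by (simp add: D_def sum_nonneg)
    ultimately show ?thesis by simp
  qed
  have "principal_angles n \<U> \<V> = rev (map arccos (singular_values B))"
    by (simp add: principal_angles_def U_def V_def B_def Let_def)
  also have "\<dots> = map (\<lambda>i. arccos (sqrt (\<mu> i))) [0..<t]"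
    unfolding sv by (simp add: rev_map)
  finally have pa: "principal_angles n \<U> \<V> = map (\<lambda>i. arccos (sqrt (\<mu> i))) [0..<t]" .
  have uU: "u i \<in> \<U>" if "i < t" for i
    using UD(3) dU qc[OF that] by (auto simp: u_def)
  show ?thesis by (rule that[OF uon uU gV proj gu nn le1 mono pa])
qed

section \<open>Functions of a normal matrix\<close>

lemma rank_one_sum_carrier [simp]: "rank_one_sum n c x \<in> carrier_mat n n"
  by (simp add: rank_one_sum_def)

lemma rank_one_sum_mult_vec:
  assumes x: "orthonormal_family n n x" and v: "v \<in> carrier_vec n"
  shows "rank_one_sum n c x *\<^sub>v v = lincomb_fam n n (\<lambda>j. c j * (v \<bullet>c x j)) x"
proof (rule eq_vecI)
  fix r assume "r < dim_vec (lincomb_fam n n (\<lambda>j. c j * (v \<bullet>c x j)) x)"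
  hence r: "r < n" by (simp add: lincomb_fam_def)
  have "(rank_one_sum n c x *\<^sub>v v) $ r = (\<Sum>s<n. \<Sum>j<n. c j * x j $ r * (v $ s * cnj (x j $ s)))"
    unfolding mult_mat_vec_index[OF rank_one_sum_carrier v r]
    by (intro sum.cong refl) (simp add: rank_one_sum_def r sum_distrib_left mult_ac)
  also have "\<dots> = (\<Sum>j<n. \<Sum>s<n. c j * x j $ r * (v $ s * cnj (x j $ s)))" by (rule sum.swap)
  also have "\<dots> = (\<Sum>j<n. c j * (v \<bullet>c x j) * x j $ r)"
    by (intro sum.cong refl)
      (simp add: cscalar_prod_sum[OF orthonormal_familyD(1)[OF x]] sum_distrib_left mult_ac)
  finally show "(rank_one_sum n c x *\<^sub>v v) $ r = lincomb_fam n n (\<lambda>j. c j * (v \<bullet>c x j)) x $ r"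
    by (simp add: lincomb_fam_def r)
qed (simp add: rank_one_sum_def lincomb_fam_def)

lemma lincomb_fam_cscalar_orthonormal:
  assumes x: "orthonormal_family n k x" and j: "j < k"
  shows "lincomb_fam n k c x \<bullet>c x j = c j"
proof -
  have "lincomb_fam n k c x \<bullet>c x j = (\<Sum>i<k. c i * (x i \<bullet>c x j))"
    by (rule lincomb_fam_cscalar) (use orthonormal_familyD(1)[OF x] j in auto)
  also have "\<dots> = (\<Sum>i<k. if i = j then c j else 0)"
    by (intro sum.cong refl) (use orthonormal_familyD(2)[OF x] j in auto)
  finally show ?thesis using j by simp
qed

lemma vec_eq_by_coords:
  assumes x: "orthonormal_family n n x" and "v \<in> carrier_vec n" "w \<in> carrier_vec n"
    and "\<And>j. j < n \<Longrightarrow> v \<bullet>c x j = w \<bullet>c x j"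
  shows "v = w"
proof (rule eq_vecI)
  fix r assume "r < dim_vec w"
  hence r: "r < n" using assms by simp
  show "v $ r = w $ r"
    unfolding orthonormal_family_expand[OF x assms(2) r] orthonormal_family_expand[OF x assms(3) r]
    using assms(4) by simp
qed (use assms in simp)

lemma smult_cscalar:
  fixes v w :: "complex vec"
  assumes "v \<in> carrier_vec n" "w \<in> carrier_vec n"
  shows "(c \<cdot>\<^sub>v v) \<bullet>c w = c * (v \<bullet>c w)"
  using assms by (simp add: cscalar_prod_sum[of _ n] sum_distrib_left mult_ac)

lemma rank_one_sum_eigenvector:
  assumes x: "orthonormal_family n n x" and i: "i < n"
  shows "rank_one_sum n c x *\<^sub>v x i = c i \<cdot>\<^sub>v x i"
proof (rule vec_eq_by_coords[OF x])
  have xi: "x i \<in> carrier_vec n" using orthonormal_familyD(1)[OF x i] .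
  show "rank_one_sum n c x *\<^sub>v x i \<in> carrier_vec n"
    by (rule mult_mat_vec_carrier[OF rank_one_sum_carrier xi])
  show "c i \<cdot>\<^sub>v x i \<in> carrier_vec n" using xi by simp
  fix j assume j: "j < n"
  show "(rank_one_sum n c x *\<^sub>v x i) \<bullet>c x j = (c i \<cdot>\<^sub>v x i) \<bullet>c x j"
    unfolding rank_one_sum_mult_vec[OF x xi] lincomb_fam_cscalar_orthonormal[OF x j]
      smult_cscalar[OF xi orthonormal_familyD(1)[OF x j]]
    using orthonormal_familyD(2)[OF x i j] by auto
qed

lemma mat_eq_on_orthonormal_basis:
  fixes B C :: "complex mat"
  assumes x: "orthonormal_family n n x" and B: "B \<in> carrier_mat n n" and C: "C \<in> carrier_mat n n"
    and eq: "\<And>i. i < n \<Longrightarrow> B *\<^sub>v x i = C *\<^sub>v x i"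
  shows "B = C"
proof (rule eq_matI)
  have entry: "B $$ (r, s) = (\<Sum>i<n. (B *\<^sub>v x i) $ r * cnj (x i $ s))"
    if B: "B \<in> carrier_mat n n" and r: "r < n" and s: "s < n" for B r s
  proof -
    have "(\<Sum>i<n. (B *\<^sub>v x i) $ r * cnj (x i $ s)) = (\<Sum>i<n. \<Sum>k<n. B $$ (r, k) * (x i $ k * cnj (x i $ s)))"
      by (intro sum.cong refl)
        (simp add: mult_mat_vec_index[OF B orthonormal_familyD(1)[OF x] r] sum_distrib_right mult.assoc)
    also have "\<dots> = (\<Sum>k<n. \<Sum>i<n. B $$ (r, k) * (x i $ k * cnj (x i $ s)))" by (rule sum.swap)
    also have "\<dots> = (\<Sum>k<n. if k = s then B $$ (r, s) else 0)"
      by (intro sum.cong refl)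
        (use s in \<open>simp add: orthonormal_family_complete[OF x] flip: sum_distrib_left\<close>)
    finally show ?thesis using s by simp
  qed
  fix r s assume "r < dim_row C" "s < dim_col C"
  hence rs: "r < n" "s < n" using C by auto
  show "B $$ (r, s) = C $$ (r, s)" unfolding entry[OF B rs] entry[OF C rs] using eq by simp
qed (use B C in auto)

lemma orthonormal_eigensystemD:
  assumes "A \<in> carrier_mat n n" "orthonormal_eigensystem A lam x"
  shows "orthonormal_family n n x" "\<And>j. j < n \<Longrightarrow> A *\<^sub>v x j = lam j \<cdot>\<^sub>v x j"
  using assms by (auto simp: orthonormal_eigensystem_def orthonormal_family_def)

text \<open>
  Comparing the two expansions of \<open>A x\<^sub>i\<close> shows that \<open>x\<^sub>i\<close> has a nonzero component along \<open>x'\<^sub>j\<close> only if the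
  eigenvalues agree. Thus \<open>x\<^sub>i\<close> is an eigenvector of the primed sum for the value \<open>f (lam i)\<close> as well.
\<close>

lemma rank_one_sum_eigensystem_unique:
  assumes A: "A \<in> carrier_mat n n" and e: "orthonormal_eigensystem A lam x"
    and e': "orthonormal_eigensystem A lam' x'"
  shows "rank_one_sum n (\<lambda>j. f (lam' j)) x' = rank_one_sum n (\<lambda>j. f (lam j)) x"
proof -
  note x = orthonormal_eigensystemD[OF A e] and x' = orthonormal_eigensystemD[OF A e']
  have A': "A = rank_one_sum n lam' x'"
    by (rule mat_eq_on_orthonormal_basis[OF x'(1) A])
      (simp_all add: rank_one_sum_eigenvector[OF x'(1)] x'(2))
  show ?thesis
  proof (rule mat_eq_on_orthonormal_basis[OF x(1)])
    fix i assume i: "i < n"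
    have xi: "x i \<in> carrier_vec n" by (rule orthonormal_familyD(1)[OF x(1) i])
    show "rank_one_sum n (\<lambda>j. f (lam' j)) x' *\<^sub>v x i = rank_one_sum n (\<lambda>j. f (lam j)) x *\<^sub>v x i"
      unfolding rank_one_sum_eigenvector[OF x(1) i]
    proof (rule vec_eq_by_coords[OF x'(1)])
      show "rank_one_sum n (\<lambda>j. f (lam' j)) x' *\<^sub>v x i \<in> carrier_vec n"
        by (rule mult_mat_vec_carrier[OF rank_one_sum_carrier xi])
      show "f (lam i) \<cdot>\<^sub>v x i \<in> carrier_vec n" using xi by simp
      fix j assume j: "j < n"
      have "(A *\<^sub>v x i) \<bullet>c x' j = lam' j * (x i \<bullet>c x' j)"
        unfolding A' rank_one_sum_mult_vec[OF x'(1) xi] by (rule lincomb_fam_cscalar_orthonormal[OF x'(1) j])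
      moreover have "(A *\<^sub>v x i) \<bullet>c x' j = lam i * (x i \<bullet>c x' j)"
        unfolding x(2)[OF i] by (rule smult_cscalar[OF xi orthonormal_familyD(1)[OF x'(1) j]])
      ultimately have "lam' j = lam i \<or> x i \<bullet>c x' j = 0" by (auto simp: mult_cancel_right)
      thus "(rank_one_sum n (\<lambda>j. f (lam' j)) x' *\<^sub>v x i) \<bullet>c x' j = (f (lam i) \<cdot>\<^sub>v x i) \<bullet>c x' j"
        unfolding rank_one_sum_mult_vec[OF x'(1) xi] lincomb_fam_cscalar_orthonormal[OF x'(1) j]
          smult_cscalar[OF xi orthonormal_familyD(1)[OF x'(1) j]] by auto
    qed
  qed simp_all
qed

lemma normal_mat_fun_eq:
  assumes A: "A \<in> carrier_mat n n" and e: "orthonormal_eigensystem A lam x"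
  shows "normal_mat_fun f A = rank_one_sum n (\<lambda>j. f (lam j)) x"
  unfolding normal_mat_fun_def
proof (rule the_equality)
  show "\<exists>lam' x'. orthonormal_eigensystem A lam' x' \<and>
      rank_one_sum n (\<lambda>j. f (lam j)) x = rank_one_sum (dim_row A) (\<lambda>j. f (lam' j)) x'"
    using e A by auto
  fix B assume "\<exists>lam' x'. orthonormal_eigensystem A lam' x' \<and> B = rank_one_sum (dim_row A) (\<lambda>j. f (lam' j)) x'"
  thus "B = rank_one_sum n (\<lambda>j. f (lam j)) x"
    using rank_one_sum_eigensystem_unique[OF A e] A by auto
qed

text \<open>
  The inner products with \<open>e\<^sub>j\<close> read off the coefficients of a linear combination of the \<open>w\<^sub>i\<close>.
\<close>

lemma biorthogonal_lin_indpt: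
  fixes w e :: "nat \<Rightarrow> complex vec"
  assumes w: "\<And>i. i < k \<Longrightarrow> w i \<in> carrier_vec n" and e: "\<And>i. i < k \<Longrightarrow> e i \<in> carrier_vec n"
    and bi: "\<And>i j. i < k \<Longrightarrow> j < k \<Longrightarrow> w i \<bullet>c e j = (if i = j then 1 else 0 :: complex)"
  shows "inj_on w {..<k}" "\<not> module.lin_dep class_ring (cspace n) (w ` {..<k})"
proof -
  interpret vec_space "TYPE(complex)" n .
  show inj: "inj_on w {..<k}"
  proof (rule inj_onI)
    fix i j assume ij: "i \<in> {..<k}" "j \<in> {..<k}" and "w i = w j"
    with bi[of i j] bi[of j j] show "i = j" by (auto split: if_splits)
  qed
  have sub: "w ` {..<k} \<subseteq> carrier_vec n" using w by auto
  have trivial: "\<forall>v\<in>w ` {..<k}. a v = 0" if 0: "lincomb a (w ` {..<k}) = 0\<^sub>v n" for a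
  proof -
    have "a (w j) = 0" if j: "j < k" for j
    proof -
      have "lincomb a (w ` {..<k}) = lincomb_fam n k (\<lambda>i. a (w i)) w"
        by (rule eq_vecI)
          (auto simp: lincomb_index[OF _ sub] lincomb_fam_def sum.reindex[OF inj] lincomb_dim[OF _ sub])
      hence "0\<^sub>v n = lincomb_fam n k (\<lambda>i. a (w i)) w" using 0 by simp
      hence "0\<^sub>v n \<bullet>c e j = (\<Sum>i<k. a (w i) * (w i \<bullet>c e j))"
        using lincomb_fam_cscalar[OF w e[OF j]] by simp
      also have "\<dots> = (\<Sum>i<k. if i = j then a (w j) else 0)"
        by (intro sum.cong refl) (use bi j in auto)
      also have "\<dots> = a (w j)" using j by simp
      finally show ?thesis using e[OF j] by simp
    qed
    thus ?thesis by auto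
  qed
  show "lin_indpt (w ` {..<k})"
    by (rule finite_lin_indpt2) (use sub trivial in auto)
qed

text \<open>
  This provides the orthonormal bases of \<open>\<Y>\<^sub>\<tau>\<close> and \<open>\<Y>'\<close> in the definition of the principal angles: both
  subspaces are spanned by families that are biorthogonal to eigenvectors.
\<close>

lemma biorthogonal_orthonormal_basis:
  fixes w e :: "nat \<Rightarrow> complex vec"
  assumes w: "\<And>i. i < k \<Longrightarrow> w i \<in> carrier_vec n" and e: "\<And>i. i < k \<Longrightarrow> e i \<in> carrier_vec n"
    and bi: "\<And>i j. i < k \<Longrightarrow> j < k \<Longrightarrow> w i \<bullet>c e j = (if i = j then 1 else 0 :: complex)"
  shows "\<exists>U. orthonormal_basis_mat n U (cspan n (w ` {..<k})) \<and> dim_col U = k"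
proof -
  interpret cof_vec_space n "TYPE(complex)" .
  define us where "us = gram_schmidt n (map w [0..<k])"
  have set: "set (map w [0..<k]) = w ` {..<k}" by auto
  have sub: "set (map w [0..<k]) \<subseteq> carrier_vec n" using w by auto
  have dist: "distinct (map w [0..<k])"
    using biorthogonal_lin_indpt(1)[OF w e bi] by (simp add: distinct_map atLeast0LessThan)
  have ind: "\<not> lin_dep (set (map w [0..<k]))"
    unfolding set by (rule biorthogonal_lin_indpt(2)[OF w e bi])
  note gs = gram_schmidt_result[OF sub dist ind us_def]
  have len: "length us = k" using gs(4) by simp
  obtain c where c: "\<And>i. i < k \<Longrightarrow> c i \<noteq> 0" and on: "orthonormal_family n k (\<lambda>i. c i \<cdot>\<^sub>v us ! i)"
    using corthogonal_normalize[OF gs(3,2) len] by metis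
  have usc: "us ! i \<in> carrier_vec n" if "i < k" for i using that gs(3) len by auto
  have us_img: "set us = (\<lambda>i. us ! i) ` {..<k}"
    using len by (metis atLeast_upt image_set map_nth)
  have idx: "(c i \<cdot>\<^sub>v us ! i) $ r = c i * us ! i $ r" if "i < k" "r < n" for i r
    using carrier_vecD[OF usc[OF that(1)]] that by simp
  have scale: "lincomb_fam n k a (\<lambda>i. c i \<cdot>\<^sub>v us ! i) = lincomb_fam n k (\<lambda>i. a i * c i) (\<lambda>i. us ! i)" for a
    unfolding lincomb_fam_def by (auto simp: idx intro!: eq_vecI sum.cong)
  have scale': "lincomb_fam n k a (\<lambda>i. us ! i) = lincomb_fam n k (\<lambda>i. a i / c i) (\<lambda>i. c i \<cdot>\<^sub>v us ! i)" for a
    unfolding scale using c unfolding lincomb_fam_def by (auto intro!: eq_vecI sum.cong)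
  have "cspan n ((\<lambda>i. c i \<cdot>\<^sub>v us ! i) ` {..<k}) = range (\<lambda>a. lincomb_fam n k a (\<lambda>i. c i \<cdot>\<^sub>v us ! i))"
    by (rule cspan_family) (use usc in simp)
  also have "\<dots> = range (\<lambda>a. lincomb_fam n k a (\<lambda>i. us ! i))"
  proof (intro equalityI subsetI)
    fix z assume "z \<in> range (\<lambda>a. lincomb_fam n k a (\<lambda>i. c i \<cdot>\<^sub>v us ! i))"
    thus "z \<in> range (\<lambda>a. lincomb_fam n k a (\<lambda>i. us ! i))" using scale by blast
  next
    fix z assume "z \<in> range (\<lambda>a. lincomb_fam n k a (\<lambda>i. us ! i))"
    thus "z \<in> range (\<lambda>a. lincomb_fam n k a (\<lambda>i. c i \<cdot>\<^sub>v us ! i))" using scale' by blast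
  qed
  also have "\<dots> = cspan n ((\<lambda>i. us ! i) ` {..<k})" by (rule cspan_family[symmetric]) (rule usc)
  also have "\<dots> = cspan n (w ` {..<k})" using gs(1) unfolding us_img set by simp
  finally have span_eq: "cspan n ((\<lambda>i. c i \<cdot>\<^sub>v us ! i) ` {..<k}) = cspan n (w ` {..<k})" .
  show ?thesis
  proof (intro exI conjI)
    show "orthonormal_basis_mat n (mat_of_cols n (map (\<lambda>i. c i \<cdot>\<^sub>v us ! i) [0..<k])) (cspan n (w ` {..<k}))"
      using orthonormal_basis_mat_of_family[OF on] unfolding span_eq .
    show "dim_col (mat_of_cols n (map (\<lambda>i. c i \<cdot>\<^sub>v us ! i) [0..<k])) = k"
      by simp
  qed
qed

text \<open>
  An orthonormal family is biorthogonal to itself, so the columns form a basis.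
\<close>

lemma dim_col_orthonormal_basis_mat:
  assumes sub: "csubspace n W" and U: "orthonormal_basis_mat n U W"
  shows "dim_col U = cdim n W"
proof -
  interpret vec_space "TYPE(complex)" n .
  define k where "k = dim_col U"
  have UD: "U \<in> carrier_mat n k" "orthonormal_family n k (col U)"
    unfolding k_def by (rule orthonormal_basis_matD(1)[OF U], rule orthonormal_basis_matD(5)[OF U])
  have span: "span (set (cols U)) = W" using U by (simp add: orthonormal_basis_mat_def)
  have cols: "set (cols U) = col U ` {..<k}" by (auto simp: cols_def k_def)
  note ind = biorthogonal_lin_indpt[OF orthonormal_familyD(1)[OF UD(2)] orthonormal_familyD(1)[OF UD(2)]
      orthonormal_familyD(2)[OF UD(2)]]
  have sm: "submodule class_ring W V" by (rule VectorSpace.subspace.submod[OF sub])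
  have colsW: "set (cols U) \<subseteq> W"
    unfolding span[symmetric] by (rule in_own_span) (auto simp: cols col_in_carrier[OF UD(1)])
  interpret W: vectorspace class_ring "V\<lparr>carrier := W\<rparr>" by (rule subspace_is_vs[OF sub])
  note nd = span_li_not_depend[OF colsW sm]
  have "W.basis (set (cols U))"
    unfolding W.basis_def nd span using ind(2) colsW by (simp add: cols)
  hence "W.dim = card (set (cols U))" by (intro W.dim_basis) auto
  also have "\<dots> = k" unfolding cols using card_image[OF ind(1)] by simp
  finally show ?thesis by (simp add: k_def)
qed

section \<open>The biorthogonal basis\<close>

lemma lincomb_fam_in_span:
  assumes g: "\<And>j. j < m \<Longrightarrow> g j \<in> range (\<lambda>c. lincomb_fam n k c v)"
  shows "lincomb_fam n m d g \<in> range (\<lambda>c. lincomb_fam n k c v)"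
proof -
  have "\<forall>j. \<exists>c. j < m \<longrightarrow> g j = lincomb_fam n k c v" using g by blast
  from choice[OF this] obtain C where C: "\<And>j. j < m \<Longrightarrow> g j = lincomb_fam n k (C j) v" by blast
  have "lincomb_fam n m d g = lincomb_fam n k (\<lambda>i. \<Sum>j<m. d j * C j i) v"
  proof (rule eq_vecI)
    fix r assume "r < dim_vec (lincomb_fam n k (\<lambda>i. \<Sum>j<m. d j * C j i) v)"
    hence r: "r < n" by (simp add: lincomb_fam_def)
    have "lincomb_fam n m d g $ r = (\<Sum>j<m. \<Sum>i<k. d j * C j i * v i $ r)"
      using r C by (simp add: lincomb_fam_def sum_distrib_left mult.assoc)
    also have "\<dots> = (\<Sum>i<k. \<Sum>j<m. d j * C j i * v i $ r)" by (rule sum.swap)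
    finally show "lincomb_fam n m d g $ r = lincomb_fam n k (\<lambda>i. \<Sum>j<m. d j * C j i) v $ r"
      using r by (simp add: lincomb_fam_def sum_distrib_right)
  qed (simp add: lincomb_fam_def)
  thus ?thesis by blast
qed

text \<open>
  The matrix of the \<open>u\<^sub>i\<close> in the basis \<open>e\<close> is unitary.
\<close>

lemma orthonormal_change_of_basis:
  assumes e: "orthonormal_family n t e" and u: "orthonormal_family n t u"
    and ue: "\<forall>i<t. u i \<in> range (\<lambda>c. lincomb_fam n t c e)"
  shows "\<And>i j. i < t \<Longrightarrow> j < t \<Longrightarrow> (\<Sum>a<t. (u i \<bullet>c e a) * cnj (u j \<bullet>c e a)) = (if i = j then 1 else 0)"
    and "\<And>a b. a < t \<Longrightarrow> b < t \<Longrightarrow> (\<Sum>i<t. (u i \<bullet>c e a) * cnj (u i \<bullet>c e b)) = (if a = b then 1 else 0)"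
    and "\<And>(z :: complex vec) a. z \<in> carrier_vec n \<Longrightarrow> a < t \<Longrightarrow> z \<bullet>c e a = (\<Sum>j<t. (u j \<bullet>c e a) * (z \<bullet>c u j))"
proof -
  show rows: "(\<Sum>a<t. (u i \<bullet>c e a) * cnj (u j \<bullet>c e a)) = (if i = j then 1 else 0)" if "i < t" "j < t" for i j
    using orthonormal_span_parseval[OF e ue[rule_format, OF that(2)] orthonormal_familyD(1)[OF u that(1)]]
      orthonormal_familyD(2)[OF u that] by simp
  show cols: "(\<Sum>i<t. (u i \<bullet>c e a) * cnj (u i \<bullet>c e b)) = (if a = b then 1 else 0)" if "a < t" "b < t" for a b
    by (rule orthonormal_array_transpose[where q = "\<lambda>i a. u i \<bullet>c e a", OF rows that])
  fix z :: "complex vec" and a assume z: "z \<in> carrier_vec n" and a: "a < t"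
  have "(\<Sum>j<t. (u j \<bullet>c e a) * (z \<bullet>c u j))
      = (\<Sum>j<t. \<Sum>b<t. (z \<bullet>c e b) * ((u j \<bullet>c e a) * cnj (u j \<bullet>c e b)))"
    by (intro sum.cong refl)
      (simp add: orthonormal_span_parseval[OF e ue[rule_format] z] sum_distrib_left mult_ac)
  also have "\<dots> = (\<Sum>b<t. \<Sum>j<t. (z \<bullet>c e b) * ((u j \<bullet>c e a) * cnj (u j \<bullet>c e b)))" by (rule sum.swap)
  also have "\<dots> = (\<Sum>b<t. if b = a then z \<bullet>c e a else 0)"
    by (intro sum.cong refl) (use a in \<open>auto simp: cols simp flip: sum_distrib_left\<close>)
  finally show "z \<bullet>c e a = (\<Sum>j<t. (u j \<bullet>c e a) * (z \<bullet>c u j))" using a by simp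
qed

lemma orthonormal_basis_mat_of_family_dim:
  assumes "orthonormal_family n k v"
  shows "orthonormal_basis_mat n (mat_of_cols n (map v [0..<k])) (cspan n (v ` {..<k}))"
    and "dim_col (mat_of_cols n (map v [0..<k])) = k"
  using orthonormal_basis_mat_of_family[OF assms] by simp_all

text \<open>
  As the largest angle is less than \<open>\<pi>/2\<close>, all squared cosines \<open>\<mu>\<^sub>j\<close> are positive. Rescaling the projections
  \<open>g\<^sub>j\<close> by \<open>1/\<mu>\<^sub>j\<close> and rotating back from the principal vectors to the \<open>x\<^sub>b\<close> produces vectors of
  \<open>\<Y>\<close> biorthogonal to the \<open>x\<^sub>a\<close>. Their coordinates form a right inverse of \<open>X\<^sup>H Yt\<close>, so this matrix is
  invertible and \<open>mat_inverse\<close> returns its inverse.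
\<close>

lemma biorthogonal_basis_props:
  assumes x: "orthonormal_family n p x" and Yb: "orthonormal_basis_mat n Yt \<Y>" and dY: "dim_col Yt = p"
    and p: "1 \<le> p" and ang: "largest_angle n (cspan n (x ` {..<p})) \<Y> < pi / 2"
  defines "y \<equiv> biorthogonal_basis (mat_of_cols n (map x [0..<p])) Yt"
  shows "\<And>i. i < p \<Longrightarrow> y i \<in> carrier_vec n"
    and "\<And>i a. i < p \<Longrightarrow> a < p \<Longrightarrow> y i \<bullet>c x a = (if i = a then 1 else 0)"
    and "\<Y> = range (\<lambda>c. lincomb_fam n p c y)"
proof -
  define X where "X = mat_of_cols n (map x [0..<p])"
  note XB = orthonormal_basis_mat_of_family_dim[OF x, folded X_def]
  note YD = orthonormal_basis_matD[OF Yb, unfolded dY]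
  note xc = orthonormal_familyD(1)[OF x]
  have X: "X \<in> carrier_mat n p" unfolding X_def by (rule carrier_matI) simp_all
  have Yt: "Yt \<in> carrier_mat n p" by (rule YD(1))
  note Xa = mat_adjoint_carrier[OF X]
  have le: "p \<le> dim_col Yt" by (simp add: dY)
  obtain u g \<mu> where u: "orthonormal_family n p u" "\<And>i. i < p \<Longrightarrow> u i \<in> cspan n (x ` {..<p})"
    and g: "\<And>i. i < p \<Longrightarrow> g i \<in> \<Y>"
    and "\<And>h i. h \<in> \<Y> \<Longrightarrow> i < p \<Longrightarrow> h \<bullet>c g i = h \<bullet>c u i"
    and gu: "\<And>i j. i < p \<Longrightarrow> j < p \<Longrightarrow> g i \<bullet>c u j = (if i = j then complex_of_real (\<mu> i) else 0)"
    and nn: "\<And>i. i < p \<Longrightarrow> 0 \<le> \<mu> i" and "\<And>i. i < p \<Longrightarrow> \<mu> i \<le> 1"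
    and mono: "\<And>i j. i \<le> j \<Longrightarrow> j < p \<Longrightarrow> \<mu> i \<le> \<mu> j"
    and pa: "principal_angles n (cspan n (x ` {..<p})) \<Y> = map (\<lambda>i. arccos (sqrt (\<mu> i))) [0..<p]"
  proof (rule principal_vectors[OF XB(1) Yb XB(2) le], goal_cases)
    case (1 u g \<mu>)
    show thesis by (rule 1(1)[OF 1(2-)])
  qed
  have "largest_angle n (cspan n (x ` {..<p})) \<Y> = arccos (sqrt (\<mu> 0))"
    using p by (simp add: largest_angle_def pa hd_map)
  hence "\<mu> 0 \<noteq> 0" using ang by auto
  hence pos: "0 < \<mu> i" if "i < p" for i using nn[of 0] mono[of 0 i] that p by force
  have xspan: "cspan n (x ` {..<p}) = range (\<lambda>c. lincomb_fam n p c x)"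
    by (rule cspan_family) (rule xc)
  have ux: "\<forall>i<p. u i \<in> range (\<lambda>c. lincomb_fam n p c x)" using u(2) unfolding xspan by blast
  note cb = orthonormal_change_of_basis[OF x u(1) ux]
  have gc: "g i \<in> carrier_vec n" if "i < p" for i
    using g[OF that] unfolding YD(4) by auto
  have gx: "g j \<bullet>c x a = (u j \<bullet>c x a) * complex_of_real (\<mu> j)" if "j < p" "a < p" for j a
  proof -
    have "g j \<bullet>c x a = (\<Sum>l<p. (u l \<bullet>c x a) * (g j \<bullet>c u l))" by (rule cb(3)[OF gc[OF that(1)] that(2)])
    also have "\<dots> = (\<Sum>l<p. if l = j then (u j \<bullet>c x a) * complex_of_real (\<mu> j) else 0)"
      by (intro sum.cong refl) (use gu that in auto)
    finally show ?thesis using that by simp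
  qed
  \<comment> \<open>\<open>x\<^sub>b = \<Sum>\<^sub>j (cnj \<langle>u\<^sub>j, x\<^sub>b\<rangle>) u\<^sub>j\<close>, with each \<open>u\<^sub>j\<close> replaced by its lift \<open>g\<^sub>j / \<mu>\<^sub>j\<close> to \<open>\<Y>\<close>.\<close>
  define h where "h b = lincomb_fam n p (\<lambda>j. cnj (u j \<bullet>c x b) / complex_of_real (\<mu> j)) g" for b
  have hY: "h b \<in> \<Y>" for b
    unfolding h_def YD(4) by (rule lincomb_fam_in_span) (use g in \<open>simp add: YD(4)\<close>)
  have hx: "h b \<bullet>c x a = (if a = b then 1 else 0)" if "a < p" "b < p" for a b
  proof -
    have "h b \<bullet>c x a = (\<Sum>j<p. cnj (u j \<bullet>c x b) / complex_of_real (\<mu> j) * (g j \<bullet>c x a))"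
      unfolding h_def by (rule lincomb_fam_cscalar[OF gc xc[OF that(1)]])
    also have "\<dots> = (\<Sum>j<p. (u j \<bullet>c x a) * cnj (u j \<bullet>c x b))"
    proof (intro sum.cong refl)
      fix j assume "j \<in> {..<p}"
      hence "j < p" "complex_of_real (\<mu> j) \<noteq> 0" using pos[of j] by auto
      thus "cnj (u j \<bullet>c x b) / complex_of_real (\<mu> j) * (g j \<bullet>c x a) = (u j \<bullet>c x a) * cnj (u j \<bullet>c x b)"
        by (simp add: gx[OF _ that(1)] field_simps)
    qed
    finally show ?thesis using cb(2)[OF that] by simp
  qed
  define N where "N = mat_adjoint X * Yt"
  have N: "N \<in> carrier_mat p p" unfolding N_def using Xa Yt by auto
  have Nc: "(N *\<^sub>v c) $ a = (Yt *\<^sub>v c) \<bullet>c x a" if c: "c \<in> carrier_vec p" and a: "a < p" for c a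
  proof -
    have Yc: "Yt *\<^sub>v c \<in> carrier_vec n" by (rule mult_mat_vec_carrier[OF Yt c])
    have "N *\<^sub>v c = mat_adjoint X *\<^sub>v (Yt *\<^sub>v c)"
      unfolding N_def by (rule assoc_mult_mat_vec[OF Xa Yt c])
    moreover have "(mat_adjoint X *\<^sub>v (Yt *\<^sub>v c)) $ a = (Yt *\<^sub>v c) \<bullet>c x a"
      unfolding mult_mat_vec_index[OF Xa Yc a] cscalar_prod_sum[OF xc[OF a]]
      by (intro sum.cong refl) (use a X in \<open>simp add: mat_adjoint_index X_def mat_of_cols_index mult.commute\<close>)
    ultimately show ?thesis by simp
  qed
  have "\<forall>b. \<exists>c. c \<in> carrier_vec p \<and> h b = Yt *\<^sub>v c" using hY unfolding YD(3) by blast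
  from choice[OF this] obtain k where k: "\<And>b. k b \<in> carrier_vec p" "\<And>b. h b = Yt *\<^sub>v k b" by blast
  define K where "K = mat p p (\<lambda>(i, b). k b $ i)"
  have K: "K \<in> carrier_mat p p" by (simp add: K_def)
  have NK: "N * K = 1\<^sub>m p"
  proof (rule eq_matI)
    fix a b assume "a < dim_row (1\<^sub>m p :: complex mat)" "b < dim_col (1\<^sub>m p :: complex mat)"
    hence ab: "a < p" "b < p" by auto
    have "(N * K) $$ (a, b) = (N *\<^sub>v k b) $ a"
      unfolding mat_mult_index[OF N K ab] mult_mat_vec_index[OF N k(1) ab(1)]
      by (intro sum.cong refl) (use ab in \<open>simp add: K_def\<close>)
    also have "\<dots> = h b \<bullet>c x a" unfolding Nc[OF k(1) ab(1)] k(2) ..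
    finally show "(N * K) $$ (a, b) = 1\<^sub>m p $$ (a, b)" using hx[OF ab] ab by simp
  qed (use N K in auto)
  have KN: "K * N = 1\<^sub>m p" by (rule mat_mult_left_right_inverse[OF N K NK])
  have "N \<in> Units (ring_mat TYPE(complex) p ())"
    unfolding Units_def ring_mat_simps using N K NK KN by blast
  then obtain B where Bs: "mat_inverse N = Some B"
    using mat_inverse(1)[OF N, of "()"] by (cases "mat_inverse N") auto
  have B: "N * B = 1\<^sub>m p" "B * N = 1\<^sub>m p" "B \<in> carrier_mat p p"
    using mat_inverse(2)[OF N Bs] by auto
  have yB: "y i = Yt *\<^sub>v col B i" for i
    unfolding y_def biorthogonal_basis_def X_def[symmetric] N_def[symmetric] Bs by simp
  have cB: "col B i \<in> carrier_vec p" for i by (rule col_in_carrier[OF B(3)])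
  show yc: "y i \<in> carrier_vec n" if "i < p" for i
    unfolding yB by (rule mult_mat_vec_carrier[OF Yt cB])
  show "y i \<bullet>c x a = (if i = a then 1 else 0)" if "i < p" "a < p" for i a
  proof -
    have "y i \<bullet>c x a = (N *\<^sub>v col B i) $ a" unfolding yB by (rule Nc[OF cB that(2), symmetric])
    also have "\<dots> = (N * B) $$ (a, i)"
      unfolding mat_mult_index[OF N B(3) that(2,1)] mult_mat_vec_index[OF N cB that(2)]
      by (intro sum.cong refl) (use that B(3) in simp)
    finally show ?thesis using that by (auto simp: B(1))
  qed
  show "\<Y> = range (\<lambda>c. lincomb_fam n p c y)"
  proof (intro equalityI subsetI)
    fix v assume "v \<in> \<Y>"
    then obtain c where c: "c \<in> carrier_vec p" "v = Yt *\<^sub>v c" unfolding YD(3) by auto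
    have Ncc: "N *\<^sub>v c \<in> carrier_vec p" by (rule mult_mat_vec_carrier[OF N c(1)])
    have YB: "Yt * B \<in> carrier_mat n p" using Yt B(3) by auto
    have "c = B *\<^sub>v (N *\<^sub>v c)"
      using assoc_mult_mat_vec[OF B(3) N c(1)] unfolding B(2) using c(1) by simp
    hence "v = (Yt * B) *\<^sub>v (N *\<^sub>v c)"
      using assoc_mult_mat_vec[OF Yt B(3) Ncc] c(2) by simp
    also have "\<dots> = lincomb_fam n p (\<lambda>i. (N *\<^sub>v c) $ i) (col (Yt * B))"
      by (rule mult_mat_vec_lincomb_fam[OF YB Ncc])
    also have "\<dots> = lincomb_fam n p (\<lambda>i. (N *\<^sub>v c) $ i) y"
      unfolding lincomb_fam_def by (intro arg_cong[where f = "vec n"] ext sum.cong refl)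
        (simp add: yB col_mult2[OF Yt B(3)])
    finally show "v \<in> range (\<lambda>c. lincomb_fam n p c y)" by blast
  next
    fix v assume "v \<in> range (\<lambda>c. lincomb_fam n p c y)"
    then obtain c where "v = lincomb_fam n p c y" by auto
    moreover have "y j \<in> range (\<lambda>c. lincomb_fam n p c (col Yt))" if "j < p" for j
      unfolding YD(4)[symmetric] unfolding YD(3) yB using cB by blast
    ultimately show "v \<in> \<Y>" unfolding YD(4) using lincomb_fam_in_span[of p y n p "col Yt" c] by simp
  qed
qed

section \<open>Tangents of principal angles\<close>

lemma tan_arccos_sqrt:
  assumes "0 < \<mu>" "\<mu> \<le> 1"
  shows "tan (arccos (sqrt \<mu>)) = sqrt (1 / \<mu> - 1)"
proof -
  have "0 \<le> sqrt \<mu>" and s: "sqrt \<mu> \<le> 1" using assms by simp_all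
  hence m: "-1 \<le> sqrt \<mu>" by linarith
  have "tan (arccos (sqrt \<mu>)) = sqrt (1 - (sqrt \<mu>)\<^sup>2) / sqrt \<mu>"
    unfolding tan_def sin_arccos[OF m s] cos_arccos[OF m s] ..
  also have "\<dots> = sqrt ((1 - \<mu>) / \<mu>)" using assms by (simp add: real_sqrt_divide)
  also have "(1 - \<mu>) / \<mu> = 1 / \<mu> - 1" using assms by (simp add: field_simps)
  finally show ?thesis .
qed

text \<open>
  Here \<open>q i\<close> are the coordinates of the principal vector \<open>u\<^sub>i\<close> in the basis \<open>e\<close>, and
  \<open>w\<^sub>i = g\<^sub>i / \<mu>\<^sub>i - u\<^sub>i\<close> is the component orthogonal to all \<open>e\<^sub>a\<close> of the vector of \<open>\<V>\<close> lying above \<open>u\<^sub>i\<close>; its length is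
  the tangent \<open>\<sigma>\<^sub>i\<close>. The vector \<open>h\<^sub>i = \<Sum>\<^sub>a q\<^sub>i\<^sub>a z\<^sub>a\<close> is another element of \<open>\<V>\<close> above \<open>u\<^sub>i\<close>. Since \<open>g\<^sub>j\<close> is the
  projection of \<open>u\<^sub>j\<close>, every \<open>v \<in> \<V>\<close> satisfies \<open>\<langle>v, w\<^sub>j\<rangle> = \<langle>v, u\<^sub>j\<rangle> \<sigma>\<^sub>j\<^sup>2\<close>, which evaluates the inner products of
  \<open>h\<^sub>i\<close> and of \<open>g\<^sub>i\<close> with \<open>w\<^sub>j\<close>. The existence of \<open>h\<^sub>i\<close> also forces \<open>\<mu>\<^sub>i > 0\<close>.
\<close>

lemma tangent_vectors:
  fixes e z :: "nat \<Rightarrow> complex vec"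
  assumes e: "orthonormal_family n t e" and V0: "orthonormal_basis_mat n V0 \<V>" and le: "t \<le> dim_col V0"
    and zV: "\<And>a. a < t \<Longrightarrow> z a \<in> \<V>"
    and ze: "\<And>a b. a < t \<Longrightarrow> b < t \<Longrightarrow> z a \<bullet>c e b = (if a = b then 1 else 0)"
  obtains q :: "nat \<Rightarrow> nat \<Rightarrow> complex" and w :: "nat \<Rightarrow> complex vec" and \<sigma> :: "nat \<Rightarrow> real"
  where "\<And>i j. i < t \<Longrightarrow> j < t \<Longrightarrow> (\<Sum>a<t. q i a * cnj (q j a)) = (if i = j then 1 else 0)"
    and "\<And>i. i < t \<Longrightarrow> w i \<in> carrier_vec n"
    and "\<And>i j. i < t \<Longrightarrow> j < t \<Longrightarrow> w i \<bullet>c w j = (if i = j then complex_of_real ((\<sigma> i)\<^sup>2) else 0)"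
    and "\<And>i a. i < t \<Longrightarrow> a < t \<Longrightarrow> w i \<bullet>c e a = 0"
    and "\<And>i j. i < t \<Longrightarrow> j < t \<Longrightarrow>
          lincomb_fam n t (q i) z \<bullet>c w j = (if i = j then complex_of_real ((\<sigma> i)\<^sup>2) else 0)"
    and "\<And>i. i < t \<Longrightarrow> lincomb_fam n t (q i) e + w i \<in> \<V>"
    and "\<And>i. i < t \<Longrightarrow> 0 \<le> \<sigma> i" and "\<And>i j. i \<le> j \<Longrightarrow> j < t \<Longrightarrow> \<sigma> j \<le> \<sigma> i"
    and "tan_principal_angles n (cspan n (e ` {..<t})) \<V> = map \<sigma> [0..<t]"
proof -
  define \<U> where "\<U> = cspan n (e ` {..<t})"
  note UB = orthonormal_basis_mat_of_family_dim[OF e, folded \<U>_def]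
  note VD = orthonormal_basis_matD[OF V0]
  note ec = orthonormal_familyD(1)[OF e]
  obtain u g \<mu> where u: "orthonormal_family n t u" "\<And>i. i < t \<Longrightarrow> u i \<in> \<U>"
    and g: "\<And>i. i < t \<Longrightarrow> g i \<in> \<V>"
    and proj: "\<And>h i. h \<in> \<V> \<Longrightarrow> i < t \<Longrightarrow> h \<bullet>c g i = h \<bullet>c u i"
    and gu: "\<And>i j. i < t \<Longrightarrow> j < t \<Longrightarrow> g i \<bullet>c u j = (if i = j then complex_of_real (\<mu> i) else 0)"
    and nn: "\<And>i. i < t \<Longrightarrow> 0 \<le> \<mu> i" and le1: "\<And>i. i < t \<Longrightarrow> \<mu> i \<le> 1"
    and mono: "\<And>i j. i \<le> j \<Longrightarrow> j < t \<Longrightarrow> \<mu> i \<le> \<mu> j"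
    and pa: "principal_angles n \<U> \<V> = map (\<lambda>i. arccos (sqrt (\<mu> i))) [0..<t]"
  proof (rule principal_vectors[OF UB(1) V0 UB(2) le], goal_cases)
    case (1 u g \<mu>)
    show thesis by (rule 1(1)[OF 1(2-)])
  qed
  have Vc: "v \<in> carrier_vec n" if v: "v \<in> \<V>" for v
  proof -
    obtain c where "v = lincomb_fam n (dim_col V0) c (col V0)"
      using v unfolding VD(4) by blast
    thus ?thesis by simp
  qed
  have V_lincomb: "lincomb_fam n m d h \<in> \<V>" if h: "\<And>j. j < m \<Longrightarrow> h j \<in> \<V>" for m d h
  proof -
    define R where "R = range (\<lambda>c. lincomb_fam n (dim_col V0) c (col V0))"
    have VR: "\<V> = R" unfolding R_def by (rule VD(4))
    have "h j \<in> range (\<lambda>c. lincomb_fam n (dim_col V0) c (col V0))" if "j < m" for j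
      using h[OF that] unfolding VR R_def .
    hence "lincomb_fam n m d h \<in> R" unfolding R_def by (rule lincomb_fam_in_span)
    thus ?thesis unfolding VR .
  qed
  note uc = orthonormal_familyD(1)[OF u(1)]
  note gc = Vc[OF g] and zc = Vc[OF zV]
  have span: "cspan n (e ` {..<t}) = range (\<lambda>c. lincomb_fam n t c e)"
    by (rule cspan_family) (rule ec)
  have ue: "\<forall>i<t. u i \<in> range (\<lambda>c. lincomb_fam n t c e)"
  proof (intro allI impI)
    fix i assume "i < t"
    from u(2)[OF this] show "u i \<in> range (\<lambda>c. lincomb_fam n t c e)"
      unfolding \<U>_def span .
  qed
  note cb = orthonormal_change_of_basis[OF e u(1) ue]
  define q where "q i a = u i \<bullet>c e a" for i a
  have u_eq: "u i = lincomb_fam n t (q i) e" if "i < t" for i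
    unfolding q_def by (rule orthonormal_span_coords[OF e]) (use ue that in blast)
  define h where "h i = lincomb_fam n t (q i) z" for i
  have hV: "h i \<in> \<V>" for i unfolding h_def by (rule V_lincomb) (rule zV)
  have he: "h i \<bullet>c e b = q i b" if "b < t" for i b
  proof -
    have "h i \<bullet>c e b = (\<Sum>a<t. q i a * (z a \<bullet>c e b))"
      unfolding h_def by (rule lincomb_fam_cscalar[OF zc ec[OF that]])
    also have "\<dots> = (\<Sum>a<t. if a = b then q i b else 0)"
      by (intro sum.cong refl) (use ze that in auto)
    finally show ?thesis using that by simp
  qed
  have hu: "h i \<bullet>c u j = (if i = j then 1 else 0)" if "i < t" "j < t" for i j
  proof -
    have "h i \<bullet>c u j = (\<Sum>b<t. (h i \<bullet>c e b) * cnj (u j \<bullet>c e b))"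
      by (rule orthonormal_span_parseval[OF e ue[rule_format, OF that(2)] Vc[OF hV]])
    thus ?thesis using cb(1)[OF that] he by (simp add: q_def)
  qed
  have pos: "0 < \<mu> i" if i: "i < t" for i
  proof (rule ccontr)
    assume "\<not> 0 < \<mu> i"
    hence "\<mu> i = 0" using nn[OF i] by simp
    hence "g i \<bullet>c g i = 0" using proj[OF g[OF i] i] gu[OF i i] by simp
    hence "g i = 0\<^sub>v n" using conjugate_square_eq_0_vec[OF gc[OF i]] by simp
    hence "h i \<bullet>c g i = 0" using Vc[OF hV] by simp
    thus False using proj[OF hV i] hu[OF i i] by simp
  qed
  define w where "w i = vec n (\<lambda>r. g i $ r / complex_of_real (\<mu> i) - u i $ r)" for i
  have wc: "w i \<in> carrier_vec n" for i by (simp add: w_def)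
  have wl: "w i \<bullet>c v = (g i \<bullet>c v) / complex_of_real (\<mu> i) - u i \<bullet>c v" if "v \<in> carrier_vec n" for i v
    by (simp add: cscalar_prod_sum[OF that] w_def left_diff_distrib sum_subtractf sum_divide_distrib)
  have wr: "v \<bullet>c w i = (v \<bullet>c g i) / complex_of_real (\<mu> i) - v \<bullet>c u i" if "v \<in> carrier_vec n" "i < t" for i v
    unfolding cscalar_prod_sum[OF wc] cscalar_prod_sum[OF gc[OF that(2)]] cscalar_prod_sum[OF uc[OF that(2)]]
    by (simp add: w_def right_diff_distrib sum_subtractf sum_divide_distrib)
  define \<sigma> where "\<sigma> i = sqrt (1 / \<mu> i - 1)" for i
  have ge1: "0 \<le> 1 / \<mu> i - 1" if "i < t" for i using pos[OF that] le1[OF that] by (simp add: field_simps)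
  have \<sigma>2: "complex_of_real ((\<sigma> i)\<^sup>2) = 1 / complex_of_real (\<mu> i) - 1" if "i < t" for i
    using ge1[OF that] by (simp add: \<sigma>_def)
  have Vw: "v \<bullet>c w j = (v \<bullet>c u j) * complex_of_real ((\<sigma> j)\<^sup>2)" if "v \<in> \<V>" "j < t" for v j
    unfolding wr[OF Vc[OF that(1)] that(2)] proj[OF that] \<sigma>2[OF that(2)] by (simp add: right_diff_distrib)
  have wu: "w i \<bullet>c u j = 0" if "i < t" "j < t" for i j
    unfolding wl[OF uc[OF that(2)]] gu[OF that] orthonormal_familyD(2)[OF u(1) that]
    using pos[OF that(1)] by (cases "i = j") auto
  have uw: "u i \<bullet>c w j = 0" if "i < t" "j < t" for i j
    using cscalar_cnj[OF wc uc[OF that(1)], of j] wu[OF that(2,1)] by simp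
  have 1: "(\<Sum>a<t. q i a * cnj (q j a)) = (if i = j then 1 else 0)" if "i < t" "j < t" for i j
    using cb(1)[OF that] by (simp add: q_def)
  have 3: "w i \<bullet>c w j = (if i = j then complex_of_real ((\<sigma> i)\<^sup>2) else 0)" if "i < t" "j < t" for i j
    unfolding wl[OF wc] Vw[OF g[OF that(1)] that(2)] gu[OF that] uw[OF that]
    using pos[OF that(1)] by (cases "i = j") auto
  have 4: "w i \<bullet>c e a = 0" if "i < t" "a < t" for i a
    unfolding cb(3)[OF wc that(2)] using wu[OF that(1)] by simp
  have 5: "lincomb_fam n t (q i) z \<bullet>c w j = (if i = j then complex_of_real ((\<sigma> i)\<^sup>2) else 0)" if "i < t" "j < t" for i j
    unfolding h_def[symmetric] Vw[OF hV that(2)] hu[OF that] by auto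
  have 6: "lincomb_fam n t (q i) e + w i \<in> \<V>" if i: "i < t" for i
  proof -
    have "lincomb_fam n t (q i) e + w i = lincomb_fam n t (\<lambda>j. if j = i then 1 / complex_of_real (\<mu> i) else 0) g"
    proof (rule eq_vecI)
      fix r assume "r < dim_vec (lincomb_fam n t (\<lambda>j. if j = i then 1 / complex_of_real (\<mu> i) else 0) g)"
      hence r: "r < n" by (simp add: lincomb_fam_def)
      have "lincomb_fam n t (\<lambda>j. if j = i then 1 / complex_of_real (\<mu> i) else 0) g $ r
          = (\<Sum>j<t. if j = i then g i $ r / complex_of_real (\<mu> i) else 0)"
        unfolding lincomb_fam_def index_vec[OF r] by (intro sum.cong refl) simp
      also have "\<dots> = g i $ r / complex_of_real (\<mu> i)" using i by simp
      also have "\<dots> = (u i + w i) $ r" using r uc[OF i] by (simp add: w_def)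
      finally show "(lincomb_fam n t (q i) e + w i) $ r
          = lincomb_fam n t (\<lambda>j. if j = i then 1 / complex_of_real (\<mu> i) else 0) g $ r"
        unfolding u_eq[OF i] by simp
    qed (simp add: w_def lincomb_fam_def)
    thus ?thesis using V_lincomb[OF g] by simp
  qed
  have 7: "0 \<le> \<sigma> i" if "i < t" for i using ge1[OF that] by (simp add: \<sigma>_def)
  have 8: "\<sigma> j \<le> \<sigma> i" if "i \<le> j" "j < t" for i j
    unfolding \<sigma>_def using mono[OF that] pos[of i] that by (simp add: frac_le)
  have 9: "tan_principal_angles n (cspan n (e ` {..<t})) \<V> = map \<sigma> [0..<t]"
    unfolding tan_principal_angles_def \<U>_def[symmetric] pa \<sigma>_def
    by (simp add: tan_arccos_sqrt[OF pos le1])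
  show ?thesis by (rule that[OF 1 wc 3 4 5 6 7 8 9])
qed

section \<open>Bounding the sums of tangents\<close>

lemma contraction_reindex:
  fixes r :: "'c \<Rightarrow> 'b"
  assumes "contraction I J M" "finite I" "finite J" "inj_on r J'" "r ` J' \<subseteq> J"
  shows "contraction I J' (\<lambda>i b. M i (r b))"
  unfolding contraction_def
proof
  fix v :: "'c \<Rightarrow> complex"
  have sub: "contraction I (r ` J') M" by (rule contraction_submatrix[OF assms(1-3) order_refl assms(5)])
  define w where "w b = v (the_inv_into J' r b)" for b
  have w: "w (r b) = v b" if "b \<in> J'" for b
    unfolding w_def using the_inv_into_f_f[OF assms(4) that] by simp
  have "(\<Sum>i\<in>I. (cmod (\<Sum>b\<in>r ` J'. M i b * w b))\<^sup>2) \<le> (\<Sum>b\<in>r ` J'. (cmod (w b))\<^sup>2)"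
    by (rule contractionD[OF sub])
  thus "(\<Sum>i\<in>I. (cmod (\<Sum>b\<in>J'. M i (r b) * v b))\<^sup>2) \<le> (\<Sum>b\<in>J'. (cmod (v b))\<^sup>2)"
    by (simp add: sum.reindex[OF assms(4)] w)
qed

text \<open>
  If \<open>\<sigma> i = 0\<close>, then \<open>w i\<close> vanishes and division by zero returns the zero row, in agreement with the
  factorization of \<open>w\<close>.
\<close>

lemma orthogonal_family_normalized:
  fixes \<sigma> :: "nat \<Rightarrow> real"
  assumes x: "orthonormal_family n n x" and w: "\<And>i. i < t \<Longrightarrow> w i \<in> carrier_vec n"
    and ww: "\<And>i j. i < t \<Longrightarrow> j < t \<Longrightarrow> w i \<bullet>c w j = (if i = j then complex_of_real ((\<sigma> i)\<^sup>2) else 0)"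
  shows "contraction {..<t} {..<n} (\<lambda>i b. (w i \<bullet>c x b) / complex_of_real (\<sigma> i))"
    and "\<And>i b. i < t \<Longrightarrow> b < n \<Longrightarrow>
      w i \<bullet>c x b = complex_of_real (\<sigma> i) * ((w i \<bullet>c x b) / complex_of_real (\<sigma> i))"
proof -
  have pars: "(\<Sum>b<n. (w i \<bullet>c x b) / complex_of_real (\<sigma> i) * cnj ((w j \<bullet>c x b) / complex_of_real (\<sigma> j)))
      = (w i \<bullet>c w j) / (complex_of_real (\<sigma> i) * complex_of_real (\<sigma> j))" if "i < t" "j < t" for i j
    unfolding orthonormal_family_parseval[OF x w[OF that(1)] w[OF that(2)]] sum_divide_distrib
    by (intro sum.cong refl) simp
  show "contraction {..<t} {..<n} (\<lambda>i b. (w i \<bullet>c x b) / complex_of_real (\<sigma> i))"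
  proof (rule contraction_orthogonal_rows)
    fix i j assume "i \<in> {..<t}" "j \<in> {..<t}" "i \<noteq> j"
    thus "(\<Sum>b<n. (w i \<bullet>c x b) / complex_of_real (\<sigma> i) * cnj ((w j \<bullet>c x b) / complex_of_real (\<sigma> j))) = 0"
      using pars[of i j] ww[of i j] by simp
  next
    fix i assume "i \<in> {..<t}"
    hence i: "i < t" by simp
    have "complex_of_real (\<Sum>b<n. (cmod ((w i \<bullet>c x b) / complex_of_real (\<sigma> i)))\<^sup>2)
        = complex_of_real ((\<sigma> i)\<^sup>2 / (\<sigma> i * \<sigma> i))"
      unfolding of_real_sum complex_norm_square pars[OF i i] ww[OF i i] by simp
    hence "(\<Sum>b<n. (cmod ((w i \<bullet>c x b) / complex_of_real (\<sigma> i)))\<^sup>2) = (\<sigma> i)\<^sup>2 / (\<sigma> i * \<sigma> i)"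
      unfolding of_real_eq_iff .
    also have "\<dots> \<le> 1" by (simp add: power2_eq_square)
    finally show "(\<Sum>b<n. (cmod ((w i \<bullet>c x b) / complex_of_real (\<sigma> i)))\<^sup>2) \<le> 1" .
  qed simp
  fix i b assume i: "i < t" and b: "b < n"
  show "w i \<bullet>c x b = complex_of_real (\<sigma> i) * ((w i \<bullet>c x b) / complex_of_real (\<sigma> i))"
  proof (cases "\<sigma> i = 0")
    case True
    hence "w i \<bullet>c w i = 0" using ww[OF i i] by simp
    hence "w i = 0\<^sub>v n" using conjugate_square_eq_0_vec[OF w[OF i]] by simp
    thus ?thesis using orthonormal_familyD(1)[OF x b] by simp
  qed simp
qed

lemma complex_polar: "complex_of_real (cmod z) * sgn z = z"
  by (cases "z = 0") (simp_all add: sgn_eq)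

lemma orthonormal_rows_contraction:
  fixes q :: "nat \<Rightarrow> nat \<Rightarrow> complex"
  assumes q: "\<And>i j. i < t \<Longrightarrow> j < t \<Longrightarrow> (\<Sum>a<s. q i a * cnj (q j a)) = (if i = j then 1 else 0)"
  shows "contraction {..<t} {..<s} q"
proof (rule contraction_orthogonal_rows)
  fix i assume i: "i \<in> {..<t}"
  have "complex_of_real (\<Sum>a<s. (cmod (q i a))\<^sup>2) = complex_of_real 1"
    unfolding of_real_sum complex_norm_square using q[of i i] i by simp
  hence "(\<Sum>a<s. (cmod (q i a))\<^sup>2) = 1" unfolding of_real_eq_iff .
  thus "(\<Sum>a<s. (cmod (q i a))\<^sup>2) \<le> 1" by simp
qed (use q in auto)

text \<open>
  The core of the argument. The family \<open>z\<close> spans \<open>\<Y>\<^sub>\<tau>\<close>, and \<open>z'\<close> is its image under \<open>f(A)\<close>, rescaled so that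
  the component in \<open>\<X>\<^sub>\<tau>\<close> is again an eigenvector. The maps \<open>l\<close> and \<open>r\<close> enumerate \<open>\<tau>\<close> and \<open>{p..<n}\<close> in the
  order in which the weights decrease. Lemma \<open>tangent_vectors\<close> for \<open>\<Y>\<^sub>\<tau>\<close> factors the coordinates of \<open>z\<close> through
  the tangents \<open>\<sigma>\<close>; for \<open>\<V>'\<close> it writes the tangents \<open>\<sigma>'\<close> as diagonal entries of a product to which
  \<open>weighted_cycle_bound\<close> applies.
\<close>

lemma tangent_sum_bound:
  fixes x z z' :: "nat \<Rightarrow> complex vec" and \<phi> :: "nat \<Rightarrow> complex" and l r :: "nat \<Rightarrow> nat"
  assumes x: "orthonormal_family n n x" and pn: "p \<le> n"
    and l: "inj_on l {..<t}" "\<And>a. a < t \<Longrightarrow> l a < p"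
    and r: "bij_betw r {..<m} {p..<n}" and tm: "t \<le> m"
    and c: "\<And>a b. a \<le> b \<Longrightarrow> b < t \<Longrightarrow> cmod (inverse (\<phi> (l b))) \<le> cmod (inverse (\<phi> (l a)))"
    and d: "\<And>a b. a \<le> b \<Longrightarrow> b < m \<Longrightarrow> cmod (\<phi> (r b)) \<le> cmod (\<phi> (r a))"
    and zc: "\<And>a. a < t \<Longrightarrow> z a \<in> carrier_vec n"
    and zx: "\<And>a j. a < t \<Longrightarrow> j < p \<Longrightarrow> z a \<bullet>c x j = (if j = l a then 1 else 0)"
    and zc': "\<And>a. a < t \<Longrightarrow> z' a \<in> carrier_vec n"
    and \<phi>0: "\<And>a. a < t \<Longrightarrow> \<phi> (l a) \<noteq> 0"
    and zx': "\<And>a j. a < t \<Longrightarrow> j < n \<Longrightarrow> z' a \<bullet>c x j = \<phi> j * inverse (\<phi> (l a)) * (z a \<bullet>c x j)"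
    and V': "orthonormal_basis_mat n V' \<V>'" "t \<le> dim_col V'" "\<And>a. a < t \<Longrightarrow> z' a \<in> \<V>'"
  obtains \<sigma> \<sigma>' :: "nat \<Rightarrow> real"
  where "tan_principal_angles n (cspan n ((\<lambda>a. x (l a)) ` {..<t})) (cspan n (z ` {..<t})) = map \<sigma> [0..<t]"
    and "tan_principal_angles n (cspan n ((\<lambda>a. x (l a)) ` {..<t})) \<V>' = map \<sigma>' [0..<t]"
    and "\<And>i. i < t \<Longrightarrow> 0 \<le> \<sigma> i" "\<And>i j. i \<le> j \<Longrightarrow> j < t \<Longrightarrow> \<sigma> j \<le> \<sigma> i"
    and "\<And>i j. i \<le> j \<Longrightarrow> j < t \<Longrightarrow> \<sigma>' j \<le> \<sigma>' i"
    and "\<And>k. k \<le> t \<Longrightarrow> (\<Sum>i<k. \<sigma>' i)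
          \<le> (\<Sum>i<k. cmod (inverse (\<phi> (l i))) * \<sigma> i * cmod (\<phi> (r i)))"
proof -
  define e where "e a = x (l a)" for a
  note xc = orthonormal_familyD(1)[OF x] and xx = orthonormal_familyD(2)[OF x]
  have ln: "l a < n" if "a < t" for a using l(2)[OF that] pn by simp
  have e: "orthonormal_family n t e"
    unfolding orthonormal_family_def e_def
    using xc[OF ln] xx[OF ln ln] inj_onD[OF l(1)] by auto
  note ec = orthonormal_familyD(1)[OF e]
  have ze: "z a \<bullet>c e b = (if a = b then 1 else 0)" if "a < t" "b < t" for a b
    using zx[OF that(1) l(2)[OF that(2)]] inj_onD[OF l(1), of a b] that by (auto simp: e_def)
  have ze': "z' a \<bullet>c e b = (if a = b then 1 else 0)" if "a < t" "b < t" for a b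
    using zx'[OF that(1) ln[OF that(2)]] ze[OF that] \<phi>0[OF that(1)] by (auto simp: e_def)
  define \<V> where "\<V> = cspan n (z ` {..<t})"
  have \<V>: "\<V> = range (\<lambda>c. lincomb_fam n t c z)"
    unfolding \<V>_def by (rule cspan_family) (rule zc)
  obtain V where V: "orthonormal_basis_mat n V \<V>" and dV: "dim_col V = t"
    using biorthogonal_orthonormal_basis[of t z n e, OF zc ec ze] unfolding \<V>_def by blast
  have zV: "z a \<in> \<V>" if "a < t" for a unfolding \<V> by (rule family_in_span[where v = z, OF that zc[OF that]])
  have tV: "t \<le> dim_col V" by (simp add: dV)
  obtain q w \<sigma> where q: "\<And>i j. i < t \<Longrightarrow> j < t \<Longrightarrow> (\<Sum>a<t. q i a * cnj (q j a)) = (if i = j then 1 else 0)"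
    and w: "\<And>i. i < t \<Longrightarrow> w i \<in> carrier_vec n"
    and ww: "\<And>i j. i < t \<Longrightarrow> j < t \<Longrightarrow> w i \<bullet>c w j = (if i = j then complex_of_real ((\<sigma> i)\<^sup>2) else 0)"
    and we: "\<And>i a. i < t \<Longrightarrow> a < t \<Longrightarrow> w i \<bullet>c e a = 0"
    and "\<And>i j. i < t \<Longrightarrow> j < t \<Longrightarrow>
          lincomb_fam n t (q i) z \<bullet>c w j = (if i = j then complex_of_real ((\<sigma> i)\<^sup>2) else 0)"
    and eV: "\<And>i. i < t \<Longrightarrow> lincomb_fam n t (q i) e + w i \<in> \<V>"
    and \<sigma>: "\<And>i. i < t \<Longrightarrow> 0 \<le> \<sigma> i" "\<And>i j. i \<le> j \<Longrightarrow> j < t \<Longrightarrow> \<sigma> j \<le> \<sigma> i"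
    and tan: "tan_principal_angles n (cspan n (e ` {..<t})) \<V> = map \<sigma> [0..<t]"
  proof (rule tangent_vectors[OF e V tV zV ze], goal_cases)
    case (4 q w \<sigma>)
    show thesis by (rule 4(1)[OF 4(2-)])
  qed assumption+
  obtain q' w' \<sigma>' where q': "\<And>i j. i < t \<Longrightarrow> j < t \<Longrightarrow> (\<Sum>a<t. q' i a * cnj (q' j a)) = (if i = j then 1 else 0)"
    and w': "\<And>i. i < t \<Longrightarrow> w' i \<in> carrier_vec n"
    and ww': "\<And>i j. i < t \<Longrightarrow> j < t \<Longrightarrow> w' i \<bullet>c w' j = (if i = j then complex_of_real ((\<sigma>' i)\<^sup>2) else 0)"
    and we': "\<And>i a. i < t \<Longrightarrow> a < t \<Longrightarrow> w' i \<bullet>c e a = 0"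
    and zw': "\<And>i j. i < t \<Longrightarrow> j < t \<Longrightarrow>
          lincomb_fam n t (q' i) z' \<bullet>c w' j = (if i = j then complex_of_real ((\<sigma>' i)\<^sup>2) else 0)"
    and "\<And>i. i < t \<Longrightarrow> lincomb_fam n t (q' i) e + w' i \<in> \<V>'"
    and \<sigma>': "\<And>i. i < t \<Longrightarrow> 0 \<le> \<sigma>' i" "\<And>i j. i \<le> j \<Longrightarrow> j < t \<Longrightarrow> \<sigma>' j \<le> \<sigma>' i"
    and tan': "tan_principal_angles n (cspan n (e ` {..<t})) \<V>' = map \<sigma>' [0..<t]"
  proof (rule tangent_vectors[OF e V'(1,2,3) ze'], goal_cases)
    case (4 q w \<sigma>)
    show thesis by (rule 4(1)[OF 4(2-)])
  qed assumption+
  define P where "P i b = (w i \<bullet>c x b) / complex_of_real (\<sigma> i)" for i b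
  define P' where "P' i b = (w' i \<bullet>c x b) / complex_of_real (\<sigma>' i)" for i b
  have P: "contraction {..<t} {..<n} P" "\<And>i b. i < t \<Longrightarrow> b < n \<Longrightarrow> w i \<bullet>c x b = complex_of_real (\<sigma> i) * P i b"
    unfolding P_def by (rule orthogonal_family_normalized[OF x]; use w ww in blast)+
  have P': "contraction {..<t} {..<n} P'" "\<And>i b. i < t \<Longrightarrow> b < n \<Longrightarrow> w' i \<bullet>c x b = complex_of_real (\<sigma>' i) * P' i b"
    unfolding P'_def by (rule orthogonal_family_normalized[OF x]; use w' ww' in blast)+
  \<comment> \<open>The vector of \<open>\<V>\<close> above a given vector of \<open>\<X>\<^sub>\<tau>\<close> is unique, because \<open>z\<close> is a basis of \<open>\<V>\<close>.\<close>
  have wz: "w i \<bullet>c x b = (\<Sum>a<t. q i a * (z a \<bullet>c x b))" if i: "i < t" and b: "p \<le> b" "b < n" for i b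
  proof -
    define v where "v = lincomb_fam n t (q i) e + w i"
    have vx: "v \<bullet>c y = lincomb_fam n t (q i) e \<bullet>c y + w i \<bullet>c y" if "y \<in> carrier_vec n" for y
      unfolding v_def by (rule add_scalar_prod_distrib[OF lincomb_fam_carrier w[OF i]]) (use that in simp)
    obtain C where C: "v = lincomb_fam n t C z" using eV[OF i] unfolding \<V> v_def by blast
    have Cq: "C a = q i a" if a: "a < t" for a
    proof -
      have "v \<bullet>c e a = (\<Sum>j<t. C j * (z j \<bullet>c e a))"
        unfolding C by (rule lincomb_fam_cscalar[OF zc ec[OF a]])
      also have "\<dots> = (\<Sum>j<t. if j = a then C a else 0)"
        by (intro sum.cong refl) (use ze a in auto)
      finally have "v \<bullet>c e a = C a" using a by simp
      moreover have "v \<bullet>c e a = q i a"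
        unfolding vx[OF ec[OF a]] lincomb_fam_cscalar_orthonormal[OF e a] we[OF i a] by simp
      ultimately show ?thesis by simp
    qed
    have "lincomb_fam n t (q i) e \<bullet>c x b = (\<Sum>a<t. q i a * (e a \<bullet>c x b))"
      by (rule lincomb_fam_cscalar[OF ec xc[OF b(2)]])
    also have "\<dots> = 0"
    proof (intro sum.neutral ballI)
      fix a assume "a \<in> {..<t}"
      hence a: "a < t" by simp
      show "q i a * (e a \<bullet>c x b) = 0"
        unfolding e_def xx[OF ln[OF a] b(2)] using l(2)[OF a] b(1) by simp
    qed
    finally have "w i \<bullet>c x b = v \<bullet>c x b" unfolding vx[OF xc[OF b(2)]] by simp
    also have "\<dots> = (\<Sum>a<t. C a * (z a \<bullet>c x b))"
      unfolding C by (rule lincomb_fam_cscalar[OF zc xc[OF b(2)]])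
    finally show ?thesis using Cq by simp
  qed
  \<comment> \<open>Inverting the unitary matrix \<open>q\<close> gives the singular value decomposition of \<open>Z\<^sub>\<tau>\<close>.\<close>
  have zP: "z a \<bullet>c x b = (\<Sum>j<t. cnj (q j a) * (complex_of_real (\<sigma> j) * P j b))"
    if a: "a < t" and b: "p \<le> b" "b < n" for a b
  proof -
    have "(\<Sum>j<t. cnj (q j a) * (complex_of_real (\<sigma> j) * P j b))
        = (\<Sum>j<t. \<Sum>a'<t. (z a' \<bullet>c x b) * (q j a' * cnj (q j a)))"
    proof (intro sum.cong refl)
      fix j assume "j \<in> {..<t}"
      hence j: "j < t" by simp
      show "cnj (q j a) * (complex_of_real (\<sigma> j) * P j b) = (\<Sum>a'<t. (z a' \<bullet>c x b) * (q j a' * cnj (q j a)))"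
        unfolding P(2)[OF j b(2), symmetric] wz[OF j b] by (simp add: sum_distrib_left mult_ac)
    qed
    also have "\<dots> = (\<Sum>a'<t. \<Sum>j<t. (z a' \<bullet>c x b) * (q j a' * cnj (q j a)))" by (rule sum.swap)
    also have "\<dots> = (\<Sum>a'<t. (z a' \<bullet>c x b) * (\<Sum>j<t. q j a' * cnj (q j a)))"
      by (simp add: sum_distrib_left)
    also have "\<dots> = (\<Sum>a'<t. if a' = a then z a \<bullet>c x b else 0)"
      by (intro sum.cong refl) (use orthonormal_array_transpose[OF q _ a] in auto)
    finally show ?thesis using a by simp
  qed
  have rr: "p \<le> r b \<and> r b < n" if "b < m" for b using bij_betwE[OF r] that by auto
  have zw: "z' a \<bullet>c w' i = complex_of_real (\<sigma>' i) * (\<Sum>b<m. (z' a \<bullet>c x (r b)) * cnj (P' i (r b)))"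
    if a: "a < t" and i: "i < t" for a i
  proof -
    \<comment> \<open>For an index \<open>b < p\<close> one of the factors vanishes: \<open>z' a\<close> has the single component \<open>l a\<close> there, and \<open>w' i\<close> is orthogonal to \<open>\<X>\<^sub>\<tau>\<close>.\<close>
    have "z' a \<bullet>c w' i = (\<Sum>b<n. (z' a \<bullet>c x b) * cnj (w' i \<bullet>c x b))"
      by (rule orthonormal_family_parseval[OF x zc'[OF a] w'[OF i]])
    also have "\<dots> = (\<Sum>b\<in>{p..<n}. (z' a \<bullet>c x b) * cnj (w' i \<bullet>c x b))"
    proof (rule sum.mono_neutral_right)
      show "\<forall>b\<in>{..<n} - {p..<n}. (z' a \<bullet>c x b) * cnj (w' i \<bullet>c x b) = 0"
      proof
        fix b assume "b \<in> {..<n} - {p..<n}"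
        hence b: "b < p" "b < n" by auto
        show "(z' a \<bullet>c x b) * cnj (w' i \<bullet>c x b) = 0"
        proof (cases "b = l a")
          case True
          thus ?thesis using we'[OF i a] by (simp add: e_def)
        next
          case False
          thus ?thesis using zx'[OF a b(2)] zx[OF a b(1)] by simp
        qed
      qed
    qed auto
    also have "\<dots> = (\<Sum>b<m. (z' a \<bullet>c x (r b)) * cnj (w' i \<bullet>c x (r b)))"
      by (rule sum.reindex_bij_betw[OF r, symmetric])
    also have "\<dots> = (\<Sum>b<m. complex_of_real (\<sigma>' i) * ((z' a \<bullet>c x (r b)) * cnj (P' i (r b))))"
      by (intro sum.cong refl) (use rr in \<open>simp add: P'(2)[OF i]\<close>)
    finally show ?thesis by (simp add: sum_distrib_left)
  qed
  have \<sigma>'_eq: "complex_of_real (\<sigma>' i) = (\<Sum>a<t. \<Sum>b<m. q' i a * (z' a \<bullet>c x (r b)) * cnj (P' i (r b)))"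
    if i: "i < t" for i
  proof (cases "\<sigma>' i = 0")
    case True
    thus ?thesis by (simp add: P'_def)
  next
    case False
    have "complex_of_real (\<sigma>' i) * complex_of_real (\<sigma>' i) = lincomb_fam n t (q' i) z' \<bullet>c w' i"
      using zw'[OF i i] by (simp add: power2_eq_square)
    also have "\<dots> = (\<Sum>a<t. q' i a * (z' a \<bullet>c w' i))"
      by (rule lincomb_fam_cscalar[OF zc' w'[OF i]])
    also have "\<dots> = complex_of_real (\<sigma>' i) * (\<Sum>a<t. \<Sum>b<m. q' i a * (z' a \<bullet>c x (r b)) * cnj (P' i (r b)))"
      unfolding sum_distrib_left
      by (intro sum.cong refl) (simp add: zw[OF _ i] sum_distrib_left mult_ac)
    finally show ?thesis using False by simp
  qed
  \<comment> \<open>The moduli of \<open>\<phi>\<close> become the weights; the phases stay with the contractions.\<close>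
  define \<alpha> where "\<alpha> i a = q' i a * sgn (inverse (\<phi> (l a)))" for i a
  define \<beta> where "\<beta> a j = cnj (q j a)" for a j
  define \<gamma> where "\<gamma> j b = P j (r b) * sgn (\<phi> (r b))" for j b
  define \<delta> where "\<delta> b i = cnj (P' i (r b))" for b i
  have rinj: "inj_on r {..<m}" "r ` {..<m} \<subseteq> {..<n}"
    using r by (auto simp: bij_betw_def)
  have expand: "complex_of_real (\<sigma>' i) = (\<Sum>a<t. \<Sum>j<t. \<Sum>b<m.
      complex_of_real (cmod (inverse (\<phi> (l a))) * \<sigma> j * cmod (\<phi> (r b))) * (\<alpha> i a * \<beta> a j * \<gamma> j b * \<delta> b i))"
    if i: "i < t" for i
  proof -
    have "q' i a * (z' a \<bullet>c x (r b)) * cnj (P' i (r b)) = (\<Sum>j<t.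
      complex_of_real (cmod (inverse (\<phi> (l a))) * \<sigma> j * cmod (\<phi> (r b))) * (\<alpha> i a * \<beta> a j * \<gamma> j b * \<delta> b i))"
      if a: "a < t" and b: "b < m" for a b
    proof -
      have rb: "p \<le> r b" "r b < n" using rr[OF b] by auto
      define A B where "A = inverse (\<phi> (l a))" and "B = \<phi> (r b)"
      have "q' i a * (z' a \<bullet>c x (r b)) * cnj (P' i (r b))
          = q' i a * (B * A * (\<Sum>j<t. cnj (q j a) * (complex_of_real (\<sigma> j) * P j (r b)))) * cnj (P' i (r b))"
        unfolding zx'[OF a rb(2)] zP[OF a rb] A_def B_def ..
      also have "\<dots> = (\<Sum>j<t. q' i a * (B * A * (cnj (q j a) * (complex_of_real (\<sigma> j) * P j (r b)))) * cnj (P' i (r b)))"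
        by (simp only: sum_distrib_left sum_distrib_right)
      also have "\<dots> = (\<Sum>j<t. complex_of_real (cmod A * \<sigma> j * cmod B) *
          (q' i a * sgn A * cnj (q j a) * (P j (r b) * sgn B) * cnj (P' i (r b))))"
      proof (intro sum.cong refl)
        fix j
        have "complex_of_real (cmod A * \<sigma> j * cmod B) *
            (q' i a * sgn A * cnj (q j a) * (P j (r b) * sgn B) * cnj (P' i (r b)))
          = q' i a * ((complex_of_real (cmod B) * sgn B) * (complex_of_real (cmod A) * sgn A) *
              (cnj (q j a) * (complex_of_real (\<sigma> j) * P j (r b)))) * cnj (P' i (r b))"
          by (simp only: of_real_mult mult_ac)
        thus "q' i a * (B * A * (cnj (q j a) * (complex_of_real (\<sigma> j) * P j (r b)))) * cnj (P' i (r b))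
          = complex_of_real (cmod A * \<sigma> j * cmod B) *
            (q' i a * sgn A * cnj (q j a) * (P j (r b) * sgn B) * cnj (P' i (r b)))"
          by (simp only: complex_polar)
      qed
      finally show ?thesis unfolding \<alpha>_def \<beta>_def \<gamma>_def \<delta>_def A_def B_def .
    qed
    hence "complex_of_real (\<sigma>' i) = (\<Sum>a<t. \<Sum>b<m. \<Sum>j<t.
      complex_of_real (cmod (inverse (\<phi> (l a))) * \<sigma> j * cmod (\<phi> (r b))) * (\<alpha> i a * \<beta> a j * \<gamma> j b * \<delta> b i))"
      unfolding \<sigma>'_eq[OF i] by (intro sum.cong refl) simp
    thus ?thesis by (subst (asm) sum.swap) simp
  qed
  have bound: "(\<Sum>i<k. \<sigma>' i) \<le> (\<Sum>i<k. cmod (inverse (\<phi> (l i))) * \<sigma> i * cmod (\<phi> (r i)))" if k: "k \<le> t" for k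
  proof -
    have "complex_of_real (\<Sum>i<k. \<sigma>' i) = (\<Sum>i<k. \<Sum>a<t. \<Sum>j<t. \<Sum>b<m.
      complex_of_real (cmod (inverse (\<phi> (l a))) * \<sigma> j * cmod (\<phi> (r b))) * (\<alpha> i a * \<beta> a j * \<gamma> j b * \<delta> b i))"
      unfolding of_real_sum by (intro sum.cong refl expand) (use k in simp)
    hence "(\<Sum>i<k. \<sigma>' i) = Re (\<Sum>i<k. \<Sum>a<t. \<Sum>j<t. \<Sum>b<m.
      complex_of_real (cmod (inverse (\<phi> (l a))) * \<sigma> j * cmod (\<phi> (r b))) * (\<alpha> i a * \<beta> a j * \<gamma> j b * \<delta> b i))"
      by (metis Re_complex_of_real)
    also have "\<dots> \<le> (\<Sum>i<k. cmod (inverse (\<phi> (l i))) * \<sigma> i * cmod (\<phi> (r i)))"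
    proof (rule weighted_cycle_bound)
      have "contraction {..<t} {..<t} \<alpha>"
        unfolding \<alpha>_def
        by (rule contraction_scale_cols[OF orthonormal_rows_contraction[OF q']]) (auto simp: norm_inverse norm_sgn)
      thus "contraction {..<k} {..<t} \<alpha>" by (rule contraction_submatrix) (use k in auto)
      show "contraction {..<t} {..<t} \<beta>"
        unfolding \<beta>_def by (rule contraction_adjoint[OF orthonormal_rows_contraction[OF q]])
      show "contraction {..<t} {..<m} \<gamma>"
        unfolding \<gamma>_def
        by (rule contraction_scale_cols[OF contraction_reindex[OF P(1) _ _ rinj]]) (auto simp: norm_inverse norm_sgn)
      have "contraction {..<m} {..<t} \<delta>"
        unfolding \<delta>_def
        by (rule contraction_adjoint[OF contraction_reindex[OF P'(1) _ _ rinj]]) auto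
      thus "contraction {..<m} {..<k} \<delta>" by (rule contraction_submatrix) (use k in auto)
    qed (use c d \<sigma> tm k in auto)
    finally show ?thesis .
  qed
  show ?thesis
    by (rule that[OF tan[unfolded e_def \<V>_def] tan'[unfolded e_def] \<sigma> \<sigma>'(2) bound])
qed

section \<open>Decreasing rearrangements and weak majorization\<close>

lemma sort_key_map: "sort (map f xs) = map f (sort_key f xs)"
  by (rule properties_for_sort) simp_all

text \<open>
  Sorting the indices by the value of \<open>f\<close> turns a decreasing rearrangement into a reindexing.
\<close>

lemma decreasing_enumeration:
  fixes f :: "'a \<Rightarrow> real"
  assumes "distinct xs"
  obtains e where "bij_betw e {..<length xs} (set xs)"
    and "decreasing_rearr (map f xs) = map (\<lambda>i. f (e i)) [0..<length xs]"
    and "\<And>i j. i \<le> j \<Longrightarrow> j < length xs \<Longrightarrow> f (e j) \<le> f (e i)"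
proof -
  define L where "L = rev (sort_key f xs)"
  have len: "length L = length xs" and dist: "distinct L" and set: "set L = set xs"
    using assms by (simp_all add: L_def)
  have map_eq: "decreasing_rearr (map f xs) = map f L"
    by (simp add: decreasing_rearr_def sort_key_map L_def rev_map)
  have "bij_betw (\<lambda>i. L ! i) {..<length xs} (set xs)"
    by (rule bij_betw_nth[OF dist]) (simp_all add: len set)
  moreover have "decreasing_rearr (map f xs) = map (\<lambda>i. f (L ! i)) [0..<length xs]"
    unfolding map_eq by (rule nth_equalityI) (simp_all add: len)
  moreover have "f (L ! j) \<le> f (L ! i)" if "i \<le> j" "j < length xs" for i j
  proof -
    have "sorted (map f (sort_key f xs))" by simp
    hence "sorted (rev (map f L))" by (simp add: L_def rev_map)
    from sorted_rev_nth_mono[OF this that(1)] show ?thesis using that len by simp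
  qed
  ultimately show ?thesis by (rule that)
qed

lemma decreasing_rearr_decreasing:
  assumes "\<And>i j. i \<le> j \<Longrightarrow> j < t \<Longrightarrow> a j \<le> a i"
  shows "decreasing_rearr (map a [0..<t]) = map a [0..<t]"
proof -
  have "sorted (rev (map a [0..<t]))"
    unfolding sorted_rev_iff_nth_mono using assms by simp
  hence "sort (rev (map a [0..<t])) = rev (map a [0..<t])" by (rule sorted_sort_id)
  moreover have "sort (rev (map a [0..<t])) = sort (map a [0..<t])"
    by (rule properties_for_sort) simp_all
  ultimately show ?thesis by (simp add: decreasing_rearr_def)
qed

lemma weakly_majorized_decreasing:
  assumes a: "\<And>i j. i \<le> j \<Longrightarrow> j < t \<Longrightarrow> a j \<le> a i"
    and b: "\<And>i j. i \<le> j \<Longrightarrow> j < t \<Longrightarrow> b j \<le> b i"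
    and sums: "\<And>k. k \<le> t \<Longrightarrow> (\<Sum>i<k. a i) \<le> (\<Sum>i<k. b i)"
  shows "map a [0..<t] \<prec>\<^sub>w map b [0..<t]"
proof -
  have pre: "sum_list (take k (map g [0..<t])) = (\<Sum>i<k. g i)" if "k \<le> t" for k and g :: "nat \<Rightarrow> real"
    using that by (simp add: take_map interv_sum_list_conv_sum_set_nat atLeast0LessThan)
  have "decreasing_rearr (map a [0..<t]) = map a [0..<t]"
    by (rule decreasing_rearr_decreasing) (rule a)
  moreover have "decreasing_rearr (map b [0..<t]) = map b [0..<t]"
    by (rule decreasing_rearr_decreasing) (rule b)
  ultimately show ?thesis
    unfolding weakly_majorized_def using sums by (simp add: pre)
qed

section \<open>The majorization of the tangents\<close>

lemma mult_mat_lincomb_fam: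
  assumes M: "M \<in> carrier_mat n n" and y: "\<And>i. i < k \<Longrightarrow> y i \<in> carrier_vec n"
  shows "M *\<^sub>v lincomb_fam n k c y = lincomb_fam n k c (\<lambda>i. M *\<^sub>v y i)"
proof (rule eq_vecI)
  fix r assume "r < dim_vec (lincomb_fam n k c (\<lambda>i. M *\<^sub>v y i))"
  hence r: "r < n" by (simp add: lincomb_fam_def)
  have "(M *\<^sub>v lincomb_fam n k c y) $ r = (\<Sum>s<n. \<Sum>i<k. c i * (M $$ (r, s) * y i $ s))"
    unfolding mult_mat_vec_index[OF M lincomb_fam_carrier r]
    by (intro sum.cong refl) (simp add: lincomb_fam_def sum_distrib_left mult_ac)
  also have "\<dots> = (\<Sum>i<k. \<Sum>s<n. c i * (M $$ (r, s) * y i $ s))" by (rule sum.swap)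
  also have "\<dots> = (\<Sum>i<k. c i * (M *\<^sub>v y i) $ r)"
    by (intro sum.cong refl) (simp add: mult_mat_vec_index[OF M y r] sum_distrib_left)
  finally show "(M *\<^sub>v lincomb_fam n k c y) $ r = lincomb_fam n k c (\<lambda>i. M *\<^sub>v y i) $ r"
    using r by (simp add: lincomb_fam_def)
qed (use M in \<open>simp add: lincomb_fam_def\<close>)

theorem theorem3p5:
  fixes A :: "complex mat" and n p :: nat
    and lam :: "nat \<Rightarrow> complex" and x y :: "nat \<Rightarrow> complex vec"
    and \<X> \<Y> \<Y>' \<X>\<tau> \<Y>\<tau> :: "complex vec set" and Yt :: "complex mat"
    and f :: "complex \<Rightarrow> complex" and \<tau> :: "nat set"
    and \<Phi>\<tau> \<Phi>hat :: "real list"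
  assumes "A \<in> carrier_mat n n" and "normal_mat A"
    and "orthonormal_eigensystem A lam x"
    and "1 \<le> p" and "2 * p \<le> n"
    and "lam ` {..<p} \<inter> lam ` {p..<n} = {}"
    and "\<X> = cspan n (x ` {..<p})"
    and "csubspace n \<Y>" and "cdim n \<Y> = p"
    and "largest_angle n \<X> \<Y> < pi / 2"
    and "Max ((\<lambda>j. cmod (f (lam j))) ` {p..<n}) < Min ((\<lambda>j. cmod (f (lam j))) ` {..<p})"
    and "\<Y>' = (\<lambda>v. normal_mat_fun f A *\<^sub>v v) ` \<Y>"
    and "orthonormal_basis_mat n Yt \<Y>"
    and "y = biorthogonal_basis (mat_of_cols n (map x [0..<p])) Yt"
    and "\<tau> \<subseteq> {..<p}"
    and "\<X>\<tau> = cspan n (x ` \<tau>)" and "\<Y>\<tau> = cspan n (y ` \<tau>)"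
    and "\<Phi>\<tau> = decreasing_rearr (map (\<lambda>i. inverse (cmod (f (lam i)))) (sorted_list_of_set \<tau>))"
    and "\<Phi>hat = decreasing_rearr (map (\<lambda>j. cmod (f (lam j))) [p..<n])"
  shows "tan_principal_angles n \<X>\<tau> \<Y>' \<prec>\<^sub>w
         \<Phi>\<tau> \<odot>\<^sub>t take (card \<tau>) \<Phi>hat \<odot>\<^sub>t tan_principal_angles n \<X>\<tau> \<Y>\<tau>"
proof -
  note A = assms(1) and es = assms(3) and p1 = assms(4) and pn2 = assms(5)
  note x = orthonormal_eigensystemD(1)[OF A es]
  define \<phi> where "\<phi> j = f (lam j)" for j
  have pn: "p \<le> n" using pn2 by simp
  have xp: "orthonormal_family n p x"
    using x pn unfolding orthonormal_family_def by simp
  note xc = orthonormal_familyD(1)[OF x]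
  have dY: "dim_col Yt = p"
    using dim_col_orthonormal_basis_mat[OF assms(8,13)] assms(9) by simp
  note bi = biorthogonal_basis_props[OF xp assms(13) dY p1 assms(10)[unfolded assms(7)], folded assms(14)]
  have \<phi>0: "\<phi> i \<noteq> 0" if "i < p" for i
  proof -
    \<comment> \<open>Index \<open>p\<close> lies in \<open>{p..<n}\<close>, so the maximum is nonnegative and the minimum positive.\<close>
    have "0 \<le> cmod (f (lam p))" by simp
    also have "\<dots> \<le> Max ((\<lambda>j. cmod (f (lam j))) ` {p..<n})"
      using p1 pn2 by (intro Max_ge) auto
    also have "\<dots> < Min ((\<lambda>j. cmod (f (lam j))) ` {..<p})" by (rule assms(11))
    also have "\<dots> \<le> cmod (f (lam i))" using that by (intro Min_le) auto
    finally show ?thesis by (simp add: \<phi>_def)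
  qed
  define M where "M = normal_mat_fun f A"
  have M_eq: "M = rank_one_sum n \<phi> x"
    unfolding M_def \<phi>_def by (rule normal_mat_fun_eq[OF A es])
  have M: "M \<in> carrier_mat n n" unfolding M_eq by simp
  \<comment> \<open>A sum with one term scales \<open>M y\<^sub>i\<close> while staying in the carrier for every \<open>i\<close>.\<close>
  define y' where "y' i = lincomb_fam n 1 (\<lambda>_. inverse (\<phi> i)) (\<lambda>_. M *\<^sub>v y i)" for i
  have Myc: "M *\<^sub>v y i \<in> carrier_vec n" if "i < p" for i
    by (rule mult_mat_vec_carrier[OF M bi(1)[OF that]])
  have y'c: "y' i \<in> carrier_vec n" for i by (simp add: y'_def)
  have y'x: "y' i \<bullet>c x j = \<phi> j * inverse (\<phi> i) * (y i \<bullet>c x j)" if "i < p" "j < n" for i j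
  proof -
    have "y' i \<bullet>c x j = (\<Sum>k<1::nat. inverse (\<phi> i) * ((M *\<^sub>v y i) \<bullet>c x j))"
      unfolding y'_def by (rule lincomb_fam_cscalar) (use Myc[OF that(1)] xc[OF that(2)] in auto)
    also have "(M *\<^sub>v y i) \<bullet>c x j = \<phi> j * (y i \<bullet>c x j)"
      unfolding M_eq rank_one_sum_mult_vec[OF x bi(1)[OF that(1)]]
      by (rule lincomb_fam_cscalar_orthonormal[OF x that(2)])
    finally show ?thesis by simp
  qed
  have y'x': "y' i \<bullet>c x a = (if i = a then 1 else 0)" if "i < p" "a < p" for i a
    using y'x[of i a] bi(2)[OF that] \<phi>0 that pn by auto
  have y'_index: "y' i $ r = inverse (\<phi> i) * (M *\<^sub>v y i) $ r" if "r < n" for i r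
    using that by (simp add: y'_def lincomb_fam_def)
  have Y': "\<Y>' = cspan n (y' ` {..<p})"
  proof -
    have My: "M *\<^sub>v lincomb_fam n p c y = lincomb_fam n p c (\<lambda>i. M *\<^sub>v y i)" for c
      by (rule mult_mat_lincomb_fam[OF M]) (rule bi(1))
    have fwd: "M *\<^sub>v lincomb_fam n p c y = lincomb_fam n p (\<lambda>i. c i * \<phi> i) y'" for c
      unfolding My unfolding lincomb_fam_def
      by (intro eq_vecI) (auto simp: y'_index \<phi>0 intro!: sum.cong)
    have bwd: "lincomb_fam n p c y' = M *\<^sub>v lincomb_fam n p (\<lambda>i. c i * inverse (\<phi> i)) y" for c
      unfolding My unfolding lincomb_fam_def
      by (intro eq_vecI) (auto simp: y'_index intro!: sum.cong)
    have "cspan n (y' ` {..<p}) = range (\<lambda>c. lincomb_fam n p c y')"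
      by (rule cspan_family) (rule y'c)
    also have "\<dots> = (\<lambda>v. M *\<^sub>v v) ` range (\<lambda>c. lincomb_fam n p c y)"
    proof (intro equalityI subsetI)
      fix v assume "v \<in> range (\<lambda>c. lincomb_fam n p c y')"
      then obtain c where "v = lincomb_fam n p c y'" by blast
      thus "v \<in> (\<lambda>v. M *\<^sub>v v) ` range (\<lambda>c. lincomb_fam n p c y)" unfolding bwd by blast
    next
      fix v assume "v \<in> (\<lambda>v. M *\<^sub>v v) ` range (\<lambda>c. lincomb_fam n p c y)"
      then obtain c where "v = M *\<^sub>v lincomb_fam n p c y" by blast
      thus "v \<in> range (\<lambda>c. lincomb_fam n p c y')" unfolding fwd by blast
    qed
    finally show ?thesis using assms(12) bi(3) by (simp add: M_def)
  qed
  obtain V' where V': "orthonormal_basis_mat n V' \<Y>'" "dim_col V' = p"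
    using biorthogonal_orthonormal_basis[of p y' n x] y'c xc pn y'x' unfolding Y' by auto
  have y'Y: "y' i \<in> \<Y>'" if "i < p" for i
  proof -
    have "cspan n (y' ` {..<p}) = range (\<lambda>c. lincomb_fam n p c y')"
      by (rule cspan_family) (rule y'c)
    thus ?thesis using family_in_span[where v = y', OF that y'c] unfolding Y' by simp
  qed
  define t where "t = card \<tau>"
  define m where "m = n - p"
  have fin: "finite \<tau>" using assms(15) finite_subset by blast
  have tp: "t \<le> p" using card_mono[OF _ assms(15)] by (simp add: t_def)
  have tm: "t \<le> m" using tp pn2 by (simp add: m_def)
  have dist: "distinct (sorted_list_of_set \<tau>)" by simp
  have len: "length (sorted_list_of_set \<tau>) = t" "length [p..<n] = m" by (simp_all add: t_def m_def)
  obtain l where l: "bij_betw l {..<t} \<tau>"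
    and lmap: "\<Phi>\<tau> = map (\<lambda>i. inverse (cmod (\<phi> (l i)))) [0..<t]"
    and ldec: "\<And>i j. i \<le> j \<Longrightarrow> j < t \<Longrightarrow> inverse (cmod (\<phi> (l j))) \<le> inverse (cmod (\<phi> (l i)))"
    using decreasing_enumeration[OF dist, of "\<lambda>i. inverse (cmod (\<phi> i))"] fin
    unfolding len assms(18) \<phi>_def set_sorted_list_of_set[OF fin] by metis
  obtain r where r: "bij_betw r {..<m} {p..<n}"
    and rmap: "\<Phi>hat = map (\<lambda>i. cmod (\<phi> (r i))) [0..<m]"
    and rdec: "\<And>i j. i \<le> j \<Longrightarrow> j < m \<Longrightarrow> cmod (\<phi> (r j)) \<le> cmod (\<phi> (r i))"
    using decreasing_enumeration[OF distinct_upt, of p n "\<lambda>i. cmod (\<phi> i)"]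
    unfolding len assms(19) \<phi>_def set_upt by metis
  have linj: "inj_on l {..<t}" and limg: "l ` {..<t} = \<tau>" using l by (auto simp: bij_betw_def)
  have lp: "l a < p" if "a < t" for a using limg assms(15) that by blast
  have X\<tau>: "\<X>\<tau> = cspan n ((\<lambda>a. x (l a)) ` {..<t})"
    unfolding assms(16) limg[symmetric] image_image ..
  have Y\<tau>: "\<Y>\<tau> = cspan n ((\<lambda>a. y (l a)) ` {..<t})"
    unfolding assms(17) limg[symmetric] image_image ..
  have cdec: "cmod (inverse (\<phi> (l j))) \<le> cmod (inverse (\<phi> (l i)))" if "i \<le> j" "j < t" for i j
    using ldec[OF that] by (simp add: norm_inverse)
  have yx: "y (l a) \<bullet>c x j = (if j = l a then 1 else 0)" if "a < t" "j < p" for a j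
    using bi(2)[OF lp[OF that(1)] that(2)] by auto
  have tV': "t \<le> dim_col V'" using V'(2) tp by simp
  obtain \<sigma> \<sigma>' where tan\<tau>: "tan_principal_angles n \<X>\<tau> \<Y>\<tau> = map \<sigma> [0..<t]"
    and tan': "tan_principal_angles n \<X>\<tau> \<Y>' = map \<sigma>' [0..<t]"
    and \<sigma>: "\<And>i. i < t \<Longrightarrow> 0 \<le> \<sigma> i" "\<And>i j. i \<le> j \<Longrightarrow> j < t \<Longrightarrow> \<sigma> j \<le> \<sigma> i"
    and \<sigma>': "\<And>i j. i \<le> j \<Longrightarrow> j < t \<Longrightarrow> \<sigma>' j \<le> \<sigma>' i"
    and bound: "\<And>k. k \<le> t \<Longrightarrow> (\<Sum>i<k. \<sigma>' i)
          \<le> (\<Sum>i<k. cmod (inverse (\<phi> (l i))) * \<sigma> i * cmod (\<phi> (r i)))"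
    unfolding X\<tau> Y\<tau>
    by (rule tangent_sum_bound[of n x p l t r m \<phi> "\<lambda>a. y (l a)" "\<lambda>a. y' (l a)" V' \<Y>'])
      (use x pn linj lp r tm cdec rdec bi(1) yx y'c \<phi>0 y'x V'(1) tV' y'Y in auto)
  have takeR: "take t \<Phi>hat = map (\<lambda>i. cmod (\<phi> (r i))) [0..<t]"
    unfolding rmap using tm by (simp add: take_map)
  define b where "b i = inverse (cmod (\<phi> (l i))) * cmod (\<phi> (r i)) * \<sigma> i" for i
  have rhs: "\<Phi>\<tau> \<odot>\<^sub>t take (card \<tau>) \<Phi>hat \<odot>\<^sub>t tan_principal_angles n \<X>\<tau> \<Y>\<tau> = map b [0..<t]"
    unfolding t_def[symmetric] takeR tan\<tau> lmap tuple_mult_def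
    by (rule nth_equalityI) (simp_all add: b_def)
  show ?thesis
    unfolding rhs tan'
  proof (rule weakly_majorized_decreasing[OF \<sigma>'])
    fix i j assume ij: "i \<le> j" "j < t"
    show "b j \<le> b i"
      unfolding b_def
      by (intro mult_mono ldec rdec \<sigma> mult_nonneg_nonneg) (use ij tm in auto)
  next
    fix k assume "k \<le> t"
    thus "(\<Sum>i<k. \<sigma>' i) \<le> (\<Sum>i<k. b i)"
      using bound[of k] by (simp add: b_def norm_inverse mult_ac)
  qed
qed

end
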